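(* Let $\Omega\subset\mathbb{R}^n$ be a bounded open convex set and $\varphi:\Omega\to(0,\infty)$ a $C^2$ concave function with $-D^2\varphi$ positive definite on $\Omega$. For $\beta>-1$ let $d\nu_\beta=\frac{\varphi(x)^\beta}{\int_\Omega\varphi^\beta}dx$ on $\Omega$. Then for every $\beta>-1$ and every locally Lipschitz $f\in L^2(\nu_\beta)$, $$\mathrm{Var}_{\nu_\beta}(f)\le\frac1{\beta+1}\int_\Omega\langle(-D^2\varphi)^{-1}\nabla f,\nabla f\rangle\,\varphi\,d\nu_\beta .$$ Moreover, for every $\beta>0$ and every bounded smooth function $f$ on $\Omega$, $$\inf_{c\in\mathbb{R}}\int_\Omega\frac{|f(x)-c|^2}{\varphi(x)}\,d\nu_\beta\le\frac1\beta\int_\Omega\langle(-D^2\varphi)^{-1}\nabla f,\nabla f\rangle\,d\nu_\beta .$$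
   Context: For a probability measure $\mu$, $\mathrm{Var}_\mu(f)=\int f^2d\mu-(\int f\,d\mu)^2$; $\langle\cdot,\cdot\rangle$ is the Euclidean inner product. *)

theory Defs
  imports "HOL-Analysis.Analysis"
begin

definition grad :: "(real^'n \<Rightarrow> real) \<Rightarrow> real^'n \<Rightarrow> real^'n" where
  "grad f x = (if \<exists>g. (f has_derivative (\<lambda>h. g \<bullet> h)) (at x)
               then (SOME g. (f has_derivative (\<lambda>h. g \<bullet> h)) (at x)) else 0)"

definition hess :: "(real^'n \<Rightarrow> real) \<Rightarrow> real^'n \<Rightarrow> real^'n^'n" where
  "hess f x = (if \<exists>M. (grad f has_derivative (\<lambda>h. M *v h)) (at x)
               then (SOME M. (grad f has_derivative (\<lambda>h. M *v h)) (at x)) else 0)"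

definition C2_on :: "(real^'n) set \<Rightarrow> (real^'n \<Rightarrow> real) \<Rightarrow> bool" where
  "C2_on U f \<longleftrightarrow> (\<forall>x\<in>U. f differentiable (at x) \<and> grad f differentiable (at x))
                 \<and> continuous_on U (hess f)"

definition pd :: "'n \<Rightarrow> (real^'n \<Rightarrow> real) \<Rightarrow> real^'n \<Rightarrow> real" where
  "pd i g x = (if \<exists>d. ((\<lambda>t. g (x + t *\<^sub>R axis i 1)) has_real_derivative d) (at 0)
               then (SOME d. ((\<lambda>t. g (x + t *\<^sub>R axis i 1)) has_real_derivative d) (at 0)) else 0)"

fun iter_pd :: "'n list \<Rightarrow> (real^'n \<Rightarrow> real) \<Rightarrow> real^'n \<Rightarrow> real" where
  "iter_pd [] f = f"
| "iter_pd (i # is) f = pd i (iter_pd is f)"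

definition smooth_on :: "(real^'n) set \<Rightarrow> (real^'n \<Rightarrow> real) \<Rightarrow> bool" where
  "smooth_on U f \<longleftrightarrow> (\<forall>is. continuous_on U (iter_pd is f) \<and>
      (\<forall>i. \<forall>x\<in>U. \<exists>d. ((\<lambda>t. iter_pd is f (x + t *\<^sub>R axis i 1)) has_real_derivative d) (at 0)))"

definition locally_lipschitz_on :: "(real^'n) set \<Rightarrow> (real^'n \<Rightarrow> real) \<Rightarrow> bool" where
  "locally_lipschitz_on U f \<longleftrightarrow> (\<forall>x\<in>U. \<exists>r>0. \<exists>L. L-lipschitz_on (ball x r \<inter> U) f)"

definition nu :: "(real^'n) set \<Rightarrow> (real^'n \<Rightarrow> real) \<Rightarrow> real \<Rightarrow> (real^'n) measure" where
  "nu \<Omega> \<phi> \<beta> = density (restrict_space lborel \<Omega>)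
      (\<lambda>x. ennreal (\<phi> x powr \<beta> / set_lebesgue_integral lborel \<Omega> (\<lambda>y. \<phi> y powr \<beta>)))"

end

theory Submission
  imports Defs
begin

text \<open>
  Writing \<open>p = \<beta> + 1\<close> in the first inequality and \<open>p = \<beta>\<close> in the second, both follow from
  \<open>p \<integral>\<^sub>\<Omega> (f - a)\<^sup>2 \<phi>\<^bsup>p-1\<^esup> \<le> \<integral>\<^sub>\<Omega> \<langle>(-D\<^sup>2\<phi>)\<^sup>-\<^sup>1 \<nabla>f, \<nabla>f\<rangle> \<phi>\<^bsup>p\<^esup>\<close> for some constant \<open>a\<close>.
  On a convex set \<open>U\<close> with compact closure in \<open>\<Omega>\<close>, choose \<open>a\<close> such that \<open>g = f - a\<close> satisfies
  \<open>\<integral>\<^sub>U g \<phi>\<^bsup>p\<^esup> = 0\<close>. The Prekopa-Leindler inequality for \<open>(\<phi> + s g)\<^bsup>p+1\<^esup>\<close>, \<open>(\<phi> - s g)\<^bsup>p+1\<^esup>\<close> and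
  the \<open>(p+1)\<close>-st power of the supremal midpoint convolution of \<open>\<phi> + s g\<close> and \<open>\<phi> - s g\<close> is expanded to second
  order in \<open>s\<close>: at a point of differentiability of \<open>f\<close>, that is almost everywhere by Rademacher's theorem,
  the convolution is at most \<open>\<phi> + s\<^sup>2/2 \<langle>(-D\<^sup>2\<phi>)\<^sup>-\<^sup>1 \<nabla>f, \<nabla>f\<rangle> + o(s\<^sup>2)\<close>.
  Exhausting \<open>\<Omega>\<close> by dilates, the constants \<open>a\<close> stay bounded, and Fatou's lemma passes to the limit.
\<close>

section \<open>Almost everywhere differentiability of Lipschitz functions\<close>

text \<open>Two obstacles shape the proof. The integrand \<open>dual_form\<close> comes from a
  gradient that exists only almost everywhere, and its measurability is not established: its
  integrals are lower integrals, and each step on them is an inequality in a direction that lower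
  integrals allow. Moreover \<phi> may vanish and \<open>f\<close> may blow up at the boundary, so
  the expansion is carried out only where \<phi> is bounded below and \<open>f\<close> is bounded,
  and none of the auxiliary bounds survives in the inequality. The power \<open>q = p + 1\<close> is
  dictated by the expansion: \<open>(\<phi> + s g)^q\<close> has second-order term
  \<open>s^2 (q p / 2) g^2 \<phi>^(p-1)\<close>, while an increase of \<phi> by
  \<open>s^2 Q / 2\<close> contributes \<open>s^2 (q / 2) Q \<phi>^p\<close>; dividing by
  \<open>s^2 q / 2\<close> leaves the inequality. The centring of \<open>g\<close> removes the terms
  of order \<open>s\<close>, so both perturbed integrals have the same lower bound. The inverse
  Hessian is the Legendre transform of the form of \<open>- hess \<phi>\<close>, reached by
  optimizing the displacement from the midpoint.\<close>

lemma negligible_borel_imp_null_sets: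
  "negligible S \<Longrightarrow> S \<in> sets borel \<Longrightarrow> S \<in> null_sets lborel"
  by (simp add: null_sets_def negligible_iff_emeasure0 emeasure_completion)

lemma emeasure_lborel_open_pos:
  fixes U :: "'a::euclidean_space set"
  assumes "open U" "U \<noteq> {}"
  shows "emeasure lborel U > 0"
  using open_not_negligible[OF assms] negligible_iff_emeasure0[of U] assms(1)
  by (auto simp: zero_less_iff_neq_zero emeasure_completion)

lemma borel_measurable_continuous_on_restrict_lborel:
  fixes f :: "'a::euclidean_space \<Rightarrow> real"
  assumes "continuous_on S f"
  shows "f \<in> borel_measurable (restrict_space lborel S)"
  using borel_measurable_continuous_on_restrict[OF assms]
  by (subst measurable_cong_sets[OF restrict_space_sets_cong[OF refl sets_lborel] refl])

section \<open>Covering estimates and oscillating difference quotients\<close>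

text \<open>Disjoint balls from the hypothesis, inside an open \<open>U\<close> barely larger than
  \<open>E\<close>, cover almost all of \<open>E\<close>; summing gives \<open>r\<close> times the
  measure of \<open>U\<close>. The uncovered rest of \<open>E\<close> is Lebesgue null, hence null
  for \<mu>. The point \<open>x\<close> need only lie in the ball, which admits intervals with
  \<open>x\<close> as an endpoint.\<close>

lemma vitali_measure_le:
  fixes \<mu> :: "'a::euclidean_space measure" and r :: real
  assumes sets: "sets \<mu> = sets borel"
    and ac: "absolutely_continuous lborel \<mu>"
    and E: "E \<in> sets borel" and r: "r \<ge> 0"
    and small: "\<And>x d. x \<in> E \<Longrightarrow> d > 0 \<Longrightarrow> \<exists>a \<rho>. 0 < \<rho> \<and> \<rho> < d \<and> x \<in> cball a \<rho> \<and>
                  emeasure \<mu> (cball a \<rho>) \<le> ennreal r * emeasure lborel (cball a \<rho>)"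
  shows "emeasure \<mu> E \<le> ennreal r * emeasure lborel E"
proof (rule ennreal_le_epsilon)
  fix e :: real assume "e > 0"
  \<comment> \<open>The excess of \<open>U\<close> over \<open>E\<close> is later multiplied by
    \<open>r\<close>; dividing by \<open>r + 1\<close> allows \<open>r = 0\<close>.\<close>
  have "e / (r + 1) > 0" using \<open>e > 0\<close> r by simp
  from outer_regular_lborel[OF E this] obtain U where
    U: "open U" "E \<subseteq> U" "emeasure lborel (U - E) < e / (r+1)" by auto
  define K where "K = {p. 0 < snd p \<and> cball (fst p) (snd p) \<subseteq> U \<and>
    emeasure \<mu> (cball (fst p) (snd p)) \<le> ennreal r * emeasure lborel (cball (fst p) (snd p))}"
  have "\<exists>i. i \<in> K \<and> x \<in> cball (fst i) (snd i) \<and> snd i < d" if x: "x \<in> E" and d: "0 < d" for x d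
  proof -
    obtain \<delta> where \<delta>: "\<delta> > 0" "ball x \<delta> \<subseteq> U" using U x by (meson open_contains_ball subset_iff)
    obtain a \<rho> where *: "0 < \<rho>" "\<rho> < min d (\<delta>/2)" "x \<in> cball a \<rho>"
      "emeasure \<mu> (cball a \<rho>) \<le> ennreal r * emeasure lborel (cball a \<rho>)"
      using small[OF x, of "min d (\<delta>/2)"] d \<delta> by auto
    have "cball a \<rho> \<subseteq> ball x \<delta>"
    proof
      fix y assume "y \<in> cball a \<rho>"
      then have "dist x y \<le> \<rho> + \<rho>" using *(3) dist_triangle[of x y a] by (simp add: dist_commute)
      also have "\<dots> < \<delta>" using * by simp
      finally show "y \<in> ball x \<delta>" by simp
    qed
    then show ?thesis using * \<delta> by (intro exI[of _ "(a,\<rho>)"]) (auto simp: K_def)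
  qed
  from Vitali_covering_theorem_cballs[of K snd E fst, OF _ this]
  obtain C where C: "countable C" "C \<subseteq> K"
     "pairwise (\<lambda>i j. disjnt (cball (fst i) (snd i)) (cball (fst j) (snd j))) C"
     "negligible(E - (\<Union>i \<in> C. cball (fst i) (snd i)))"
    unfolding K_def by auto
  let ?V = "\<Union>i \<in> C. cball (fst i) (snd i)"
  have V[measurable]: "?V \<in> sets borel" using C(1) by (intro sets.countable_UN'') auto
  have dis: "disjoint_family_on (\<lambda>i. cball (fst i) (snd i)) C"
    using C(3) by (auto simp: disjoint_family_on_def pairwise_def disjnt_def)
  have "E - ?V \<in> sets borel" using E V by auto
  then have "E - ?V \<in> null_sets lborel" by (rule negligible_borel_imp_null_sets[OF C(4)])
  then have n: "E - ?V \<in> null_sets \<mu>" using ac by (auto simp: absolutely_continuous_def)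
  have "emeasure \<mu> E \<le> emeasure \<mu> (?V \<union> (E - ?V))" using E V sets by (intro emeasure_mono) auto
  also have "\<dots> = emeasure \<mu> ?V" using n V sets by (intro emeasure_Un_null_set) auto
  also have "\<dots> = (\<integral>\<^sup>+i. emeasure \<mu> (cball (fst i) (snd i)) \<partial>count_space C)"
    using dis C(1) sets by (intro emeasure_UN_countable) auto
  also have "\<dots> \<le> (\<integral>\<^sup>+i. ennreal r * emeasure lborel (cball (fst i) (snd i)) \<partial>count_space C)"
    using C(2) by (intro nn_integral_mono) (auto simp: K_def)
  also have "\<dots> = ennreal r * (\<integral>\<^sup>+i. emeasure lborel (cball (fst i) (snd i)) \<partial>count_space C)"
    by (intro nn_integral_cmult) auto
  also have "(\<integral>\<^sup>+i. emeasure lborel (cball (fst i) (snd i)) \<partial>count_space C) = emeasure lborel ?V"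
    using dis C(1) by (intro emeasure_UN_countable[symmetric]) auto
  also have "\<dots> \<le> emeasure lborel U" using U C(2) by (intro emeasure_mono) (auto simp: K_def)
  also have "emeasure lborel U = emeasure lborel (E \<union> (U - E))" using U(2) by (simp add: Un_absorb1)
  also have "\<dots> \<le> emeasure lborel E + emeasure lborel (U - E)"
    using U E by (intro emeasure_subadditive) auto
  also have "\<dots> \<le> emeasure lborel E + ennreal (e/(r+1))" using U(3) by (intro add_left_mono) simp
  also have "ennreal r * (emeasure lborel E + ennreal (e/(r+1))) = ennreal r * emeasure lborel E + ennreal (r * (e/(r+1)))"
    using r \<open>e>0\<close> by (simp add: distrib_left ennreal_mult[symmetric])
  also have "\<dots> \<le> ennreal r * emeasure lborel E + ennreal e"
  proof (intro add_left_mono ennreal_leI)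
    have "r * e \<le> e * (r+1)" using \<open>e>0\<close> by (simp add: algebra_simps)
    then show "r * (e/(r+1)) \<le> e" using r by (simp add: divide_simps)
  qed
  finally show "emeasure \<mu> E \<le> ennreal r * emeasure lborel E + ennreal e"
    by (simp add: mult_left_mono)
qed

text \<open>The sum of the two Stieltjes measures agrees with Lebesgue measure on open intervals,
  hence on all Borel sets. Each summand is then absolutely continuous, as the covering estimate
  demands, and the two local densities compete for a total of one.\<close>

lemma lborel_split_interval_measure:
  fixes F G :: "real \<Rightarrow> real"
  assumes F: "mono F" "continuous_on UNIV F" and G: "mono G" "continuous_on UNIV G"
    and FG: "\<And>x. F x + G x = x" and A: "A \<in> sets borel"
  shows "emeasure lborel A = emeasure (interval_measure F) A + emeasure (interval_measure G) A"
proof -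
  let ?m = "\<lambda>A. emeasure (interval_measure F) A + emeasure (interval_measure G) A"
  define M where "M = measure_of UNIV (sets borel) ?m"
  have M: "emeasure M A = ?m A"
    if "A \<in> sets borel" for A
    unfolding M_def
  proof (rule emeasure_measure_of_sigma)
    show "sigma_algebra UNIV (sets borel :: real set set)" 
      using sets.sigma_algebra_axioms[of "borel :: real measure"] by simp
    show "positive (sets borel) ?m"
      by (simp add: positive_def)
    show "countably_additive (sets borel) ?m"
      by (auto simp: countably_additive_def suminf_add[symmetric] suminf_emeasure)
  qed fact
  have ioo: "emeasure (interval_measure F) {a<..<b} = ennreal (F b - F a)"
    if "a \<le> b" "mono F" "continuous_on UNIV F" for F :: "real \<Rightarrow> real" and a b
  proof -
    have Icc: "emeasure (interval_measure F) {x..y} = ennreal (F y - F x)" if "x \<le> y" for x y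
      using that \<open>mono F\<close> \<open>continuous_on UNIV F\<close> by (intro emeasure_interval_measure_Icc) (auto simp: monoD)
    have "{a..a} \<union> {b..b} \<in> null_sets (interval_measure F)"
      using Icc[of a a] Icc[of b b] by (intro null_sets.Un null_setsI) auto
    then have "{a, b} \<in> null_sets (interval_measure F)" by (simp add: insert_commute)
    then have "emeasure (interval_measure F) ({a..b} - {a,b}) = emeasure (interval_measure F) {a..b}"
      by (intro emeasure_Diff_null_set) auto
    moreover have "{a..b} - {a,b} = {a<..<b}" by auto
    ultimately show ?thesis using Icc[OF \<open>a \<le> b\<close>] by simp
  qed
  have "lborel = M"
  proof (rule lborel_eqI)
    fix l u :: real assume "\<And>b. b \<in> Basis \<Longrightarrow> l \<bullet> b \<le> u \<bullet> b"
    then have lu: "l \<le> u" by simp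
    have "emeasure M {l<..<u} = ennreal (F u - F l) + ennreal (G u - G l)"
      using lu F G by (simp add: M ioo)
    also have "\<dots> = ennreal ((F u - F l) + (G u - G l))"
      using lu F G by (intro ennreal_plus[symmetric]) (auto simp: monoD)
    also have "(F u - F l) + (G u - G l) = u - l"
      using FG[of u] FG[of l] by simp
    finally show "emeasure M (box l u) = ennreal (\<Prod>b\<in>Basis. (u - l) \<bullet> b)"
      by (simp add: box_real)
  next
    show "sets M = sets borel" using sets.sigma_sets_eq[of "borel :: real measure"] by (simp add: M_def)
  qed
  then show ?thesis using M[OF A] by simp
qed

abbreviation slope :: "('a::real_normed_vector \<Rightarrow> real) \<Rightarrow> 'a \<Rightarrow> 'a \<Rightarrow> real \<Rightarrow> real" where
  "slope f x v h \<equiv> (f (x + h *\<^sub>R v) - f x) / h"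

text \<open>Along \<open>v\<close>, the lower derivative is at most \<open>r\<close> and the upper
  derivative at least \<open>R\<close> at these points. For rational \<open>r < R\<close> the sets
  exhaust the points where bounded difference quotients fail to converge.\<close>

definition oscillation_set :: "('a::real_normed_vector \<Rightarrow> real) \<Rightarrow> 'a \<Rightarrow> real \<Rightarrow> real \<Rightarrow> 'a set" where
  "oscillation_set f v r R = (\<Inter>m::nat.
     {x. \<exists>h. h \<noteq> 0 \<and> \<bar>h\<bar> < 1 / Suc m \<and> slope f x v h < r} \<inter>
     {x. \<exists>h. h \<noteq> 0 \<and> \<bar>h\<bar> < 1 / Suc m \<and> slope f x v h > R})"

text \<open>A countable intersection of open sets: the union over \<open>h\<close> is uncountable,
  but each of its members is open.\<close>

lemma oscillation_set_borel:
  fixes f :: "'a::euclidean_space \<Rightarrow> real"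
  assumes f: "continuous_on UNIV f"
  shows "oscillation_set f v r R \<in> sets borel"
proof -
  have c: "continuous_on UNIV (\<lambda>x. slope f x v h)" if "h \<noteq> 0" for h
    using that by (intro continuous_intros continuous_on_compose2[OF f]) auto
  have o1: "open {x. slope f x v h < r}" if "h \<noteq> 0" for h
    by (intro open_Collect_less c that continuous_intros)
  have o2: "open {x. slope f x v h > R}" if "h \<noteq> 0" for h
    by (intro open_Collect_less c that continuous_intros)
  have "open {x. \<exists>h. h \<noteq> 0 \<and> \<bar>h\<bar> < 1 / Suc m \<and> slope f x v h < r}" (is "open ?A") for m
  proof -
    have "?A = (\<Union>h\<in>{h. h \<noteq> 0 \<and> \<bar>h\<bar> < 1 / Suc m}. {x. slope f x v h < r})" by auto
    then show ?thesis using o1 by auto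
  qed
  moreover have "open {x. \<exists>h. h \<noteq> 0 \<and> \<bar>h\<bar> < 1 / Suc m \<and> slope f x v h > R}" (is "open ?A") for m
  proof -
    have "?A = (\<Union>h\<in>{h. h \<noteq> 0 \<and> \<bar>h\<bar> < 1 / Suc m}. {x. slope f x v h > R})" by auto
    then show ?thesis using o2 by auto
  qed
  ultimately show ?thesis unfolding oscillation_set_def
    by (intro sets.countable_INT sets.Int) (auto intro: borel_open)
qed

lemma oscillation_set_null_real:
  fixes f :: "real \<Rightarrow> real"
  assumes f: "L-lipschitz_on UNIV f" and L: "L > 0" and rR: "r < R"
  shows "oscillation_set f 1 r R \<in> null_sets lborel"
proof -
  let ?E = "oscillation_set f 1 r R"
  have cf: "continuous_on UNIV f" using f by (rule lipschitz_on_continuous_on)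
  have E[measurable]: "?E \<in> sets borel" by (rule oscillation_set_borel[OF cf])
  have lip: "\<bar>f x - f y\<bar> \<le> L * \<bar>x - y\<bar>" for x y
    using lipschitz_onD[OF f, of x y] by (simp add: dist_real_def)
  have slope: "\<bar>(f (x + h) - f x) / h\<bar> \<le> L" if "h \<noteq> 0" for x h
    using lip[of "x+h" x] that by (simp add: abs_divide divide_simps)
  show ?thesis
  \<comment> \<open>All difference quotients lie in \<open>[-L, L]\<close>, so these cases give the
    empty set; in the remaining one both densities below are positive.\<close>
  proof (cases "r \<le> -L \<or> R \<ge> L")
    case True
    have "?E = {}"
    proof (rule ccontr)
      assume "?E \<noteq> {}"
      then obtain x where "x \<in> ?E" by auto
      then obtain h h' where "h \<noteq> 0" "(f (x + h) - f x) / h < r" "h' \<noteq> 0" "(f (x + h') - f x) / h' > R"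
        unfolding oscillation_set_def by (auto dest!: spec[of _ 0])
      then show False using True slope[of h x] slope[of h' x] by linarith
    qed
    then show ?thesis by simp
  next
    case False
    \<comment> \<open>The Stieltjes measures of \<open>F\<close> and \<open>G\<close> add up to Lebesgue measure, but by the Vitali covering
      theorem their densities on the oscillation set are at most \<open>(L+r)/(2L)\<close> and \<open>(L-R)/(2L)\<close>.\<close>
    define F where "F x = (L * x + f x) / (2*L)" for x
    define G where "G x = (L * x - f x) / (2*L)" for x
    have FG: "F x + G x = x" for x using L by (simp add: F_def G_def field_simps)
    have F: "mono F" "continuous_on UNIV F"
    proof -
      show "mono F"
      proof
        fix x y :: real assume "x \<le> y"
        then have "L * x + f x \<le> L * y + f y" using lip[of x y] by (simp add: abs_if algebra_simps split: if_splits)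
        then show "F x \<le> F y" using L by (simp add: F_def divide_right_mono)
      qed
      show "continuous_on UNIV F" unfolding F_def using L by (intro continuous_intros cf) auto
    qed
    have G: "mono G" "continuous_on UNIV G"
    proof -
      show "mono G"
      proof
        fix x y :: real assume "x \<le> y"
        then have "L * x - f x \<le> L * y - f y" using lip[of x y] by (simp add: abs_if algebra_simps split: if_splits)
        then show "G x \<le> G y" using L by (simp add: G_def divide_right_mono)
      qed
      show "continuous_on UNIV G" unfolding G_def using L by (intro continuous_intros cf) auto
    qed
    note split = lborel_split_interval_measure[OF F G FG]
    have acF: "absolutely_continuous lborel (interval_measure F)" and acG: "absolutely_continuous lborel (interval_measure G)"
      using split by (auto simp: absolutely_continuous_def null_sets_def)
    have Icc: "emeasure (interval_measure F) {x..y} = ennreal (F y - F x)" if "x \<le> y" "mono F" "continuous_on UNIV F" 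
      for x y and F :: "real \<Rightarrow> real"
      using that by (intro emeasure_interval_measure_Icc) (auto simp: monoD)
    \<comment> \<open>The ball is the interval between \<open>x\<close> and \<open>x + h\<close>, so
      the ratio of its two measures is the difference quotient of \<open>F\<close>.\<close>
    have seg: "\<exists>a \<rho>. 0 < \<rho> \<and> \<rho> < d \<and> x \<in> cball a \<rho> \<and>
       emeasure (interval_measure F) (cball a \<rho>) \<le> ennreal c * emeasure lborel (cball a \<rho>)"
      if F: "mono F" "continuous_on UNIV F" and h: "h \<noteq> 0" "\<bar>h\<bar> < d" "(F (x+h) - F x)/h \<le> c" "c \<ge> 0" 
      for F :: "real \<Rightarrow> real" and x h c d
    proof (intro exI conjI)
      show "0 < \<bar>h\<bar>/2" "\<bar>h\<bar>/2 < d" "x \<in> cball (x + h/2) (\<bar>h\<bar>/2)" using h by (auto simp: dist_real_def)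
      have cb: "cball (x + h/2) (\<bar>h\<bar>/2) = {min x (x+h)..max x (x+h)}"
        by (auto simp: dist_real_def min_def max_def abs_if field_simps split: if_splits)
      have "emeasure (interval_measure F) {min x (x+h)..max x (x+h)} = ennreal (F (max x (x+h)) - F (min x (x+h)))"
        using F by (intro Icc) auto
      also have "\<dots> \<le> ennreal (c * \<bar>h\<bar>)"
        using h by (intro ennreal_leI) (auto simp: min_def max_def divide_simps algebra_simps split: if_splits)
      also have "\<dots> = ennreal c * emeasure lborel {min x (x+h)..max x (x+h)}"
        using h(4) by (auto simp: min_def max_def ennreal_mult)
      finally show "emeasure (interval_measure F) (cball (x + h/2) (\<bar>h\<bar>/2)) \<le> ennreal c * emeasure lborel (cball (x + h/2) (\<bar>h\<bar>/2))"
        by (simp add: cb)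
    qed
    have small: "\<exists>m::nat. 1 / Suc m < d" if "d > 0" for d :: real
      using that by (meson nat_approx_posE)
    \<comment> \<open>On a bounded piece the measure is a real number, so being at most a proper
      fraction of itself forces it to vanish.\<close>
    have bounded: "emeasure lborel (?E \<inter> {-real N..real N}) = 0" for N :: nat
    proof -
      let ?B = "?E \<inter> {-real N..real N}"
      have B: "?B \<in> sets borel" by auto
      have 1: "emeasure (interval_measure F) ?B \<le> ennreal ((L+r)/(2*L)) * emeasure lborel ?B"
      proof (rule vitali_measure_le[OF _ acF B])
        show "0 \<le> (L+r)/(2*L)" using False L by simp
        fix x d :: real assume "x \<in> ?B" "d > 0"
        then obtain h where h: "h \<noteq> 0" "\<bar>h\<bar> < d" "(f (x + h) - f x) / h < r"
          using small[OF \<open>d>0\<close>] unfolding oscillation_set_def by (force intro: less_trans)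
        have "(F (x+h) - F x)/h = (L + (f (x + h) - f x) / h) / (2*L)"
          using h(1) L by (simp add: F_def field_simps)
        also have "\<dots> \<le> (L+r)/(2*L)" using h L by (intro divide_right_mono) auto
        finally show "\<exists>a \<rho>. 0 < \<rho> \<and> \<rho> < d \<and> x \<in> cball a \<rho> \<and>
            emeasure (interval_measure F) (cball a \<rho>) \<le> ennreal ((L+r)/(2*L)) * emeasure lborel (cball a \<rho>)"
          using False L h F by (intro seg[where h=h]) auto
      qed simp
      have 2: "emeasure (interval_measure G) ?B \<le> ennreal ((L-R)/(2*L)) * emeasure lborel ?B"
      proof (rule vitali_measure_le[OF _ acG B])
        show "0 \<le> (L-R)/(2*L)" using False L by simp
        fix x d :: real assume "x \<in> ?B" "d > 0"
        then obtain h where h: "h \<noteq> 0" "\<bar>h\<bar> < d" "(f (x + h) - f x) / h > R"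
          using small[OF \<open>d>0\<close>] unfolding oscillation_set_def by (force intro: less_trans)
        have "(G (x+h) - G x)/h = (L - (f (x + h) - f x) / h) / (2*L)"
          using h(1) L by (simp add: G_def field_simps)
        also have "\<dots> \<le> (L-R)/(2*L)" using h L by (intro divide_right_mono) auto
        finally show "\<exists>a \<rho>. 0 < \<rho> \<and> \<rho> < d \<and> x \<in> cball a \<rho> \<and>
            emeasure (interval_measure G) (cball a \<rho>) \<le> ennreal ((L-R)/(2*L)) * emeasure lborel (cball a \<rho>)"
          using False L h G by (intro seg[where h=h]) auto
      qed simp
      have "emeasure lborel ?B \<le> emeasure lborel {-real N..real N}" by (intro emeasure_mono) auto
      also have "\<dots> < \<infinity>" by simp
      finally obtain b where b: "emeasure lborel ?B = ennreal b" "b \<ge> 0" by (cases "emeasure lborel ?B") auto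
      \<comment> \<open>The two densities add up to \<open>1 - (R - r) / (2 * L)\<close>, which is
        below one.\<close>
      have "ennreal b \<le> ennreal ((L+r)/(2*L)) * ennreal b + ennreal ((L-R)/(2*L)) * ennreal b"
        using split[OF B] add_mono[OF 1 2] unfolding b by simp
      also have "\<dots> = ennreal ((L+r)/(2*L) * b + (L-R)/(2*L) * b)"
        using False L b(2) by (simp add: ennreal_mult[symmetric] ennreal_plus[symmetric] del: ennreal_plus)
      finally have "b \<le> (L+r)/(2*L) * b + (L-R)/(2*L) * b"
        using False L b(2) by (subst (asm) ennreal_le_iff) auto
      then have "b * (R - r) \<le> 0" using L by (simp add: field_simps)
      then have "b = 0" using rR b(2) by (simp add: mult_le_0_iff)
      then show ?thesis using b by simp
    qed
    have "?E = (\<Union>N. ?E \<inter> {-real N..real N})"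
    proof -
      have "\<exists>N. x \<in> {-real N..real N}" for x
      proof -
        obtain N where "\<bar>x\<bar> \<le> real N" using real_arch_simple by blast
        then show ?thesis by (intro exI[of _ N]) auto
      qed
      then show ?thesis by blast
    qed
    moreover have "(\<Union>N. ?E \<inter> {-real N..real N}) \<in> null_sets lborel"
      using bounded by (intro null_sets_UN) (auto intro!: null_setsI)
    ultimately show ?thesis by simp
  qed
qed

text \<open>Tonelli for the pair \<open>(t, x)\<close> with the lines as inner sections. Translation
  invariance replaces a choice of coordinates adapted to \<open>v\<close>.\<close>

lemma null_set_if_null_on_lines:
  fixes N :: "'a::euclidean_space set"
  assumes N[measurable]: "N \<in> sets borel"
    and line: "\<And>x. {t::real. x + t *\<^sub>R v \<in> N} \<in> null_sets lborel"
  shows "N \<in> null_sets lborel"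
proof -
  have *: "(\<integral>\<^sup>+x. indicator N (x + t *\<^sub>R v) \<partial>lborel) = emeasure lborel N" for t :: real
  proof -
    have "emeasure lborel N = emeasure (distr lborel borel ((+) (t *\<^sub>R v))) N"
      using lborel_distr_plus[of "t *\<^sub>R v"] by simp
    also have "\<dots> = (\<integral>\<^sup>+x. indicator N x \<partial>distr lborel borel ((+) (t *\<^sub>R v)))" by simp
    also have "\<dots> = (\<integral>\<^sup>+x. indicator N (t *\<^sub>R v + x) \<partial>lborel)"
      by (subst nn_integral_distr) auto
    finally show ?thesis by (simp add: add.commute)
  qed
  \<comment> \<open>averaging over the translates of \<open>N\<close> by \<open>t *\<^sub>R v\<close> with \<open>t \<in> {0..1}\<close>\<close>
  have "emeasure lborel N = (\<integral>\<^sup>+t. indicator {0..1} t * emeasure lborel N \<partial>(lborel::real measure))"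
    by (subst nn_integral_multc) auto
  also have "\<dots> = (\<integral>\<^sup>+t. (\<integral>\<^sup>+x. indicator {0..1} t * indicator N (x + t *\<^sub>R v) \<partial>lborel) \<partial>(lborel::real measure))"
    by (subst nn_integral_cmult) (auto simp: *)
  also have "\<dots> = (\<integral>\<^sup>+x. (\<integral>\<^sup>+t. indicator {0..1} t * indicator N (x + t *\<^sub>R v) \<partial>(lborel::real measure)) \<partial>lborel)"
    by (rule lborel_pair.Fubini') measurable
  also have "\<dots> = (\<integral>\<^sup>+x. 0 \<partial>(lborel :: 'a measure))"
  proof (rule nn_integral_cong)
    fix x :: 'a
    have "AE t in lborel. t \<notin> {t::real. x + t *\<^sub>R v \<in> N}" using line by (rule AE_not_in)
    then have "(\<integral>\<^sup>+t. indicator {0..1} t * indicator N (x + t *\<^sub>R v) \<partial>(lborel::real measure)) = (\<integral>\<^sup>+t. 0 \<partial>(lborel::real measure))"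
      by (intro nn_integral_cong_AE) (auto elim!: eventually_mono)
    then show "(\<integral>\<^sup>+t. indicator {0..1} t * indicator N (x + t *\<^sub>R v) \<partial>(lborel::real measure)) = 0" by simp
  qed
  finally show ?thesis by (intro null_setsI) auto
qed

lemma oscillation_set_null:
  fixes f :: "'a::euclidean_space \<Rightarrow> real"
  assumes f: "L-lipschitz_on UNIV f" and rR: "r < R"
  shows "oscillation_set f v r R \<in> null_sets lborel"
proof (rule null_set_if_null_on_lines)
  show "oscillation_set f v r R \<in> sets borel"
    using f by (intro oscillation_set_borel lipschitz_on_continuous_on)
  fix x
  have L: "L \<ge> 0" using f by (rule lipschitz_on_nonneg)
  \<comment> \<open>The added one keeps the constant positive when \<open>L\<close> or
    \<open>v\<close> is zero, as the one-dimensional result requires.\<close>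
  have "(L * norm v + 1)-lipschitz_on UNIV (\<lambda>t. f (x + t *\<^sub>R v))"
  proof (rule lipschitz_onI)
    fix s t :: real
    have "dist (f (x + s *\<^sub>R v)) (f (x + t *\<^sub>R v)) \<le> L * dist (x + s *\<^sub>R v) (x + t *\<^sub>R v)"
      using lipschitz_onD[OF f UNIV_I UNIV_I] .
    also have "dist (x + s *\<^sub>R v) (x + t *\<^sub>R v) = norm v * dist s t"
      by (simp add: dist_norm scaleR_left_diff_distrib[symmetric] mult.commute)
    finally show "dist (f (x + s *\<^sub>R v)) (f (x + t *\<^sub>R v)) \<le> (L * norm v + 1) * dist s t"
      using zero_le_dist[of s t] unfolding distrib_right mult.assoc by linarith
  qed (use L in simp)
  then have "oscillation_set (\<lambda>t. f (x + t *\<^sub>R v)) 1 r R \<in> null_sets lborel"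
    using L rR by (intro oscillation_set_null_real) (auto intro: add_nonneg_pos)
  also have "oscillation_set (\<lambda>t. f (x + t *\<^sub>R v)) 1 r R = {t. x + t *\<^sub>R v \<in> oscillation_set f v r R}"
    by (auto simp: oscillation_set_def algebra_simps)
  finally show "{t. x + t *\<^sub>R v \<in> oscillation_set f v r R} \<in> null_sets lborel" .
qed

text \<open>Boundedness keeps the lower and the upper limit real; if they differed, two rationals
  between them would put \<open>x\<close> into an oscillation set.\<close>

lemma convergent_if_not_oscillating:
  assumes bd: "\<And>h::real. h \<noteq> 0 \<Longrightarrow> \<bar>slope f x v h\<bar> \<le> (B::real)"
    and no: "\<And>r R. r \<in> \<rat> \<Longrightarrow> R \<in> \<rat> \<Longrightarrow> r < R \<Longrightarrow> x \<notin> oscillation_set f v r R"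
  shows "\<exists>l. ((\<lambda>h. slope f x v h) \<longlongrightarrow> l) (at 0)"
proof -
  define q where "q h = slope f x v h" for h
  let ?i = "Liminf (at 0) (\<lambda>h. ereal (q h))" and ?s = "Limsup (at 0) (\<lambda>h. ereal (q h))"
  have ev: "eventually (\<lambda>h. \<bar>q h\<bar> \<le> B) (at 0)"
    using bd by (auto simp: eventually_at q_def intro!: exI[of _ 1])
  have i: "ereal (-B) \<le> ?i" and s: "?s \<le> ereal B"
    using ev by (auto intro!: Liminf_bounded Limsup_bounded elim!: eventually_mono)
  have i_s: "?i \<le> ?s" by (rule Liminf_le_Limsup) simp
  have "?i = ?s"
  proof (rule ccontr)
    assume "?i \<noteq> ?s"
    then have "?i < ?s" using i_s by simp
    then obtain a b where ab: "?i = ereal a" "?s = ereal b" "a < b"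
      using i s by (cases ?i; cases ?s) auto
    obtain R where R: "R \<in> \<rat>" "a < R" "R < b" using Rats_dense_in_real[OF ab(3)] by auto
    obtain r where r: "r \<in> \<rat>" "a < r" "r < R" using Rats_dense_in_real[OF R(2)] by auto
    have fr: "\<exists>h. h \<noteq> 0 \<and> \<bar>h\<bar> < 1 / Suc m \<and> q h < r" for m
    proof (rule ccontr)
      assume "\<not> ?thesis"
      then have "eventually (\<lambda>h. r \<le> q h) (at 0)"
        by (auto simp: eventually_at not_less intro!: exI[of _ "1 / Suc m"])
      then have "ereal r \<le> ?i" by (intro Liminf_bounded) (auto elim!: eventually_mono)
      then show False using ab r by simp
    qed
    have fR: "\<exists>h. h \<noteq> 0 \<and> \<bar>h\<bar> < 1 / Suc m \<and> q h > R" for m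
    proof (rule ccontr)
      assume "\<not> ?thesis"
      then have "eventually (\<lambda>h. q h \<le> R) (at 0)"
        by (auto simp: eventually_at not_less intro!: exI[of _ "1 / Suc m"])
      then have "?s \<le> ereal R" by (intro Limsup_bounded) (auto elim!: eventually_mono)
      then show False using ab R by simp
    qed
    have "x \<in> oscillation_set f v r R"
      using fr fR by (auto simp: oscillation_set_def q_def)
    then show False using no r R by auto
  qed
  moreover obtain l where "?i = ereal l" using i s i_s by (cases ?i; cases ?s) auto
  ultimately have "((\<lambda>h. ereal (q h)) \<longlongrightarrow> ereal l) (at 0)"
    by (subst tendsto_iff_Liminf_eq_Limsup) auto
  then show ?thesis by (auto simp: q_def)
qed

lemma lipschitz_slope_le:
  fixes f :: "'a::real_normed_vector \<Rightarrow> real"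
  assumes f: "L-lipschitz_on UNIV f" and "h \<noteq> 0"
  shows "\<bar>slope f x v h\<bar> \<le> L * norm v"
proof -
  have "\<bar>f (x + h *\<^sub>R v) - f x\<bar> \<le> L * norm (h *\<^sub>R v)"
    using lipschitz_onD[OF f, of "x + h *\<^sub>R v" x] by (simp add: dist_norm)
  then show ?thesis using \<open>h \<noteq> 0\<close> by (simp add: abs_divide divide_simps mult_ac)
qed

lemma lipschitz_directional_derivative_AE:
  fixes f :: "'a::euclidean_space \<Rightarrow> real"
  assumes f: "L-lipschitz_on UNIV f"
  shows "AE x in lborel. \<exists>l. ((\<lambda>h. slope f x v h) \<longlongrightarrow> l) (at 0)"
proof -
  have "AE x in lborel. \<forall>p\<in>{p\<in>\<rat>\<times>\<rat>. fst p < snd p}. x \<notin> oscillation_set f v (fst p) (snd p)"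
  proof (subst AE_ball_countable)
    show "countable {p\<in>\<rat>\<times>\<rat>. fst p < (snd p :: real)}"
      by (rule countable_subset[of _ "\<rat>\<times>\<rat>"]) (auto intro: countable_SIGMA countable_rat)
    show "\<forall>p\<in>{p\<in>\<rat>\<times>\<rat>. fst p < snd p}. AE x in lborel. x \<notin> oscillation_set f v (fst p) (snd p)"
      using oscillation_set_null[OF f] by (auto intro!: AE_not_in)
  qed
  then show ?thesis
  proof eventually_elim
    case (elim x)
    show ?case
      using lipschitz_slope_le[OF f] elim by (intro convergent_if_not_oscillating[where B="L * norm v"]) auto
  qed
qed

text \<open>Taking the limit only along \<open>1 / Suc n\<close> makes this a Borel function; it
  equals the two-sided limit wherever that exists.\<close>

definition dir_deriv :: "('a::euclidean_space \<Rightarrow> real) \<Rightarrow> 'a \<Rightarrow> 'a \<Rightarrow> real" where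
  "dir_deriv f v x = lim (\<lambda>n. (f (x + (1 / Suc n) *\<^sub>R v) - f x) * real (Suc n))"

lemma dir_deriv_eqI:
  assumes "((\<lambda>h. slope f x v h) \<longlongrightarrow> l) (at 0)"
  shows "dir_deriv f v x = l"
proof -
  have "filterlim (\<lambda>n. 1 / real (Suc n)) (at 0) sequentially"
    using LIMSEQ_inverse_real_of_nat by (auto simp: filterlim_at inverse_eq_divide)
  from filterlim_compose[OF assms this]
  show ?thesis unfolding dir_deriv_def by (intro limI) simp
qed

lemma dir_deriv_measurable [measurable]:
  fixes f :: "'a::euclidean_space \<Rightarrow> real"
  assumes "f \<in> borel_measurable borel"
  shows "dir_deriv f v \<in> borel_measurable borel"
  unfolding dir_deriv_def[abs_def] using assms by measurable

lemma dir_deriv_sequentially_AE: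
  fixes f :: "'a::euclidean_space \<Rightarrow> real"
  assumes f: "L-lipschitz_on UNIV f"
  shows "AE x in lborel. (\<lambda>n. (f (x + (1 / Suc n) *\<^sub>R v) - f x) * real (Suc n)) \<longlonglongrightarrow> dir_deriv f v x
     \<and> \<bar>dir_deriv f v x\<bar> \<le> L * norm v"
  using lipschitz_directional_derivative_AE[OF f, of v]
proof eventually_elim
  case (elim x)
  then obtain l where l: "((\<lambda>h. slope f x v h) \<longlongrightarrow> l) (at 0)" by auto
  have "filterlim (\<lambda>n. 1 / real (Suc n)) (at 0) sequentially"
    using LIMSEQ_inverse_real_of_nat by (auto simp: filterlim_at inverse_eq_divide)
  from filterlim_compose[OF l this] 
  have 1: "(\<lambda>n. (f (x + (1 / Suc n) *\<^sub>R v) - f x) * real (Suc n)) \<longlonglongrightarrow> dir_deriv f v x"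
    using dir_deriv_eqI[OF l] by simp
  moreover have "\<bar>dir_deriv f v x\<bar> \<le> L * norm v"
  proof (rule tendsto_upperbound[OF tendsto_rabs[OF 1]])
    show "\<forall>\<^sub>F n in sequentially. \<bar>(f (x + (1 / Suc n) *\<^sub>R v) - f x) * real (Suc n)\<bar> \<le> L * norm v"
      using lipschitz_slope_le[OF f, of "1 / Suc n" x v for n] by (intro always_eventually allI) simp
  qed simp
  ultimately show ?case by simp
qed

section \<open>Linearity of the derivative in the direction, almost everywhere\<close>

lemma AE_zero_if_box_integrals_zero:
  fixes h :: "'a::euclidean_space \<Rightarrow> real"
  assumes h[measurable]: "h \<in> borel_measurable borel" and bd: "AE x in lborel. \<bar>h x\<bar> \<le> B" and B: "B > 0"
    and z: "\<And>a b. (\<integral>x. indicator (box a b) x * h x \<partial>lborel) = 0"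
  shows "AE x in lborel. h x = 0"
proof -
  let ?d = "\<lambda>x. ennreal ((B + h x) / B)"
  \<comment> \<open>shifting \<open>h\<close> makes it a nonnegative density, so that uniqueness of densities applies\<close>
  have "lborel = density lborel ?d"
  proof (rule lborel_eqI)
    fix l u :: 'a assume lu: "\<And>b. b \<in> Basis \<Longrightarrow> l \<bullet> b \<le> u \<bullet> b"
    let ?T = "\<lambda>x. indicator (box l u) x + indicator (box l u) x * h x / B"
    have i1: "integrable lborel (\<lambda>x. indicator (box l u) x * h x)"
    proof (rule Bochner_Integration.integrable_bound)
      show "integrable lborel (\<lambda>x. B * indicator (box l u) x)" by (auto simp: emeasure_lborel_box_eq)
      show "AE x in lborel. norm (indicator (box l u) x * h x) \<le> norm (B * indicator (box l u) x)"
        using bd by eventually_elim (use B in \<open>auto simp: indicator_def\<close>)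
    qed simp
    have "emeasure (density lborel ?d) (box l u)
       = (\<integral>\<^sup>+x. ennreal ((B + h x) / B) * indicator (box l u) x \<partial>lborel)"
      by (subst emeasure_density) auto
    also have "\<dots> = (\<integral>\<^sup>+x. ennreal (?T x) \<partial>lborel)"
      using B by (intro nn_integral_cong) (auto simp: indicator_def add_divide_distrib)
    also have "\<dots> = ennreal (\<integral>x. ?T x \<partial>lborel)"
    proof (rule nn_integral_eq_integral)
      show "integrable lborel ?T"
        using i1 by (auto simp: emeasure_lborel_box_eq)
      show "AE x in lborel. 0 \<le> ?T x"
        using bd by eventually_elim (use B in \<open>auto simp: indicator_def field_simps\<close>)
    qed
    also have "(\<integral>x. ?T x \<partial>lborel) = measure lborel (box l u)"
      using i1 z[of l u] by (subst Bochner_Integration.integral_add) (auto simp: emeasure_lborel_box_eq)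
    also have "ennreal (measure lborel (box l u)) = emeasure lborel (box l u)"
      by (intro emeasure_eq_ennreal_measure[symmetric]) (auto simp: emeasure_lborel_box_eq)
    also have "\<dots> = (\<Prod>b\<in>Basis. (u - l) \<bullet> b)" using lu by (simp add: emeasure_lborel_box_eq)
    finally show "emeasure (density lborel ?d) (box l u) = (\<Prod>b\<in>Basis. (u - l) \<bullet> b)" .
  qed simp
  then have "density lborel (\<lambda>_::'a. 1) = density lborel ?d"
    by (simp add: density_1)
  then have "AE x in lborel. 1 = ennreal ((B + h x) / B)"
    by (subst (asm) sigma_finite_measure.density_unique_iff[OF lborel.sigma_finite_measure_axioms]) auto
  then show ?thesis using bd
  proof eventually_elim
    case (elim x)
    have "0 \<le> (B + h x)/B" using elim B by auto
    then have "1 = (B + h x)/B" using elim by (metis ennreal_eq_1)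
    then show ?case using B by (simp add: field_simps)
  qed
qed

text \<open>The difference quotients satisfy
  \<open>q (u+v) n x = q u n (x + v/(n+1)) + q v n x\<close>, but the base point of the first
  summand moves with \<open>n\<close>. After integration over a box the shift passes to the box and
  disappears in the limit; box integrals then determine the function.\<close>

lemma dir_deriv_add_AE:
  fixes f :: "'a::euclidean_space \<Rightarrow> real"
  assumes f: "L-lipschitz_on UNIV f"
  shows "AE x in lborel. dir_deriv f (u + v) x = dir_deriv f u x + dir_deriv f v x"
proof -
  have L: "L \<ge> 0" using f by (rule lipschitz_on_nonneg)
  have cf: "continuous_on UNIV f" using f by (rule lipschitz_on_continuous_on)
  have [measurable]: "f \<in> borel_measurable borel" using cf by (rule borel_measurable_continuous_onI)
  define q where "q w n x = (f (x + (1 / Suc n) *\<^sub>R w) - f x) * real (Suc n)" for w n x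
  have qm[measurable]: "q w n \<in> borel_measurable borel" for w n
    unfolding q_def by measurable
  have qb: "\<bar>q w n x\<bar> \<le> L * norm w" for w n x
    using lipschitz_slope_le[OF f, of "1 / Suc n" x w] by (simp add: q_def)
  have qlim: "AE x in lborel. (\<lambda>n. q w n x) \<longlonglongrightarrow> dir_deriv f w x \<and> \<bar>dir_deriv f w x\<bar> \<le> L * norm w" for w
    unfolding q_def by (rule dir_deriv_sequentially_AE[OF f])
  define h where "h x = dir_deriv f (u + v) x - dir_deriv f u x - dir_deriv f v x" for x
  have [measurable]: "h \<in> borel_measurable borel" unfolding h_def by measurable
  have "AE x in lborel. h x = 0"
  proof (rule AE_zero_if_box_integrals_zero)
    let ?B = "L * norm (u+v) + L * norm u + L * norm v + 1"
    show "AE x in lborel. \<bar>h x\<bar> \<le> ?B"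
      using qlim[of u] qlim[of v] qlim[of "u+v"] by eventually_elim (auto simp: h_def)
    show "?B > 0" using L by (intro add_nonneg_pos add_nonneg_nonneg) auto
    fix a b :: 'a
    let ?I = "\<lambda>x. indicator (box a b) x :: real"
    have int: "integrable lborel (\<lambda>x. ?I x * g x)" if "g \<in> borel_measurable borel" "AE x in lborel. \<bar>g x\<bar> \<le> C" for g C
    proof (rule Bochner_Integration.integrable_bound)
      show "integrable lborel (\<lambda>x. C * ?I x)" by (auto simp: emeasure_lborel_box_eq)
      show "AE x in lborel. norm (?I x * g x) \<le> norm (C * ?I x)"
        using that(2) by eventually_elim (auto simp: indicator_def)
    qed (use that in simp)
    have lim: "(\<lambda>n. \<integral>x. ?I x * q w n x \<partial>lborel) \<longlonglongrightarrow> (\<integral>x. ?I x * dir_deriv f w x \<partial>lborel)" for w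
    proof (rule integral_dominated_convergence[where w="\<lambda>x. (L * norm w) * ?I x"])
      show "integrable lborel (\<lambda>x. (L * norm w) * ?I x)" by (auto simp: emeasure_lborel_box_eq)
      show "AE x in lborel. (\<lambda>n. ?I x * q w n x) \<longlonglongrightarrow> ?I x * dir_deriv f w x"
        using qlim[of w] by eventually_elim (auto intro: tendsto_mult)
      show "AE x in lborel. norm (?I x * q w n x) \<le> L * norm w * ?I x" for n
        using qb[of w n] by (intro AE_I2) (auto simp: indicator_def)
    qed auto
    have lim_shift: "(\<lambda>n. \<integral>x. ?I x * q u n (x + (1 / Suc n) *\<^sub>R v) \<partial>lborel) \<longlonglongrightarrow> (\<integral>x. ?I x * dir_deriv f u x \<partial>lborel)"
    proof -
      have eq: "(\<integral>x. ?I x * q u n (x + (1 / Suc n) *\<^sub>R v) \<partial>lborel) = (\<integral>y. ?I (y - (1 / Suc n) *\<^sub>R v) * q u n y \<partial>lborel)" for n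
      proof -
        let ?t = "(1 / Suc n) *\<^sub>R v"
        have "(\<integral>y. ?I (y - ?t) * q u n y \<partial>lborel) = (\<integral>y. ?I (y - ?t) * q u n y \<partial>distr lborel borel ((+) ?t))"
          by (simp add: lborel_distr_plus)
        also have "\<dots> = (\<integral>x. ?I (?t + x - ?t) * q u n (?t + x) \<partial>lborel)"
          by (subst integral_distr) auto
        finally show ?thesis by (simp add: add.commute)
      qed
      obtain R where R: "box a b \<subseteq> ball 0 R" "R > 0"
        using bounded_box[of a b] by (metis bounded_subset_ballD)
      have "(\<lambda>n. \<integral>y. ?I (y - (1 / Suc n) *\<^sub>R v) * q u n y \<partial>lborel) \<longlonglongrightarrow> (\<integral>x. ?I x * dir_deriv f u x \<partial>lborel)"
      proof (rule integral_dominated_convergence[where w="\<lambda>x. (L * norm u) * indicator (ball 0 (R + norm v)) x"])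
        show "integrable lborel (\<lambda>x. (L * norm u) * indicator (ball (0::'a) (R + norm v)) x)"
          using emeasure_lborel_ball_finite[of "0::'a" "R + norm v"]
          by (intro integrable_mult_right integrable_real_indicator) auto
        show "AE x in lborel. norm (?I (x - (1 / Suc n) *\<^sub>R v) * q u n x) \<le> L * norm u * indicator (ball 0 (R + norm v)) x" for n
        proof (rule AE_I2)
          fix x
          have "x \<in> ball 0 (R + norm v)" if "x - (1 / Suc n) *\<^sub>R v \<in> box a b"
          proof -
            have "norm x \<le> norm (x - (1 / Suc n) *\<^sub>R v) + norm ((1 / Suc n) *\<^sub>R v)" 
              using norm_triangle_sub by (metis add.commute)
            also have "norm ((1 / Suc n) *\<^sub>R v) \<le> norm v" by (simp add: divide_simps mult_left_le_one_le) (simp add: algebra_simps)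
            also have "norm (x - (1 / Suc n) *\<^sub>R v) < R" using that R by auto
            finally show ?thesis by simp
          qed
          then show "norm (?I (x - (1 / Suc n) *\<^sub>R v) * q u n x) \<le> L * norm u * indicator (ball 0 (R + norm v)) x"
            using qb[of u n x] L by (auto simp: indicator_def)
        qed
        \<comment> \<open>Off the frontier, a null set, the indicators of the shifted boxes converge
          to that of the box.\<close>
        have fr: "AE x in lborel. x \<notin> frontier (box a b)"
        proof -
          have "negligible (frontier (box a b))" by (intro negligible_convex_frontier convex_box)
          then have "frontier (box a b) \<in> null_sets lborel" by (rule negligible_borel_imp_null_sets) auto
          then show ?thesis by (rule AE_not_in)
        qed
        show "AE x in lborel. (\<lambda>n. ?I (x - (1 / Suc n) *\<^sub>R v) * q u n x) \<longlonglongrightarrow> ?I x * dir_deriv f u x"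
          using fr qlim[of u]
        proof eventually_elim
          case (elim x)
          have s: "(\<lambda>n. x - (1 / Suc n) *\<^sub>R v) \<longlonglongrightarrow> x - 0 *\<^sub>R v"
            using LIMSEQ_inverse_real_of_nat by (intro tendsto_intros) (simp add: inverse_eq_divide)
          have "eventually (\<lambda>n. ?I (x - (1 / Suc n) *\<^sub>R v) = ?I x) sequentially"
          proof (cases "x \<in> box a b")
            case True
            then have "eventually (\<lambda>n. x - (1 / Suc n) *\<^sub>R v \<in> box a b) sequentially"
              using s open_box by (intro topological_tendstoD[of _ x]) auto
            then show ?thesis by eventually_elim (use True in auto)
          next
            case False
            then have "x \<in> - closure (box a b)" using elim(1) by (auto simp: frontier_def interior_open[OF open_box])
            then have "eventually (\<lambda>n. x - (1 / Suc n) *\<^sub>R v \<in> - closure (box a b)) sequentially"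
              using s by (intro topological_tendstoD[of _ x]) auto
            then show ?thesis
            proof eventually_elim
              case (elim n)
              then have "x - (1 / Suc n) *\<^sub>R v \<notin> box a b" using closure_subset by blast
              then show ?case using False by simp
            qed
          qed
          then have "(\<lambda>n. ?I (x - (1 / Suc n) *\<^sub>R v)) \<longlonglongrightarrow> ?I x"
            by (rule tendsto_eventually)
          then show ?case using elim(2) by (intro tendsto_mult) auto
        qed
      qed auto
      then show ?thesis unfolding eq .
    qed
    have split: "(\<integral>x. ?I x * q (u+v) n x \<partial>lborel) = (\<integral>x. ?I x * q u n (x + (1 / Suc n) *\<^sub>R v) \<partial>lborel) + (\<integral>x. ?I x * q v n x \<partial>lborel)" for n
    proof -
      have "q (u+v) n x = q u n (x + (1 / Suc n) *\<^sub>R v) + q v n x" for x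
        by (simp add: q_def algebra_simps)
      then have "(\<integral>x. ?I x * q (u+v) n x \<partial>lborel) = (\<integral>x. ?I x * q u n (x + (1 / Suc n) *\<^sub>R v) + ?I x * q v n x \<partial>lborel)"
        by (simp add: algebra_simps)
      also have "\<dots> = (\<integral>x. ?I x * q u n (x + (1 / Suc n) *\<^sub>R v) \<partial>lborel) + (\<integral>x. ?I x * q v n x \<partial>lborel)"
        using qb by (intro Bochner_Integration.integral_add int) auto
      finally show ?thesis .
    qed
    have "(\<integral>x. ?I x * dir_deriv f (u+v) x \<partial>lborel) = (\<integral>x. ?I x * dir_deriv f u x \<partial>lborel) + (\<integral>x. ?I x * dir_deriv f v x \<partial>lborel)"
      using LIMSEQ_unique[OF lim[of "u+v"]] tendsto_add[OF lim_shift lim[of v]] unfolding split by blast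
    moreover have "integrable lborel (\<lambda>x. ?I x * dir_deriv f w x)" for w
      using qlim[of w] by (intro int[where C="L * norm w"]) (auto elim!: eventually_mono)
    ultimately show "(\<integral>x. ?I x * h x \<partial>lborel) = 0"
      unfolding h_def by (simp add: right_diff_distrib)
  qed simp
  then show ?thesis by eventually_elim (simp add: h_def)
qed

lemma dir_deriv_scaleR:
  fixes f :: "'a::euclidean_space \<Rightarrow> real"
  assumes "((\<lambda>h. slope f x v h) \<longlongrightarrow> l) (at 0)"
  shows "dir_deriv f (c *\<^sub>R v) x = c * l"
proof (rule dir_deriv_eqI, cases "c = 0")
  case False
  have "filterlim (\<lambda>h::real. h * c) (at 0) (at 0)"
    using False by (auto simp: filterlim_at eventually_at intro!: tendsto_eq_intros exI[of _ 1])
  from filterlim_compose[OF assms this]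
  have "((\<lambda>h. c * ((f (x + (h * c) *\<^sub>R v) - f x) / (h * c))) \<longlongrightarrow> c * l) (at 0)"
    by (intro tendsto_mult tendsto_const)
  then show "((\<lambda>h. (f (x + h *\<^sub>R c *\<^sub>R v) - f x) / h) \<longlongrightarrow> c * l) (at 0)"
    using False by simp
qed simp

text \<open>Induction over partial sums of the basis expansion of a fixed \<open>v\<close>:
  additivity brings in one basis vector at a time, and homogeneity holds wherever the derivative
  along that vector exists. The exceptional null set depends on \<open>v\<close>.\<close>

lemma dir_deriv_linear_AE:
  fixes f :: "'a::euclidean_space \<Rightarrow> real"
  assumes f: "L-lipschitz_on UNIV f"
  shows "AE x in lborel. dir_deriv f v x = (\<Sum>i\<in>Basis. dir_deriv f i x *\<^sub>R i) \<bullet> v"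
proof -
  have "AE x in lborel. dir_deriv f (\<Sum>i\<in>F. (v \<bullet> i) *\<^sub>R i) x = (\<Sum>i\<in>F. (v \<bullet> i) * dir_deriv f i x)"
    if "F \<subseteq> Basis" for F :: "'a set"
    using finite_subset[OF that finite_Basis] that
  proof (induction F rule: finite_induct)
    case empty
    have "dir_deriv f 0 x = 0" for x by (rule dir_deriv_eqI) simp
    then show ?case by simp
  next
    case (insert i F)
    then have "AE x in lborel. dir_deriv f (\<Sum>i\<in>F. (v \<bullet> i) *\<^sub>R i) x = (\<Sum>i\<in>F. (v \<bullet> i) * dir_deriv f i x)"
      by simp
    with dir_deriv_add_AE[OF f, of "(v \<bullet> i) *\<^sub>R i" "\<Sum>i\<in>F. (v \<bullet> i) *\<^sub>R i"]
      lipschitz_directional_derivative_AE[OF f, of i]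
    show ?case
    proof eventually_elim
      case (elim x)
      then obtain l where l: "((\<lambda>h. (f (x + h *\<^sub>R i) - f x) / h) \<longlongrightarrow> l) (at 0)" by auto
      show ?case using elim insert dir_deriv_scaleR[OF l] dir_deriv_eqI[OF l] by simp
    qed
  qed
  note this[OF subset_refl, unfolded euclidean_representation]
  moreover have "(\<Sum>i\<in>Basis. dir_deriv f i x *\<^sub>R i) \<bullet> v = (\<Sum>i\<in>Basis. (v \<bullet> i) * dir_deriv f i x)" for x
    unfolding inner_sum_left by (intro sum.cong refl) (simp add: inner_commute)
  ultimately show ?thesis
    by simp
qed

text \<open>Outside one null set the directional derivatives exist and are linear simultaneously on
  a countable dense set \<open>D\<close>. The Lipschitz bound makes difference quotients depend on
  the direction uniformly in the step length, so a finite net of the unit sphere taken from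
  \<open>D\<close> yields the total derivative.\<close>

theorem Rademacher:
  fixes f :: "'a::euclidean_space \<Rightarrow> real"
  assumes f: "L-lipschitz_on UNIV f"
  shows "AE x in lborel. \<exists>g. (f has_derivative (\<lambda>h. g \<bullet> h)) (at x)"
proof -
  have L: "L \<ge> 0" using f by (rule lipschitz_on_nonneg)
  obtain D :: "'a set" where D: "countable D" "UNIV \<subseteq> closure D"
    by (rule separable)
  have "AE x in lborel. \<forall>v\<in>D. (\<exists>l. ((\<lambda>h. slope f x v h) \<longlongrightarrow> l) (at 0)) \<and>
      dir_deriv f v x = (\<Sum>i\<in>Basis. dir_deriv f i x *\<^sub>R i) \<bullet> v"
    unfolding AE_ball_countable[OF D(1)]
    using lipschitz_directional_derivative_AE[OF f] dir_deriv_linear_AE[OF f]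
    by (intro ballI AE_conjI)
  then show ?thesis
  proof eventually_elim
    case (elim x)
    define g where "g = (\<Sum>i\<in>Basis. dir_deriv f i x *\<^sub>R i)"
    have lim: "((\<lambda>h. slope f x v h) \<longlongrightarrow> g \<bullet> v) (at 0)" if v: "v \<in> D" for v
    proof -
      obtain l where l: "((\<lambda>h. slope f x v h) \<longlongrightarrow> l) (at 0)"
        and "dir_deriv f v x = g \<bullet> v"
        using bspec[OF elim v] unfolding g_def by (elim conjE exE)
      then show ?thesis using dir_deriv_eqI[OF l] by simp
    qed
    have "(f has_derivative (\<lambda>h. g \<bullet> h)) (at x)"
      unfolding has_derivative_at_within
    proof (intro conjI)
      show "bounded_linear (\<lambda>h. g \<bullet> h)" by (rule bounded_linear_inner_right)
      have "\<exists>d>0. \<forall>y. 0 < dist y x \<and> dist y x < d \<longrightarrow> norm ((f y - (f x + g \<bullet> (y - x))) /\<^sub>R norm (y - x)) < e"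
        if e: "e > 0" for e
      proof -
        \<comment> \<open>Replacing a unit direction by one within \<eta> costs at most
          \<open>L * \<eta>\<close> in the difference quotient and \<open>norm g * \<eta>\<close> in
          the linear term, together at most \<open>e/2\<close>.\<close>
        define \<eta> where "\<eta> = e / (2 * (L + norm g + 1))"
        have \<eta>: "\<eta> > 0" using e L by (simp add: \<eta>_def add_nonneg_pos)
        have "sphere (0::'a) 1 \<subseteq> (\<Union>v\<in>D. ball v \<eta>)"
        proof
          fix w :: 'a
          have "w \<in> closure D" using D(2) by blast
          then obtain v where "v \<in> D" "dist v w < \<eta>" using \<eta> unfolding closure_approachable by blast
          then show "w \<in> (\<Union>v\<in>D. ball v \<eta>)" by auto
        qed
        then obtain C where C: "C \<subseteq> D" "finite C" "sphere (0::'a) 1 \<subseteq> (\<Union>v\<in>C. ball v \<eta>)"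
          by (rule compactE_image[OF compact_sphere, rotated]) auto
        have "\<forall>v\<in>C. eventually (\<lambda>h. dist (slope f x v h) (g \<bullet> v) < e/2) (at 0)"
          using lim C(1) e by (intro ballI tendstoD) auto
        then have "eventually (\<lambda>h. \<forall>v\<in>C. dist (slope f x v h) (g \<bullet> v) < e/2) (at 0)"
          using C(2) by (simp add: eventually_ball_finite)
        then obtain d where d: "d > 0" "\<And>h v. h \<noteq> 0 \<Longrightarrow> \<bar>h\<bar> < d \<Longrightarrow> v \<in> C \<Longrightarrow> 
             dist (slope f x v h) (g \<bullet> v) < e/2"
          by (auto simp: eventually_at)
        have "norm ((f y - (f x + g \<bullet> (y - x))) /\<^sub>R norm (y - x)) < e" if y: "0 < dist y x" "dist y x < d" for y
        proof -
          define h where "h = norm (y - x)"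
          define w where "w = (1/h) *\<^sub>R (y - x)"
          have h: "h > 0" "h < d" using y by (auto simp: h_def dist_norm)
          have "norm w = 1" using h by (simp add: w_def h_def)
          then obtain v where v: "v \<in> C" "dist v w < \<eta>" using C(3) by (auto simp: subset_iff)
          have yx: "y = x + h *\<^sub>R w" using h by (simp add: w_def)
          have 1: "\<bar>slope f x v h - g \<bullet> v\<bar> < e/2" using d(2)[of h v] h v by (simp add: dist_real_def)
          have "\<bar>f y - f (x + h *\<^sub>R v)\<bar> \<le> L * dist y (x + h *\<^sub>R v)"
            using lipschitz_onD[OF f, of y "x + h *\<^sub>R v"] by (simp add: dist_real_def)
          also have "dist y (x + h *\<^sub>R v) = h * dist w v"
            using h by (simp add: yx dist_norm scaleR_diff_right[symmetric])
          finally have 2: "\<bar>(f y - f (x + h *\<^sub>R v)) / h\<bar> \<le> L * dist w v"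
            using h by (simp add: abs_divide divide_simps mult_ac)
          have 3: "\<bar>g \<bullet> v - g \<bullet> w\<bar> \<le> norm g * dist w v"
            using Cauchy_Schwarz_ineq2[of g "v - w"] by (simp add: inner_diff_right dist_norm norm_minus_commute)
          have "(f y - (f x + g \<bullet> (y - x))) /\<^sub>R norm (y - x) = (f y - f x) / h - g \<bullet> w"
          proof -
            have "g \<bullet> w = (g \<bullet> (y - x)) / h" by (simp add: w_def)
            moreover have "norm (y - x) = h" by (simp add: h_def)
            ultimately show ?thesis using h by (simp add: field_simps)
          qed
          also have "\<dots> = (f y - f (x + h *\<^sub>R v)) / h + (slope f x v h - g \<bullet> v) + (g \<bullet> v - g \<bullet> w)"
            using h by (simp add: field_simps)
          finally have "norm ((f y - (f x + g \<bullet> (y - x))) /\<^sub>R norm (y - x)) < L * dist w v + e/2 + norm g * dist w v"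
            using 1 2 3 unfolding real_norm_def by linarith
          also have "\<dots> = (L + norm g) * dist w v + e/2" by (simp add: algebra_simps)
          also have "(L + norm g) * dist w v \<le> (L + norm g + 1) * \<eta>"
            using v(2) L by (intro mult_mono) (auto simp: dist_commute)
          also have "(L + norm g + 1) * \<eta> = e/2"
          proof -
            have "L + norm g + 1 > 0" using L by (simp add: add_nonneg_pos)
            then show ?thesis by (simp add: \<eta>_def field_simps)
          qed
          finally show ?thesis by simp
        qed
        with d(1) show ?thesis by blast
      qed
      then show "((\<lambda>y. ((f y - f x) - g \<bullet> (y - x)) /\<^sub>R norm (y - x)) \<longlongrightarrow> 0) (at x)"
        unfolding LIM_def dist_0_norm dist_norm[where x="_::real"] by (simp add: diff_diff_eq)
    qed
    then show ?case by blast
  qed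
qed

lemma Rademacher_on:
  fixes f :: "'a::euclidean_space \<Rightarrow> real"
  assumes f: "L-lipschitz_on U f" and U: "open U"
  shows "AE x in lborel. x \<in> U \<longrightarrow> (\<exists>g. (f has_derivative (\<lambda>h. g \<bullet> h)) (at x))"
proof (cases "U = {}")
  case False
  have L: "L \<ge> 0" using f by (rule lipschitz_on_nonneg)
  have lip: "f x - f y \<le> L * dist x y" if "x \<in> U" "y \<in> U" for x y
    using lipschitz_onD[OF f that] by (simp add: dist_real_def abs_le_iff)
  \<comment> \<open>McShane's extension\<close>
  define F where "F x = (INF y\<in>U. f y + L * dist x y)" for x
  obtain y0 where y0: "y0 \<in> U" using False by auto
  have bdd: "bdd_below ((\<lambda>y. f y + L * dist x y) ` U)" for x
  proof (rule bdd_belowI2)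
    fix y assume y: "y \<in> U"
    have "f y0 - f y \<le> L * dist y0 y" using lip y0 y by simp
    also have "\<dots> \<le> L * (dist y0 x + dist x y)" using L by (intro mult_left_mono dist_triangle) auto
    finally show "f y0 - L * dist y0 x \<le> f y + L * dist x y" by (simp add: algebra_simps)
  qed
  have FU: "F x = f x" if "x \<in> U" for x
  proof (rule antisym)
    show "F x \<le> f x" unfolding F_def using cINF_lower[OF bdd that, of x] by simp
    show "f x \<le> F x" unfolding F_def
    proof (rule cINF_greatest)
      show "f x \<le> f y + L * dist x y" if "y \<in> U" for y using lip[OF \<open>x \<in> U\<close> that] by simp
    qed (use False in auto)
  qed
  have F_le: "F x \<le> F z + L * dist x z" for x z
  proof -
    have "F x - L * dist x z \<le> F z" unfolding F_def[of z]
    proof (rule cINF_greatest)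
      fix y assume y: "y \<in> U"
      have "F x \<le> f y + L * dist x y" unfolding F_def by (rule cINF_lower[OF bdd y])
      also have "\<dots> \<le> f y + L * (dist x z + dist z y)"
        using L by (intro add_left_mono mult_left_mono dist_triangle) auto
      finally show "F x - L * dist x z \<le> f y + L * dist z y" by (simp add: algebra_simps)
    qed (use False in auto)
    then show ?thesis by simp
  qed
  have "L-lipschitz_on UNIV F"
  proof (rule lipschitz_onI)
    fix x y show "dist (F x) (F y) \<le> L * dist x y"
      using F_le[of x y] F_le[of y x] by (auto simp: dist_real_def abs_le_iff dist_commute)
  qed fact
  from Rademacher[OF this] show ?thesis
  proof eventually_elim
    case (elim x)
    show ?case
    proof
      assume "x \<in> U"
      then show "\<exists>g. (f has_derivative (\<lambda>h. g \<bullet> h)) (at x)"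
        using elim U FU by (auto intro: has_derivative_transform_within_open)
    qed
  qed
qed simp

section \<open>The midpoint form of the Prekopa-Leindler inequality\<close>

text \<open>One-dimensional Brunn-Minkowski. The half-size copy of \<open>A\<close> placed by a
  point \<open>b\<close> near the bottom of \<open>B\<close>, and that of \<open>B\<close> placed by
  a point \<open>a\<close> near the top of \<open>A\<close>, both lie in \<open>C\<close> and hardly
  overlap. Working with a given Borel set \<open>C\<close> sidesteps measurability of the set of
  midpoints.\<close>

lemma midpoint_measure_bounded:
  fixes A B C :: "real set"
  assumes [measurable]: "A \<in> sets borel" "B \<in> sets borel" "C \<in> sets borel"
    and ne: "A \<noteq> {}" "B \<noteq> {}" and bd: "bounded A" "bounded B"
    and mid: "\<And>x y. x \<in> A \<Longrightarrow> y \<in> B \<Longrightarrow> (x + y) / 2 \<in> C"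
  shows "emeasure lborel A + emeasure lborel B \<le> 2 * emeasure lborel C"
proof (rule ennreal_le_epsilon)
  fix e :: real assume e: "e > 0"
  have ba: "bdd_above A" and bb: "bdd_below B" using bd by (auto simp: bounded_imp_bdd_above bounded_imp_bdd_below)
  obtain a where a: "a \<in> A" "Sup A - e/2 < a" using less_cSupE[of "Sup A - e/2" A] ne e by auto
  obtain b where b: "b \<in> B" "b < Inf B + e/2" using cInf_lessD[of B "Inf B + e/2"] ne e by auto
  have half: "2 * emeasure lborel ((\<lambda>x. (x + c) / 2) ` S) = emeasure lborel S \<and> (\<lambda>x. (x + c) / 2) ` S \<in> sets borel"
    if [measurable]: "S \<in> sets borel" for S :: "real set" and c
  proof -
    have eq: "(\<lambda>x. (x + c) / 2) ` S = (\<lambda>x. 2 * x - c) -` S"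
      by (auto simp: image_iff field_simps intro!: bexI[of _ "2 * x - c" for x])
    have m: "(\<lambda>x. 2 * x - c) -` S \<in> sets borel"
      by (rule measurable_sets_borel[OF _ that]) auto
    have "emeasure lborel S = (\<integral>\<^sup>+x. indicator S x \<partial>lborel)" by simp
    also have "\<dots> = 2 * (\<integral>\<^sup>+x. indicator S (- c + 2 * x) \<partial>lborel)"
      by (subst nn_integral_real_affine[where c=2 and t="-c"]) auto
    also have "(\<integral>\<^sup>+x. indicator S (- c + 2 * x) \<partial>lborel) = (\<integral>\<^sup>+x. indicator ((\<lambda>x. 2 * x - c) -` S) x \<partial>lborel)"
      by (intro nn_integral_cong) (auto simp: indicator_def)
    also have "\<dots> = emeasure lborel ((\<lambda>x. 2 * x - c) -` S)" using m by simp
    finally show ?thesis using eq m by simp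
  qed
  let ?A = "(\<lambda>x. (x + b) / 2) ` A" and ?B = "(\<lambda>x. (x + a) / 2) ` B"
  have sub: "?A \<union> ?B \<subseteq> C" using mid[OF _ b(1)] mid[OF a(1)] by (auto simp: add.commute[of _ a])
  \<comment> \<open>For \<open>a = Sup A\<close> and \<open>b = Inf B\<close> this interval would be
    a single point; these values need not be attained, and the near-extremal choice leaves length at
    most \<open>e/2\<close>.\<close>
  have int: "?A \<inter> ?B \<subseteq> {(Inf B + a)/2 .. (Sup A + b)/2}"
  proof
    fix z assume "z \<in> ?A \<inter> ?B"
    then obtain x y where "x \<in> A" "z = (x + b)/2" "y \<in> B" "z = (y + a)/2" by auto
    then show "z \<in> {(Inf B + a)/2 .. (Sup A + b)/2}"
      using cSup_upper[OF _ ba, of x] cInf_lower[OF _ bb, of y] by auto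
  qed
  have "emeasure lborel (?A \<inter> ?B) \<le> emeasure lborel {(Inf B + a)/2 .. (Sup A + b)/2}"
    using int by (intro emeasure_mono) auto
  also have "\<dots> \<le> ennreal (e/2)"
  proof -
    have "(Sup A + b)/2 - (Inf B + a)/2 = ((Sup A - a) + (b - Inf B))/2" by (simp add: field_simps)
    also have "\<dots> \<le> (e/2 + e/2)/2" using a(2) b(2) by (intro divide_right_mono add_mono) auto
    finally have "(Sup A + b)/2 - (Inf B + a)/2 \<le> e/2" by simp
    moreover have "emeasure lborel {(Inf B + a)/2 .. (Sup A + b)/2} = ennreal ((Sup A + b)/2 - (Inf B + a)/2)"
      by (cases "(Inf B + a)/2 \<le> (Sup A + b)/2") (auto simp: ennreal_neg)
    ultimately show ?thesis using ennreal_leI by presburger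
  qed
  finally have small: "emeasure lborel (?A \<inter> ?B) \<le> ennreal (e/2)" .
  have "emeasure lborel ?A + emeasure lborel ?B = emeasure lborel (?A \<union> ?B) + emeasure lborel (?A \<inter> ?B)"
    using half by (intro emeasure_Un_Int) auto
  also have "\<dots> \<le> emeasure lborel C + ennreal (e/2)"
    using sub small half by (intro add_mono emeasure_mono) auto
  finally have "2 * (emeasure lborel ?A + emeasure lborel ?B) \<le> 2 * (emeasure lborel C + ennreal (e/2))"
    by (intro mult_left_mono) auto
  moreover have "2 * ennreal (e/2) = ennreal e" using e ennreal_mult[of 2 "e/2"] by simp
  ultimately show "emeasure lborel A + emeasure lborel B \<le> 2 * emeasure lborel C + ennreal e"
    using half[of A b] half[of B a] by (simp add: distrib_left)
qed

text \<open>Truncation to \<open>[-n, n]\<close>, with \<open>n\<close> so large that both sets stay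
  nonempty.\<close>

lemma midpoint_measure:
  fixes A B C :: "real set"
  assumes [measurable]: "A \<in> sets borel" "B \<in> sets borel" "C \<in> sets borel"
    and ne: "A \<noteq> {}" "B \<noteq> {}"
    and mid: "\<And>x y. x \<in> A \<Longrightarrow> y \<in> B \<Longrightarrow> (x + y) / 2 \<in> C"
  shows "emeasure lborel A + emeasure lborel B \<le> 2 * emeasure lborel C"
proof -
  obtain a b where ab: "a \<in> A" "b \<in> B" using ne by auto
  let ?I = "\<lambda>n. {-real n..real n}"
  have inc: "incseq (\<lambda>n. S \<inter> ?I n)" for S by (auto simp: incseq_def)
  have un: "(\<Union>n. ?I n) = UNIV"
  proof -
    have "\<exists>n. x \<in> ?I n" for x
    proof -
      obtain n where "\<bar>x\<bar> \<le> real n" using real_arch_simple by blast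
      then show ?thesis by (intro exI[of _ n]) auto
    qed
    then show ?thesis by blast
  qed
  have lim: "(\<lambda>n. emeasure lborel (S \<inter> ?I n)) \<longlonglongrightarrow> emeasure lborel S" if [measurable]: "S \<in> sets borel" for S
    using Lim_emeasure_incseq[OF _ inc, of S lborel] by (simp add: un image_subset_iff)
  have ev: "eventually (\<lambda>n. c \<in> ?I n) sequentially" for c
  proof -
    obtain n where "\<bar>c\<bar> \<le> real n" using real_arch_simple by blast
    then show ?thesis by (intro eventually_sequentiallyI[of n]) (auto simp: abs_le_iff)
  qed
  show ?thesis
  proof (rule tendsto_upperbound[OF tendsto_add[OF lim lim]])
    show "eventually (\<lambda>n. emeasure lborel (A \<inter> ?I n) + emeasure lborel (B \<inter> ?I n) \<le> 2 * emeasure lborel C) sequentially"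
      using ev[of a] ev[of b]
    proof eventually_elim
      case (elim n)
      show ?case using ab elim mid by (intro midpoint_measure_bounded) (auto intro: bounded_subset[of "?I n"])
    qed
  qed auto
qed

text \<open>The levels are restricted to \<open>0 < t < 1\<close> because this is where superlevel
  sets of functions with supremum one are nonempty.\<close>

lemma layer_cake_le_1:
  fixes f :: "'a \<Rightarrow> ennreal"
  assumes M: "sigma_finite_measure M" and f[measurable]: "f \<in> borel_measurable M" and le: "\<And>x. f x \<le> 1"
  shows "(\<integral>\<^sup>+x. f x \<partial>M) = (\<integral>\<^sup>+t. indicator {0<..<1} t * emeasure M {x\<in>space M. ennreal t < f x} \<partial>lborel)"
proof -
  interpret M: sigma_finite_measure M by fact
  interpret P: pair_sigma_finite M lborel ..
  have "(\<integral>\<^sup>+x. f x \<partial>M) = (\<integral>\<^sup>+x. \<integral>\<^sup>+t. indicator {0<..<1} t * (if ennreal t < f x then 1 else 0) \<partial>lborel \<partial>M)"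
  proof (rule nn_integral_cong)
    fix x
    obtain r where r: "f x = ennreal r" "r \<ge> 0" "r \<le> 1" using le[of x] by (cases "f x") (auto simp: top_unique)
    have "(\<integral>\<^sup>+t. indicator {0<..<1} t * (if ennreal t < f x then 1 else 0) \<partial>lborel) = (\<integral>\<^sup>+t. indicator {0<..<r} t \<partial>(lborel::real measure))"
      using r by (intro nn_integral_cong) (auto simp: indicator_def ennreal_less_iff)
    also have "\<dots> = f x" using r by simp
    finally show "f x = (\<integral>\<^sup>+t. indicator {0<..<1} t * (if ennreal t < f x then 1 else 0) \<partial>lborel)" by simp
  qed
  also have "\<dots> = (\<integral>\<^sup>+t. \<integral>\<^sup>+x. indicator {0<..<1} t * (if ennreal t < f x then 1 else 0) \<partial>M \<partial>lborel)"
    by (rule P.Fubini'[symmetric]) measurable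
  also have "\<dots> = (\<integral>\<^sup>+t. indicator {0<..<1} t * emeasure M {x\<in>space M. ennreal t < f x} \<partial>lborel)"
  proof (rule nn_integral_cong)
    fix t :: real
    have "(\<integral>\<^sup>+x. indicator {0<..<1} t * (if ennreal t < f x then 1 else 0) \<partial>M) = indicator {0<..<1} t * (\<integral>\<^sup>+x. (if ennreal t < f x then 1 else 0) \<partial>M)"
      by (rule nn_integral_cmult) measurable
    also have "(\<integral>\<^sup>+x. (if ennreal t < f x then 1 else 0) \<partial>M) = (\<integral>\<^sup>+x. indicator {x\<in>space M. ennreal t < f x} x \<partial>M)"
      by (intro nn_integral_cong) (auto simp: indicator_def)
    also have "\<dots> = emeasure M {x\<in>space M. ennreal t < f x}" by (rule nn_integral_indicator) measurable
    finally show "(\<integral>\<^sup>+x. indicator {0<..<1} t * (if ennreal t < f x then 1 else 0) \<partial>M) = indicator {0<..<1} t * emeasure M {x\<in>space M. ennreal t < f x}" .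
  qed
  finally show ?thesis .
qed

text \<open>By normalization the superlevel sets of \<open>f\<close> and \<open>g\<close> at a
  common level \<open>t < 1\<close> are nonempty, and their midpoints lie in that of
  \<open>h\<close>. Integrating the inequality for measures over \<open>t\<close> gives a bound on
  the sum of the integrals, from which the product form follows by the arithmetic-geometric mean
  inequality.\<close>

lemma prekopa_leindler_normalized:
  fixes f g h :: "real \<Rightarrow> ennreal"
  assumes [measurable]: "f \<in> borel_measurable borel" "g \<in> borel_measurable borel" "h \<in> borel_measurable borel"
    and sup: "(SUP x. f x) = 1" "(SUP x. g x) = 1"
    and mid: "\<And>x y. f x * g y \<le> (h ((x + y) / 2))\<^sup>2"
  shows "(\<integral>\<^sup>+x. f x \<partial>lborel) + (\<integral>\<^sup>+x. g x \<partial>lborel) \<le> 2 * (\<integral>\<^sup>+x. h x \<partial>lborel)"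
proof -
  let ?m = "\<lambda>f t. indicator {0<..<1} t * emeasure lborel {x::real. ennreal t < f x} :: ennreal"
  have le: "f x \<le> 1" "g x \<le> 1" for x using sup by (metis SUP_upper UNIV_I)+
  have m[measurable]: "?m f \<in> borel_measurable lborel" if [measurable]: "f \<in> borel_measurable borel" for f :: "real \<Rightarrow> ennreal"
  proof -
    have "(\<lambda>t. emeasure lborel {x\<in>space lborel. ennreal t < f x}) \<in> borel_measurable (lborel::real measure)"
      by (rule lborel.measurable_emeasure) measurable
    then show ?thesis by simp
  qed
  have "(\<integral>\<^sup>+x. f x \<partial>lborel) + (\<integral>\<^sup>+x. g x \<partial>lborel) = (\<integral>\<^sup>+t. ?m f t + ?m g t \<partial>lborel)"
    using layer_cake_le_1[OF lborel.sigma_finite_measure_axioms, of f] layer_cake_le_1[OF lborel.sigma_finite_measure_axioms, of g] le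
    by (subst nn_integral_add) auto
  \<comment> \<open>Only levels below one are compared, hence \<open>h\<close> is capped at
    one.\<close>
  also have "\<dots> \<le> (\<integral>\<^sup>+t. 2 * ?m (\<lambda>x. min (h x) 1) t \<partial>lborel)"
  proof (rule nn_integral_mono)
    fix t :: real
    show "?m f t + ?m g t \<le> 2 * ?m (\<lambda>x. min (h x) 1) t"
    proof (cases "0 < t \<and> t < 1")
      case True
      then have t1: "ennreal t < 1" by (simp add: ennreal_less_one_iff)
      have "emeasure lborel {x. ennreal t < f x} + emeasure lborel {x. ennreal t < g x} \<le> 2 * emeasure lborel {x. ennreal t < min (h x) 1}"
      proof (rule midpoint_measure)
        show "{x. ennreal t < f x} \<noteq> {}" "{x. ennreal t < g x} \<noteq> {}"
          using t1 sup by (metis (mono_tags, lifting) empty_Collect_eq less_SUP_iff)+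
        fix x y assume xy: "x \<in> {x. ennreal t < f x}" "y \<in> {x. ennreal t < g x}"
        show "(x + y) / 2 \<in> {x. ennreal t < min (h x) 1}"
        proof (rule ccontr)
          assume "(x + y) / 2 \<notin> {x. ennreal t < min (h x) 1}"
          then have "h ((x+y)/2) \<le> ennreal t" using t1 by (auto simp: not_less min_def split: if_splits)
          then have "(h ((x+y)/2))\<^sup>2 \<le> ennreal t * ennreal t" by (simp add: power2_eq_square mult_mono)
          also have "\<dots> < f x * ennreal t"
            using xy True by (intro ennreal_mult_strict_right_mono) auto
          also have "\<dots> \<le> f x * g y" using xy by (intro mult_left_mono) auto
          also have "\<dots> \<le> (h ((x + y) / 2))\<^sup>2" by (rule mid)
          finally show False by simp
        qed
      qed measurable
      then show ?thesis using True by simp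
    qed simp
  qed
  also have "\<dots> = 2 * (\<integral>\<^sup>+x. min (h x) 1 \<partial>lborel)"
    using layer_cake_le_1[OF lborel.sigma_finite_measure_axioms, of "\<lambda>x. min (h x) 1"] 
    by (subst nn_integral_cmult) auto
  also have "\<dots> \<le> 2 * (\<integral>\<^sup>+x. h x \<partial>lborel)" by (intro mult_left_mono nn_integral_mono) auto
  finally show ?thesis .
qed


lemma ennreal_am_gm: "4 * (x * y) \<le> ((x::ennreal) + y)\<^sup>2"
proof (cases x; cases y)
  fix a b :: real assume *: "x = ennreal a" "a \<ge> 0" "y = ennreal b" "b \<ge> 0"
  have "4 * (a * b) \<le> (a + b)\<^sup>2" using zero_le_power2[of "a - b"] by (simp add: power2_eq_square algebra_simps)
  then have "ennreal (4 * (a * b)) \<le> ennreal ((a+b)\<^sup>2)" by (rule ennreal_leI)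
  moreover have "ennreal ((a+b)\<^sup>2) = (ennreal a + ennreal b)\<^sup>2" using * by (simp add: ennreal_power[symmetric])
  ultimately show ?thesis using * by (simp add: ennreal_mult)
qed (auto simp: power2_eq_square ennreal_top_mult ennreal_mult_top)

text \<open>Dividing \<open>f\<close> and \<open>g\<close> by their suprema \<open>a\<close> and
  \<open>b\<close>, and \<open>h\<close> by \<open>sqrt (a * b)\<close>, preserves the midpoint
  hypothesis. The sum inequality for the rescaled functions turns into the product inequality by
  \<open>ennreal_am_gm\<close>.\<close>

lemma prekopa_leindler_real_bounded:
  fixes f g h :: "real \<Rightarrow> ennreal"
  assumes [measurable]: "f \<in> borel_measurable borel" "g \<in> borel_measurable borel" "h \<in> borel_measurable borel"
    and bd: "\<And>x. f x \<le> ennreal B" "\<And>x. g x \<le> ennreal B"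
    and mid: "\<And>x y. f x * g y \<le> (h ((x + y) / 2))\<^sup>2"
  shows "(\<integral>\<^sup>+x. f x \<partial>lborel) * (\<integral>\<^sup>+x. g x \<partial>lborel) \<le> (\<integral>\<^sup>+x. h x \<partial>lborel)\<^sup>2"
proof (cases "(SUP x. f x) = 0 \<or> (SUP x. g x) = 0")
  case True
  then have "(\<forall>x. f x = 0) \<or> (\<forall>x. g x = 0)" by (metis SUP_upper UNIV_I le_zero_eq)
  then show ?thesis by auto
next
  case False
  have "(SUP x. f x) \<le> ennreal B" "(SUP x. g x) \<le> ennreal B" using bd by (auto intro!: SUP_least)
  then obtain a b where a: "(SUP x. f x) = ennreal a" "a > 0" and b: "(SUP x. g x) = ennreal b" "b > 0"
    using False by (cases "SUP x. f x"; cases "SUP x. g x") (auto simp: top_unique less_le)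
  define \<gamma> where "\<gamma> = 1 / sqrt (a * b)"
  have \<gamma>: "\<gamma> > 0" "\<gamma>\<^sup>2 = 1/a * (1/b)" using a b by (auto simp: \<gamma>_def power_divide)
  have \<gamma>2: "(ennreal \<gamma>)\<^sup>2 = ennreal (1/a) * ennreal (1/b)"
    using \<gamma> a b by (simp add: ennreal_power ennreal_mult[symmetric])
  have "(\<integral>\<^sup>+x. ennreal (1/a) * f x \<partial>lborel) + (\<integral>\<^sup>+x. ennreal (1/b) * g x \<partial>lborel) \<le> 2 * (\<integral>\<^sup>+x. ennreal \<gamma> * h x \<partial>lborel)"
  proof (rule prekopa_leindler_normalized)
    show "(SUP x. ennreal (1/a) * f x) = 1" "(SUP x. ennreal (1/b) * g x) = 1"
      using a b by (simp_all add: SUP_mult_left_ennreal[symmetric] ennreal_mult[symmetric])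
    fix x y
    have "ennreal (1/a) * f x * (ennreal (1/b) * g y) = (ennreal \<gamma>)\<^sup>2 * (f x * g y)"
      by (simp add: \<gamma>2 mult_ac)
    also have "\<dots> \<le> (ennreal \<gamma>)\<^sup>2 * (h ((x+y)/2))\<^sup>2" using mid by (intro mult_left_mono) auto
    finally show "ennreal (1/a) * f x * (ennreal (1/b) * g y) \<le> (ennreal \<gamma> * h ((x+y)/2))\<^sup>2"
      by (simp add: power_mult_distrib)
  qed measurable
  then have le: "ennreal (1/a) * (\<integral>\<^sup>+x. f x \<partial>lborel) + ennreal (1/b) * (\<integral>\<^sup>+x. g x \<partial>lborel) \<le> 2 * (ennreal \<gamma> * (\<integral>\<^sup>+x. h x \<partial>lborel))"
    by (simp add: nn_integral_cmult)
  let ?F = "\<integral>\<^sup>+x. f x \<partial>lborel" and ?G = "\<integral>\<^sup>+x. g x \<partial>lborel" and ?H = "\<integral>\<^sup>+x. h x \<partial>lborel"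
  have "4 * (ennreal \<gamma>)\<^sup>2 * (?F * ?G)
     = 4 * ((ennreal (1/a) * ?F) * (ennreal (1/b) * ?G))"
    by (simp add: \<gamma>2 mult_ac)
  also have "\<dots> \<le> (2 * (ennreal \<gamma> * ?H))\<^sup>2"
    using le by (intro order_trans[OF ennreal_am_gm] power_mono) auto
  also have "\<dots> = 4 * (ennreal \<gamma>)\<^sup>2 * ?H\<^sup>2"
    by (simp add: power_mult_distrib mult.assoc)
  finally show ?thesis
    using \<gamma>(1) by (subst (asm) ennreal_mult_le_mult_iff) (auto simp: ennreal_mult_eq_top_iff power_eq_top_ennreal)
qed

lemma prekopa_leindler_real:
  fixes f g h :: "real \<Rightarrow> ennreal"
  assumes [measurable]: "f \<in> borel_measurable borel" "g \<in> borel_measurable borel" "h \<in> borel_measurable borel"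
    and mid: "\<And>x y. f x * g y \<le> (h ((x + y) / 2))\<^sup>2"
  shows "(\<integral>\<^sup>+x. f x \<partial>lborel) * (\<integral>\<^sup>+x. g x \<partial>lborel) \<le> (\<integral>\<^sup>+x. h x \<partial>lborel)\<^sup>2"
proof -
  have lim: "(\<lambda>n. \<integral>\<^sup>+x. min (f x) (of_nat n) \<partial>lborel) \<longlonglongrightarrow> (\<integral>\<^sup>+x. f x \<partial>lborel)"
    if [measurable]: "f \<in> borel_measurable borel" for f :: "real \<Rightarrow> ennreal"
  proof (rule nn_integral_LIMSEQ)
    show "incseq (\<lambda>n x. min (f x) (of_nat n))" by (auto simp: incseq_def le_fun_def min_def order_trans)
    fix x show "(\<lambda>n. min (f x) (of_nat n)) \<longlonglongrightarrow> f x"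
      using tendsto_min[OF tendsto_const of_nat_tendsto_top_ennreal, of "f x"] by simp
  qed simp
  \<comment> \<open>Independent truncation levels allow the two suprema to be taken one after the
    other.\<close>
  have b: "(\<integral>\<^sup>+x. min (f x) (of_nat m) \<partial>lborel) * (\<integral>\<^sup>+x. min (g x) (of_nat n) \<partial>lborel) \<le> (\<integral>\<^sup>+x. h x \<partial>lborel)\<^sup>2" for m n
  proof (rule prekopa_leindler_real_bounded[where B="real (max m n)"])
    show "min (f x) (of_nat m) \<le> ennreal (real (max m n))" "min (g x) (of_nat n) \<le> ennreal (real (max m n))" for x
      by (auto simp: ennreal_of_nat_eq_real_of_nat min_def intro: order_trans)
    fix x y
    have "min (f x) (of_nat m) * min (g y) (of_nat n) \<le> f x * g y" by (intro mult_mono) auto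
    also have "\<dots> \<le> (h ((x+y)/2))\<^sup>2" by (rule mid)
    finally show "min (f x) (of_nat m) * min (g y) (of_nat n) \<le> (h ((x+y)/2))\<^sup>2" .
  qed measurable
  have sup: "(\<integral>\<^sup>+x. f x \<partial>lborel) = (SUP n. \<integral>\<^sup>+x. min (f x) (of_nat n) \<partial>lborel)"
    if [measurable]: "f \<in> borel_measurable borel" for f :: "real \<Rightarrow> ennreal"
    by (rule LIMSEQ_unique[OF lim[OF that] LIMSEQ_SUP])
       (auto simp: incseq_def intro!: nn_integral_mono intro: order_trans min.mono)
  show ?thesis
    unfolding sup[OF assms(1)] sup[OF assms(2)] SUP_mult_left_ennreal SUP_mult_right_ennreal
    by (intro SUP_least b)
qed


text \<open>Integrating out one coordinate preserves the midpoint hypothesis: for fixed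
  \<open>x\<close> and \<open>y\<close> the one-dimensional inequality applies to the slices, and
  its conclusion is the hypothesis for the marginals. Extensional functions are the points of the
  product space, hence the restriction in the hypothesis.\<close>

lemma prekopa_leindler_PiM:
  fixes f g h :: "('i \<Rightarrow> real) \<Rightarrow> ennreal"
  assumes "finite I"
    and "f \<in> borel_measurable (Pi\<^sub>M I (\<lambda>_. lborel))" "g \<in> borel_measurable (Pi\<^sub>M I (\<lambda>_. lborel))"
        "h \<in> borel_measurable (Pi\<^sub>M I (\<lambda>_. lborel))"
    and "\<And>x y. x \<in> extensional I \<Longrightarrow> y \<in> extensional I \<Longrightarrow> f x * g y \<le> (h (\<lambda>i\<in>I. (x i + y i) / 2))\<^sup>2"
  shows "(\<integral>\<^sup>+x. f x \<partial>Pi\<^sub>M I (\<lambda>_. lborel)) * (\<integral>\<^sup>+x. g x \<partial>Pi\<^sub>M I (\<lambda>_. lborel)) \<le> (\<integral>\<^sup>+x. h x \<partial>Pi\<^sub>M I (\<lambda>_. lborel))\<^sup>2"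
  using assms
proof (induction I arbitrary: f g h rule: finite_induct)
  case empty
  interpret product_sigma_finite "\<lambda>_::'i. lborel :: real measure" ..
  have u: "(\<lambda>_. undefined) \<in> extensional ({} :: 'i set)" by (auto simp: extensional_def)
  show ?case using empty.prems(4)[OF u u] by (simp add: nn_integral_empty)
next
  case (insert i I)
  interpret product_sigma_finite "\<lambda>_::'i. lborel :: real measure" ..
  note [measurable] = insert.prems(1-3)
  have slice: "(\<lambda>y. k (x(i := y))) \<in> borel_measurable borel"
    if "k \<in> borel_measurable (Pi\<^sub>M (insert i I) (\<lambda>_. lborel))" "x \<in> extensional I" for k :: "('i \<Rightarrow> real) \<Rightarrow> ennreal" and x
  proof -
    have "x \<in> space (Pi\<^sub>M I (\<lambda>_. lborel))" using that(2) by (simp add: space_PiM PiE_def)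
    from measurable_comp[OF measurable_component_update[OF this insert.hyps(2)] that(1)] show ?thesis
      by (simp add: comp_def)
  qed
  have marg: "(\<lambda>x. \<integral>\<^sup>+y. k (x(i := y)) \<partial>lborel) \<in> borel_measurable (Pi\<^sub>M I (\<lambda>_. lborel))"
    if [measurable]: "k \<in> borel_measurable (Pi\<^sub>M (insert i I) (\<lambda>_. lborel))" for k :: "('i \<Rightarrow> real) \<Rightarrow> ennreal"
    using insert.hyps(2) by measurable
  show ?case
    unfolding product_nn_integral_insert[OF insert.hyps insert.prems(1)]
      product_nn_integral_insert[OF insert.hyps insert.prems(2)] product_nn_integral_insert[OF insert.hyps insert.prems(3)]
  proof (rule insert.IH)
    fix x y :: "'i \<Rightarrow> real" assume xy: "x \<in> extensional I" "y \<in> extensional I"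
    let ?m = "\<lambda>j\<in>I. (x j + y j) / 2"
    show "(\<integral>\<^sup>+s. f (x(i := s)) \<partial>lborel) * (\<integral>\<^sup>+t. g (y(i := t)) \<partial>lborel) \<le> (\<integral>\<^sup>+s. h (?m(i := s)) \<partial>lborel)\<^sup>2"
    proof (rule prekopa_leindler_real)
      fix s t
      have e: "x(i := s) \<in> extensional (insert i I)" "y(i := t) \<in> extensional (insert i I)"
        using xy by (auto simp: extensional_def)
      have "(\<lambda>j\<in>insert i I. ((x(i := s)) j + (y(i := t)) j) / 2) = ?m(i := (s + t) / 2)"
        using insert.hyps(2) by (auto simp: fun_eq_iff)
      then show "f (x(i := s)) * g (y(i := t)) \<le> (h (?m(i := (s + t) / 2)))\<^sup>2"
        using insert.prems(4)[OF e] by (simp only:)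
    qed (auto intro!: slice insert.prems xy)
  qed (rule marg[OF insert.prems(1)] marg[OF insert.prems(2)] marg[OF insert.prems(3)])+
qed

theorem prekopa_leindler:
  fixes f g h :: "'a::euclidean_space \<Rightarrow> ennreal"
  assumes [measurable]: "f \<in> borel_measurable borel" "g \<in> borel_measurable borel" "h \<in> borel_measurable borel"
    and mid: "\<And>x y. f x * g y \<le> (h ((1/2) *\<^sub>R (x + y)))\<^sup>2"
  shows "(\<integral>\<^sup>+x. f x \<partial>lborel) * (\<integral>\<^sup>+x. g x \<partial>lborel) \<le> (\<integral>\<^sup>+x. h x \<partial>lborel)\<^sup>2"
proof -
  let ?T = "\<lambda>x. \<Sum>b\<in>Basis. x b *\<^sub>R b :: 'a"
  let ?P = "Pi\<^sub>M (Basis :: 'a set) (\<lambda>_. lborel :: real measure)"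
  have T[measurable]: "?T \<in> measurable ?P borel" by measurable
  have lb: "(lborel :: 'a measure) = distr ?P borel ?T"
    unfolding lborel_def[where 'a='a] lborel_eq_real by (simp add: lborel_def)
  have eq: "(\<integral>\<^sup>+x. k x \<partial>lborel) = (\<integral>\<^sup>+x. k (?T x) \<partial>?P)" if "k \<in> borel_measurable borel" for k :: "'a \<Rightarrow> ennreal"
    unfolding lb using that by (intro nn_integral_distr) auto
  show ?thesis
    unfolding eq[OF assms(1)] eq[OF assms(2)] eq[OF assms(3)]
  proof (rule prekopa_leindler_PiM)
    fix x y :: "'a \<Rightarrow> real"
    have "?T (\<lambda>i\<in>Basis. (x i + y i) / 2) = (1/2) *\<^sub>R (?T x + ?T y)"
      by (simp add: scaleR_sum_right sum.distrib[symmetric] algebra_simps add_divide_distrib cong: sum.cong)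
    then show "f (?T x) * g (?T y) \<le> (h (?T (\<lambda>i\<in>Basis. (x i + y i) / 2)))\<^sup>2"
      using mid[of "?T x" "?T y"] by simp
  qed measurable
qed

section \<open>The second variation of an integral of powers\<close>

lemma powr_bounded_on_interval:
  fixes c d r :: real
  assumes "0 < c"
  shows "\<exists>C\<ge>0. \<forall>t. c \<le> t \<and> t \<le> d \<longrightarrow> t powr r \<le> C"
proof -
  have "compact ((\<lambda>t. t powr r) ` {c..d})"
    using assms by (intro compact_continuous_image continuous_intros) auto
  then obtain C where "\<forall>t\<in>{c..d}. norm (t powr r) \<le> C"
    using bounded_iff compact_imp_bounded by (metis image_eqI)
  then have "\<forall>t. c \<le> t \<and> t \<le> d \<longrightarrow> t powr r \<le> \<bar>C\<bar>" by force
  then show ?thesis by (intro exI[of _ "\<bar>C\<bar>"]) auto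
qed

text \<open>The products over factorials are generalized binomial coefficients. Since
  \<open>a + x\<close> stays in \<open>[\<delta>/2, K + \<delta>/2]\<close>, the derivative in the
  Lagrange remainder is bounded uniformly in \<open>a\<close>.\<close>

lemma powr_taylor:
  fixes q \<delta> K :: real
  assumes \<delta>: "\<delta> > 0" and n: "n > 0"
  shows "\<exists>C\<ge>0. \<forall>a x. \<delta> \<le> a \<and> a \<le> K \<and> \<bar>x\<bar> \<le> \<delta>/2 \<longrightarrow>
    \<bar>(a + x) powr q - (\<Sum>m<n. (\<Prod>i<m. q - real i) / fact m * a powr (q - real m) * x ^ m)\<bar> \<le> C * \<bar>x\<bar> ^ n"
proof -
  obtain B where B: "B \<ge> 0" "\<And>t. \<delta>/2 \<le> t \<Longrightarrow> t \<le> K + \<delta>/2 \<Longrightarrow> t powr (q - real n) \<le> B"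
    using powr_bounded_on_interval[of "\<delta>/2" "K + \<delta>/2" "q - real n"] \<delta> by auto
  define C where "C = \<bar>\<Prod>i<n. q - real i\<bar> / fact n * B"
  define diff where "diff m t = (\<Prod>i<m. q - real i) * t powr (q - real m)" for m t
  have "\<bar>(a + x) powr q - (\<Sum>m<n. (\<Prod>i<m. q - real i) / fact m * a powr (q - real m) * x ^ m)\<bar> \<le> C * \<bar>x\<bar> ^ n"
    if a: "\<delta> \<le> a" "a \<le> K" and x: "\<bar>x\<bar> \<le> \<delta>/2" for a x
  proof (cases "x = 0")
    case False
    have der: "\<forall>m t. m < n \<and> \<delta>/2 \<le> t \<and> t \<le> K + \<delta>/2 \<longrightarrow> DERIV (diff m) t :> diff (Suc m) t"
      using \<delta> unfolding diff_def by (auto intro!: derivative_eq_intros simp: algebra_simps)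
    have "\<exists>t. (if a + x < a then a + x < t \<and> t < a else a < t \<and> t < a + x) \<and>
      (a + x) powr q = (\<Sum>m<n. (diff m a / fact m) * (a + x - a)^m) + (diff n t / fact n) * (a + x - a)^n"
      by (rule Taylor[of n diff "\<lambda>t. t powr q" "\<delta>/2" "K + \<delta>/2" a "a + x", OF n _ der])
         (use a x \<delta> False in \<open>auto simp: diff_def abs_le_iff\<close>)
    then obtain t where t: "if a + x < a then a + x < t \<and> t < a else a < t \<and> t < a + x"
      and eq: "(a + x) powr q = (\<Sum>m<n. (diff m a / fact m) * x^m) + (diff n t / fact n) * x^n"
      by auto
    have "\<delta>/2 \<le> t" "t \<le> K + \<delta>/2" using t a x \<delta> by (auto simp: abs_le_iff split: if_splits)
    then have "t powr (q - real n) \<le> B" by (rule B)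
    then have "\<bar>diff n t / fact n\<bar> \<le> C"
      by (auto simp: diff_def C_def abs_mult abs_divide intro!: divide_right_mono mult_left_mono)
    then have "\<bar>(diff n t / fact n) * x^n\<bar> \<le> C * \<bar>x\<bar>^n"
      by (simp only: abs_mult power_abs mult_right_mono zero_le_power abs_ge_zero)
    then show ?thesis using eq by (simp add: diff_def)
  qed (use \<delta> a n in \<open>auto simp: lessThan_Suc_eq_insert_0 gr0_conv_Suc sum.lessThan_Suc_shift simp del: sum.lessThan_Suc\<close>)
  then show ?thesis using B(1) by (intro exI[of _ C]) (auto simp: C_def)
qed

lemma integrable_bounded_measurable:
  fixes f :: "'a \<Rightarrow> real"
  assumes "finite_measure M" "f \<in> borel_measurable M" "\<And>x. x \<in> space M \<Longrightarrow> \<bar>f x\<bar> \<le> B"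
  shows "integrable M f"
  using assms by (intro finite_measure.integrable_const_bound[where B=B]) (auto intro!: AE_I2)

text \<open>With \<open>q = p + 1\<close>, each left factor is at least
  \<open>A + s^2 (q p / 2) V - O(s^3)\<close>, its first-order term vanishing by
  \<open>zero\<close>, while the integral squared on the right is at most
  \<open>A + q s^2 W + O(s^4)\<close>. Taking roots, cancelling \<open>A\<close> and dividing by
  \<open>s^2\<close> leaves \<open>p V \<le> 2 W\<close> up to a vanishing error. Reverse Fatou then
  bounds the limit superior of \<open>2 W\<close> by the integral of
  \<open>Q x * \<phi> x powr p\<close>.\<close>

lemma second_variation:
  fixes \<phi> g Q :: "'a \<Rightarrow> real" and k :: "nat \<Rightarrow> 'a \<Rightarrow> real" and s :: "nat \<Rightarrow> real"
  assumes M: "finite_measure M" and pos: "emeasure M (space M) > 0"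
    and meas[measurable]: "\<phi> \<in> borel_measurable M" "g \<in> borel_measurable M" "\<And>n. k n \<in> borel_measurable M"
    and \<delta>: "\<delta> > 0" and p: "p > 0"
    and \<phi>: "\<And>x. x \<in> space M \<Longrightarrow> \<delta> \<le> \<phi> x \<and> \<phi> x \<le> K"
    and g: "\<And>x. x \<in> space M \<Longrightarrow> \<bar>g x\<bar> \<le> G"
    and k: "\<And>n x. x \<in> space M \<Longrightarrow> 0 \<le> k n x \<and> k n x \<le> H"
    and s: "s \<longlonglongrightarrow> 0" "\<And>n. s n > 0"
    and zero: "(\<integral>x. g x * \<phi> x powr p \<partial>M) = 0"
    and Q: "AE x in M. \<forall>e>0. eventually (\<lambda>n. k n x \<le> Q x / 2 + e) sequentially"
    and PL: "\<And>n. s n * G \<le> \<delta> / 2 \<Longrightarrow>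
       (\<integral>x. (\<phi> x + s n * g x) powr (p+1) \<partial>M) * (\<integral>x. (\<phi> x - s n * g x) powr (p+1) \<partial>M)
         \<le> (\<integral>x. (\<phi> x + (s n)\<^sup>2 * k n x) powr (p+1) \<partial>M)\<^sup>2"
  shows "ennreal (p * (\<integral>x. (g x)\<^sup>2 * \<phi> x powr (p-1) \<partial>M)) \<le> (\<integral>\<^sup>+x. ennreal (Q x * \<phi> x powr p) \<partial>M)"
proof -
  interpret finite_measure M by fact
  define q where "q = p + 1"
  define m where "m = measure M (space M)"
  have ne: "space M \<noteq> {}" using pos by auto
  then obtain x0 where x0: "x0 \<in> space M" by auto
  have GH: "G \<ge> 0" "H \<ge> 0" using g[OF x0] k[OF x0] by (auto intro: order_trans[OF abs_ge_zero] order_trans)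
  have m: "m \<ge> 0" by (simp add: m_def)
  \<comment> \<open>A third-order remainder for the left factors, whose second-order term is the
    quantity sought.\<close>
  obtain C where C: "C \<ge> 0" "\<And>a x. \<delta> \<le> a \<Longrightarrow> a \<le> K \<Longrightarrow> \<bar>x\<bar> \<le> \<delta>/2 \<Longrightarrow>
    \<bar>(a + x) powr q - (a powr q + q * a powr p * x + q * p / 2 * a powr (p-1) * x\<^sup>2)\<bar> \<le> C * \<bar>x\<bar> ^ 3"
    using powr_taylor[OF \<delta>, of 3 K q] by (auto simp: q_def eval_nat_numeral algebra_simps)
  \<comment> \<open>On the right the increment is itself of order \<open>s^2\<close>, so a
    second-order remainder is already of order \<open>s^4\<close>.\<close>
  obtain D where D: "D \<ge> 0" "\<And>a x. \<delta> \<le> a \<Longrightarrow> a \<le> K \<Longrightarrow> \<bar>x\<bar> \<le> \<delta>/2 \<Longrightarrow>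
    \<bar>(a + x) powr q - (a powr q + q * a powr p * x)\<bar> \<le> D * \<bar>x\<bar> ^ 2"
    using powr_taylor[OF \<delta>, of 2 K q] by (auto simp: q_def eval_nat_numeral algebra_simps)
  have bnd: "\<exists>B. \<forall>x\<in>space M. \<phi> x powr r \<le> B" for r
    using powr_bounded_on_interval[OF \<delta>, of K r] \<phi> by blast
  have int\<phi>: "integrable M (\<lambda>x. h x * \<phi> x powr r)" 
    if [measurable]: "h \<in> borel_measurable M" and h: "\<And>x. x \<in> space M \<Longrightarrow> \<bar>h x\<bar> \<le> b" for h :: "'a \<Rightarrow> real" and r b
  proof -
    obtain B where B: "\<forall>x\<in>space M. \<phi> x powr r \<le> B" using bnd by blast
    show ?thesis
    proof (rule integrable_bounded_measurable[OF M])
      fix x assume x: "x \<in> space M"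
      have "\<bar>h x * \<phi> x powr r\<bar> = \<bar>h x\<bar> * \<phi> x powr r" by (simp add: abs_mult)
      also have "\<dots> \<le> b * B" using h[OF x] B x by (intro mult_mono) (auto intro: order_trans[OF abs_ge_zero])
      finally show "\<bar>h x * \<phi> x powr r\<bar> \<le> b * B" .
    qed measurable
  qed
  define A where "A = (\<integral>x. \<phi> x powr q \<partial>M)"
  define V where "V = (\<integral>x. (g x)\<^sup>2 * \<phi> x powr (p-1) \<partial>M)"
  define W where "W n = (\<integral>x. k n x * \<phi> x powr p \<partial>M)" for n
  have i1: "integrable M (\<lambda>x. \<phi> x powr q)" using int\<phi>[of "\<lambda>_. 1" 1 q] by simp
  have i2: "integrable M (\<lambda>x. g x * \<phi> x powr p)" using g by (intro int\<phi>) auto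
  have i3: "integrable M (\<lambda>x. (g x)\<^sup>2 * \<phi> x powr (p-1))"
  proof (rule int\<phi>)
    fix x assume "x \<in> space M"
    then show "\<bar>(g x)\<^sup>2\<bar> \<le> G\<^sup>2" using g[of x] by (simp add: abs_le_square_iff[symmetric])
  qed measurable
  have i4: "integrable M (\<lambda>x. k n x * \<phi> x powr p)" for n using k by (intro int\<phi>[where b=H]) auto
  have Apos: "A > 0"
  proof -
    have "m > 0" using pos unfolding m_def by (simp add: emeasure_eq_measure)
    then have "0 < m * \<delta> powr q" using \<delta> by simp
    also have "\<dots> = (\<integral>x. \<delta> powr q \<partial>M)" by (simp add: m_def)
    also have "\<dots> \<le> A" unfolding A_def using \<phi> \<delta> p i1
      by (intro integral_mono) (auto simp: q_def intro!: powr_mono2)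
    finally show ?thesis .
  qed
  \<comment> \<open>The sign of \<sigma> is free: \<open>s n\<close> and \<open>- s n\<close> give
    the two factors with one and the same lower bound.\<close>
  have lower: "A + (\<sigma> * q * p / 2) * \<sigma> * V - C * (\<bar>\<sigma>\<bar> * G)^3 * m \<le> (\<integral>x. (\<phi> x + \<sigma> * g x) powr q \<partial>M)"
    if \<sigma>: "\<bar>\<sigma>\<bar> * G \<le> \<delta>/2" for \<sigma>
  proof -
    let ?T = "\<lambda>x. (\<phi> x powr q + q * \<sigma> * (g x * \<phi> x powr p) + (\<sigma> * q * p / 2) * \<sigma> * ((g x)\<^sup>2 * \<phi> x powr (p-1))) - C * (\<bar>\<sigma>\<bar> * G)^3"
    have small: "\<bar>\<sigma> * g x\<bar> \<le> \<bar>\<sigma>\<bar> * G" if "x \<in> space M" for x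
      using g[OF that] by (auto simp: abs_mult intro!: mult_left_mono)
    have "A + (\<sigma> * q * p / 2) * \<sigma> * V - C * (\<bar>\<sigma>\<bar> * G)^3 * m
       = (\<integral>x. ?T x \<partial>M)"
      using i1 i2 i3 zero by (simp add: A_def V_def m_def)
    also have "\<dots> \<le> (\<integral>x. (\<phi> x + \<sigma> * g x) powr q \<partial>M)"
    proof (rule integral_mono)
      show "integrable M ?T"
        using i1 i2 i3 by simp
      show "integrable M (\<lambda>x. (\<phi> x + \<sigma> * g x) powr q)"
      proof (rule integrable_bounded_measurable[OF M])
        fix x assume x: "x \<in> space M"
        have "0 \<le> \<phi> x + \<sigma> * g x" "\<phi> x + \<sigma> * g x \<le> K + \<delta>/2"
          using small[OF x] \<sigma> \<phi>[OF x] \<delta> by (auto simp: abs_le_iff)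
        then show "\<bar>(\<phi> x + \<sigma> * g x) powr q\<bar> \<le> (K + \<delta>/2) powr q"
          using p by (auto simp: q_def intro!: powr_mono2)
      qed measurable
      fix x assume x: "x \<in> space M"
      have "\<bar>\<sigma> * g x\<bar> \<le> \<delta>/2" using small[OF x] \<sigma> by simp
      from C(2)[OF _ _ this, of "\<phi> x"] \<phi>[OF x]
      have "\<phi> x powr q + q * \<phi> x powr p * (\<sigma> * g x) + q * p / 2 * \<phi> x powr (p-1) * (\<sigma> * g x)\<^sup>2 - C * \<bar>\<sigma> * g x\<bar>^3 \<le> (\<phi> x + \<sigma> * g x) powr q"
        by (simp add: abs_le_iff)
      moreover have "C * \<bar>\<sigma> * g x\<bar>^3 \<le> C * (\<bar>\<sigma>\<bar> * G)^3"
        using small[OF x] C(1) by (intro mult_left_mono power_mono) auto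
      ultimately show "?T x \<le> (\<phi> x + \<sigma> * g x) powr q"
        by (simp add: power2_eq_square algebra_simps)
    qed
    finally show ?thesis .
  qed
  have upper: "(\<integral>x. (\<phi> x + \<sigma>\<^sup>2 * k n x) powr q \<partial>M) \<le> A + q * \<sigma>\<^sup>2 * W n + D * (\<sigma>\<^sup>2 * H)^2 * m"
    if \<sigma>: "\<sigma>\<^sup>2 * H \<le> \<delta>/2" for \<sigma> n
  proof -
    let ?T = "\<lambda>x. (\<phi> x powr q + q * \<sigma>\<^sup>2 * (k n x * \<phi> x powr p)) + D * (\<sigma>\<^sup>2 * H)^2"
    have small: "0 \<le> \<sigma>\<^sup>2 * k n x \<and> \<sigma>\<^sup>2 * k n x \<le> \<sigma>\<^sup>2 * H" if "x \<in> space M" for x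
      using k[OF that] by (auto intro!: mult_left_mono)
    have "(\<integral>x. (\<phi> x + \<sigma>\<^sup>2 * k n x) powr q \<partial>M) \<le> (\<integral>x. ?T x \<partial>M)"
    proof (rule integral_mono)
      show "integrable M ?T"
        using i1 i4 by simp
      show "integrable M (\<lambda>x. (\<phi> x + \<sigma>\<^sup>2 * k n x) powr q)"
      proof (rule integrable_bounded_measurable[OF M])
        fix x assume x: "x \<in> space M"
        have "0 \<le> \<phi> x + \<sigma>\<^sup>2 * k n x" "\<phi> x + \<sigma>\<^sup>2 * k n x \<le> K + \<delta>/2"
          using small[OF x] \<sigma> \<phi>[OF x] \<delta> by auto
        then show "\<bar>(\<phi> x + \<sigma>\<^sup>2 * k n x) powr q\<bar> \<le> (K + \<delta>/2) powr q"
          using p by (auto simp: q_def intro!: powr_mono2)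
      qed measurable
      fix x assume x: "x \<in> space M"
      have "\<bar>\<sigma>\<^sup>2 * k n x\<bar> \<le> \<delta>/2" using small[OF x] \<sigma> by simp
      from D(2)[OF _ _ this, of "\<phi> x"] \<phi>[OF x]
      have "(\<phi> x + \<sigma>\<^sup>2 * k n x) powr q \<le> \<phi> x powr q + q * \<phi> x powr p * (\<sigma>\<^sup>2 * k n x) + D * \<bar>\<sigma>\<^sup>2 * k n x\<bar>^2"
        by (simp add: abs_le_iff)
      moreover have "D * \<bar>\<sigma>\<^sup>2 * k n x\<bar>^2 \<le> D * (\<sigma>\<^sup>2 * H)^2"
        using small[OF x] D(1) by (intro mult_left_mono power_mono) auto
      ultimately show "(\<phi> x + \<sigma>\<^sup>2 * k n x) powr q \<le> ?T x"
        by (simp add: algebra_simps)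
    qed
    also have "\<dots> = A + q * \<sigma>\<^sup>2 * W n + D * (\<sigma>\<^sup>2 * H)^2 * m"
      using i1 i4 by (simp add: A_def W_def m_def)
    finally show ?thesis .
  qed
  \<comment> \<open>The cubic and quartic errors after division by \<open>s^2\<close>, times the
    \<open>2/q\<close> that turns the coefficient of \<open>V\<close> into \<open>p\<close>.\<close>
  define c where "c n = (2/q) * (s n * (C * G^3 * m) + (s n)\<^sup>2 * (D * H^2 * m))" for n
  have q: "q > 0" using p by (simp add: q_def)
  have c0: "c \<longlonglongrightarrow> 0" unfolding c_def using q s(1) by (auto intro!: tendsto_eq_intros)
  have ev: "eventually (\<lambda>n. p * V - c n \<le> 2 * W n) sequentially"
  proof -
    have t1: "(\<lambda>n. s n * G) \<longlonglongrightarrow> 0" "(\<lambda>n. (s n)\<^sup>2 * H) \<longlonglongrightarrow> 0"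
      using s(1) by (auto intro!: tendsto_eq_intros)
    \<comment> \<open>Eventual positivity of the lower bound is what permits multiplying it with
      itself.\<close>
    have t2: "(\<lambda>n. A + (s n * q * p / 2) * s n * V - C * (\<bar>s n\<bar> * G)^3 * m) \<longlonglongrightarrow> A"
      using s(1) by (auto intro!: tendsto_eq_intros)
    have "eventually (\<lambda>n. s n * G < \<delta>/2) sequentially" "eventually (\<lambda>n. (s n)\<^sup>2 * H < \<delta>/2) sequentially"
      "eventually (\<lambda>n. 0 < A + (s n * q * p / 2) * s n * V - C * (\<bar>s n\<bar> * G)^3 * m) sequentially"
      using order_tendstoD(2)[OF t1(1), of "\<delta>/2"] order_tendstoD(2)[OF t1(2), of "\<delta>/2"] order_tendstoD(1)[OF t2 Apos] \<delta>
      by simp_all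
    then show ?thesis
    proof eventually_elim
      case (elim n)
      let ?l = "A + (s n * q * p / 2) * s n * V - C * (\<bar>s n\<bar> * G)^3 * m"
      let ?P = "\<integral>x. (\<phi> x + s n * g x) powr q \<partial>M" and ?N = "\<integral>x. (\<phi> x - s n * g x) powr q \<partial>M"
        and ?K = "\<integral>x. (\<phi> x + (s n)\<^sup>2 * k n x) powr q \<partial>M"
      have sn: "s n > 0" by (rule s)
      have 1: "?l \<le> ?P" using elim sn by (intro lower) simp
      have 2: "?l \<le> ?N" using lower[of "- s n"] elim sn by simp
      have 3: "?K \<le> A + q * (s n)\<^sup>2 * W n + D * ((s n)\<^sup>2 * H)^2 * m"
        using elim by (intro upper) simp
      have "?l\<^sup>2 \<le> ?P * ?N"
        using 1 2 elim unfolding power2_eq_square by (intro mult_mono) auto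
      also have "\<dots> \<le> ?K\<^sup>2"
        using PL[of n] elim unfolding q_def by simp
      finally have "?l \<le> ?K"
        by (rule power2_le_imp_le) simp
      with 3 have "?l \<le> A + q * (s n)\<^sup>2 * W n + D * ((s n)\<^sup>2 * H)^2 * m" by simp
      then have "(s n)\<^sup>2 * (q * p / 2 * V) \<le> (s n)\<^sup>2 * (q * W n + s n * (C * G^3 * m) + (s n)\<^sup>2 * (D * H^2 * m))"
        using sn by (simp add: power2_eq_square power3_eq_cube algebra_simps)
      then have "q * p / 2 * V \<le> q * W n + s n * (C * G^3 * m) + (s n)\<^sup>2 * (D * H^2 * m)"
        using sn by (subst (asm) mult_le_cancel_left_pos) auto
      then have "(2/q) * (q * p / 2 * V) \<le> (2/q) * (q * W n + s n * (C * G^3 * m) + (s n)\<^sup>2 * (D * H^2 * m))"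
        using q by (intro mult_left_mono) auto
      then show ?case using q by (simp add: c_def distrib_left)
    qed
  qed
  define w where "w n x = ennreal (2 * (k n x * \<phi> x powr p))" for n x
  have [measurable]: "w n \<in> borel_measurable M" for n unfolding w_def by measurable
  have wW: "(\<integral>\<^sup>+x. w n x \<partial>M) = ennreal (2 * W n)" for n
    unfolding w_def W_def using i4[of n] k
    by (subst nn_integral_eq_integral) (auto intro!: AE_I2)
  have "(\<lambda>n. ennreal (p * V - c n)) \<longlonglongrightarrow> ennreal (p * V)"
    using tendsto_diff[OF tendsto_const c0, of "p*V"] by (intro tendsto_ennrealI) simp
  then have "ennreal (p * V) = limsup (\<lambda>n. ennreal (p * V - c n))"
    by (simp add: lim_imp_Limsup)
  also have "\<dots> \<le> limsup (\<lambda>n. \<integral>\<^sup>+x. w n x \<partial>M)"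
    unfolding wW using ev by (intro Limsup_mono) (auto elim!: eventually_mono intro!: ennreal_leI)
  also have "\<dots> \<le> (\<integral>\<^sup>+x. limsup (\<lambda>n. w n x) \<partial>M)"
  proof -
    obtain B where B: "\<forall>x\<in>space M. \<phi> x powr p \<le> B" using bnd by blast
    show ?thesis
    \<comment> \<open>Reverse Fatou: the bounds on \<open>k\<close> and \<phi> give a constant
      majorant, integrable because \<open>M\<close> is finite.\<close>
    proof (rule nn_integral_limsup[where w="\<lambda>_. ennreal (2 * (H * B))"])
      show "AE x in M. w n x \<le> ennreal (2 * (H * B))" for n
        unfolding w_def using B k GH by (intro AE_I2 ennreal_leI mult_left_mono mult_mono) auto
      show "(\<integral>\<^sup>+x. ennreal (2 * (H * B)) \<partial>M) < \<infinity>" by (simp add: ennreal_mult_less_top less_top emeasure_eq_measure)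
    qed measurable
  qed
  also have "\<dots> \<le> (\<integral>\<^sup>+x. ennreal (Q x * \<phi> x powr p) \<partial>M)"
  proof (rule nn_integral_mono_AE)
    show "AE x in M. limsup (\<lambda>n. w n x) \<le> ennreal (Q x * \<phi> x powr p)"
      using Q AE_space
    proof eventually_elim
      case (elim x)
      have \<phi>p: "\<phi> x powr p > 0" using \<phi>[OF elim(2)] \<delta> by simp
      show ?case
      proof (rule ennreal_le_epsilon)
        fix e :: real assume e: "e > 0"
        then have "e / (2 * \<phi> x powr p) > 0" using \<phi>p by simp
        then have "eventually (\<lambda>n. k n x \<le> Q x / 2 + e / (2 * \<phi> x powr p)) sequentially" using elim(1) by blast
        then have "eventually (\<lambda>n. w n x \<le> ennreal (Q x * \<phi> x powr p + e)) sequentially"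
        proof eventually_elim
          case (elim n)
          have "2 * (k n x * \<phi> x powr p) \<le> 2 * ((Q x / 2 + e / (2 * \<phi> x powr p)) * \<phi> x powr p)"
            using elim \<phi>p by (intro mult_left_mono mult_right_mono) auto
          also have "\<dots> = Q x * \<phi> x powr p + e" using \<phi>p by (simp add: field_simps)
          finally show ?case unfolding w_def by (rule ennreal_leI)
        qed
        then have "limsup (\<lambda>n. w n x) \<le> ennreal (Q x * \<phi> x powr p + e)" by (rule Limsup_bounded)
        also have "\<dots> \<le> ennreal (Q x * \<phi> x powr p) + ennreal e"
        \<comment> \<open>\<open>Q\<close> carries no sign here, and \<open>ennreal\<close>
          truncates a negative summand to zero.\<close>
        proof (cases "Q x * \<phi> x powr p \<ge> 0")
          case False
          then have "ennreal (Q x * \<phi> x powr p + e) \<le> ennreal e" by (intro ennreal_leI) simp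
          then show ?thesis using False by (simp add: ennreal_neg)
        qed (use e in simp)
        finally show "limsup (\<lambda>n. w n x) \<le> ennreal (Q x * \<phi> x powr p) + ennreal e" .
      qed
    qed
  qed
  finally show ?thesis by (simp add: V_def)
qed

section \<open>Gradients and Hessians\<close>

lemma grad_works:
  fixes f :: "real^'n \<Rightarrow> real"
  assumes "f differentiable (at x)"
  shows "(f has_derivative (\<lambda>h. grad f x \<bullet> h)) (at x)"
proof -
  obtain D where D: "(f has_derivative D) (at x)" using assms by (auto simp: differentiable_def)
  then have "linear D" by (rule has_derivative_linear)
  then have "D = (\<lambda>h. adjoint D 1 \<bullet> h)"
    using adjoint_works[of D _ 1] by (auto simp: fun_eq_iff inner_commute)
  then have "\<exists>g. (f has_derivative (\<lambda>h. g \<bullet> h)) (at x)" using D by metis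
  then show ?thesis unfolding grad_def by (auto intro: someI_ex)
qed

lemma hess_works:
  fixes f :: "real^'n \<Rightarrow> real"
  assumes "grad f differentiable (at x)"
  shows "(grad f has_derivative (\<lambda>h. hess f x *v h)) (at x)"
proof -
  obtain D where D: "(grad f has_derivative D) (at x)" using assms by (auto simp: differentiable_def)
  then have "linear D" by (rule has_derivative_linear)
  then have "D = (\<lambda>h. matrix D *v h)" by (auto simp: fun_eq_iff matrix_works)
  then have "\<exists>M. (grad f has_derivative (\<lambda>h. M *v h)) (at x)" using D by metis
  then show ?thesis unfolding hess_def by (auto intro: someI_ex)
qed

lemma differentiable_if_gradient_exists:
  assumes "\<exists>g. (f has_derivative (\<lambda>h. g \<bullet> h)) (at x)"
  shows "f differentiable (at x)"
  using assms by (auto simp: differentiable_def)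

text \<open>The mean value theorem along \<open>u\<close>, for the increment of \<phi> by
  \<open>v\<close>, leaves a difference of two gradients. Each is compared with its linear
  approximation at \<open>z\<close>, with error at most
  \<open>e * (norm u + norm v)\<close>.\<close>

lemma mixed_difference_le:
  fixes \<phi> :: "real^'n \<Rightarrow> real" and u v :: "real^'n"
  assumes diff: "\<And>y. norm (y - z) < d \<Longrightarrow> (\<phi> has_derivative (\<lambda>h. grad \<phi> y \<bullet> h)) (at y)"
    and H: "\<And>y. norm (y - z) < d \<Longrightarrow> norm (grad \<phi> y - grad \<phi> z - H *v (y - z)) \<le> e * norm (y - z)"
    and small: "norm u + norm v < d" and e: "e > 0"
  shows "\<bar>\<phi> (z + u + v) - \<phi> (z + u) - \<phi> (z + v) + \<phi> z - u \<bullet> (H *v v)\<bar> \<le> 2 * e * (norm u + norm v)\<^sup>2"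
proof -
  define \<psi> where "\<psi> s = \<phi> (z + s *\<^sub>R u + v) - \<phi> (z + s *\<^sub>R u)" for s :: real
  define w where "w s = z + s *\<^sub>R u" for s :: real
  have near: "norm (w s + v - z) < d \<and> norm (w s - z) < d \<and> norm (w s + v - z) \<le> norm u + norm v \<and> norm (w s - z) \<le> norm u + norm v"
    if "0 \<le> s" "s \<le> 1" for s
  proof -
    have s: "norm (s *\<^sub>R u) \<le> norm u" using that by (simp add: mult_left_le_one_le)
    have "norm (s *\<^sub>R u + v) \<le> norm u + norm v" using s norm_triangle_ineq[of "s *\<^sub>R u" v] by linarith
    moreover have "norm (s *\<^sub>R u) \<le> norm u + norm v" using s norm_ge_zero[of v] by linarith
    ultimately show ?thesis using small unfolding w_def by (simp add: algebra_simps)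
  qed
  have der: "(\<psi> has_real_derivative u \<bullet> (grad \<phi> (w s + v) - grad \<phi> (w s))) (at s)" if "0 \<le> s" "s \<le> 1" for s
  proof -
    have 1: "((\<lambda>s. \<phi> (w s + v)) has_derivative (\<lambda>h. grad \<phi> (w s + v) \<bullet> (h *\<^sub>R u))) (at s)"
      by (rule has_derivative_compose[of "\<lambda>s. w s + v" "\<lambda>h. h *\<^sub>R u"])
         (use near[OF that] diff in \<open>auto simp: w_def intro!: derivative_eq_intros\<close>)
    have 2: "((\<lambda>s. \<phi> (w s)) has_derivative (\<lambda>h. grad \<phi> (w s) \<bullet> (h *\<^sub>R u))) (at s)"
      by (rule has_derivative_compose[of "\<lambda>s. w s" "\<lambda>h. h *\<^sub>R u"])
         (use near[OF that] diff in \<open>auto simp: w_def intro!: derivative_eq_intros\<close>)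
    show ?thesis
      unfolding \<psi>_def has_field_derivative_def w_def[symmetric] using has_derivative_diff[OF 1 2]
      by (rule has_derivative_eq_rhs) (auto simp: w_def fun_eq_iff inner_diff_right inner_commute algebra_simps)
  qed
  have "\<exists>s>0. s < 1 \<and> \<psi> 1 - \<psi> 0 = (1 - 0) * (u \<bullet> (grad \<phi> (w s + v) - grad \<phi> (w s)))"
    by (rule MVT2) (auto intro: der)
  then obtain s where s: "0 < s" "s < 1" "\<psi> 1 - \<psi> 0 = u \<bullet> (grad \<phi> (w s + v) - grad \<phi> (w s))" by auto
  let ?E = "\<lambda>y. grad \<phi> y - grad \<phi> z - H *v (y - z)"
  have n: "norm (w s + v - z) < d" "norm (w s - z) < d" "norm (w s + v - z) \<le> norm u + norm v" "norm (w s - z) \<le> norm u + norm v"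
    using near[of s] s by auto
  have "grad \<phi> (w s + v) - grad \<phi> (w s) - H *v v = ?E (w s + v) - ?E (w s)"
    by (simp add: algebra_simps matrix_vector_mult_diff_distrib matrix_vector_right_distrib)
  then have "norm (grad \<phi> (w s + v) - grad \<phi> (w s) - H *v v) \<le> norm (?E (w s + v)) + norm (?E (w s))"
    by (metis norm_triangle_ineq4)
  also have "\<dots> \<le> e * norm (w s + v - z) + e * norm (w s - z)"
    using H[OF n(1)] H[OF n(2)] by (rule add_mono)
  also have "\<dots> \<le> e * (norm u + norm v) + e * (norm u + norm v)"
    using n e by (intro add_mono mult_left_mono) auto
  finally have b: "norm (grad \<phi> (w s + v) - grad \<phi> (w s) - H *v v) \<le> 2 * e * (norm u + norm v)" by simp
  have "\<phi> (z + u + v) - \<phi> (z + u) - \<phi> (z + v) + \<phi> z - u \<bullet> (H *v v) = u \<bullet> (grad \<phi> (w s + v) - grad \<phi> (w s) - H *v v)"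
    using s(3) by (simp add: \<psi>_def inner_diff_right)
  also have "\<bar>\<dots>\<bar> \<le> norm u * (2 * e * (norm u + norm v))"
    using Cauchy_Schwarz_ineq2 b by (meson mult_left_mono norm_ge_zero order_trans)
  also have "\<dots> \<le> (norm u + norm v) * (2 * e * (norm u + norm v))"
    using e by (intro mult_right_mono) auto
  finally show ?thesis by (simp add: power2_eq_square algebra_simps)
qed

text \<open>The mixed second difference is symmetric in \<open>u\<close> and \<open>v\<close>. For
  both vectors scaled by \<open>t\<close> it is \<open>t^2\<close> times either bilinear value up to
  a small multiple of \<open>t^2\<close>. Symmetry is what allows the square to be completed for the
  inverse Hessian.\<close>

lemma hess_symmetric:
  fixes \<phi> :: "real^'n \<Rightarrow> real"
  assumes S: "open S" "z \<in> S" and diff: "\<And>y. y \<in> S \<Longrightarrow> \<phi> differentiable (at y)"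
    and diff2: "grad \<phi> differentiable (at z)"
  shows "u \<bullet> (hess \<phi> z *v v) = v \<bullet> (hess \<phi> z *v u)"
proof -
  let ?H = "hess \<phi> z" and ?N = "norm u + norm v"
  have "\<bar>u \<bullet> (?H *v v) - v \<bullet> (?H *v u)\<bar> \<le> 0 + e" if e: "e > 0" for e
  proof -
    \<comment> \<open>Two errors of \<open>2 * \<eta> * (t * ?N)^2\<close> must stay below
      \<open>t^2 * e\<close>; the \<open>+ 1\<close> covers \<open>u = v = 0\<close>.\<close>
    define \<eta> where "\<eta> = e / (4 * (?N + 1)\<^sup>2)"
    have N: "?N + 1 > 0" by (simp add: add_nonneg_pos)
    have \<eta>: "\<eta> > 0" using e N by (simp add: \<eta>_def)
    obtain d1 where d1: "d1 > 0" "ball z d1 \<subseteq> S" using S by (meson open_contains_ball)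
    obtain d2 where d2: "d2 > 0" "\<And>y. norm (y - z) < d2 \<Longrightarrow> norm (grad \<phi> y - grad \<phi> z - ?H *v (y - z)) \<le> \<eta> * norm (y - z)"
      using hess_works[OF diff2] \<eta> unfolding has_derivative_at_alt by blast
    define d where "d = min d1 d2"
    have d: "d > 0" using d1 d2 by (simp add: d_def)
    define t where "t = d / (2 * (?N + 1))"
    have t: "t > 0" "t * ?N < d"
    proof -
      show "t > 0" using d N by (simp add: t_def)
      have "t * ?N \<le> t * (?N + 1)" using \<open>t > 0\<close> by (intro mult_left_mono) auto
      also have "\<dots> = d / 2"
      proof -
        have "d / (2 * M) * M = d / 2" if "M > 0" for M :: real using that by simp
        from this[OF N] show ?thesis by (simp only: t_def)
      qed
      finally show "t * ?N < d" using d by simp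
    qed
    have g: "(\<phi> has_derivative (\<lambda>h. grad \<phi> y \<bullet> h)) (at y)" if "norm (y - z) < d" for y
      using that d1(2) by (intro grad_works diff) (auto simp: d_def dist_norm norm_minus_commute subset_iff)
    have h: "norm (grad \<phi> y - grad \<phi> z - ?H *v (y - z)) \<le> \<eta> * norm (y - z)" if "norm (y - z) < d" for y
      using that d2(2) by (simp add: d_def)
    have tn: "norm (t *\<^sub>R u) + norm (t *\<^sub>R v) = t * ?N" "norm (t *\<^sub>R v) + norm (t *\<^sub>R u) = t * ?N"
      using t by (auto simp: algebra_simps)
    have 1: "\<bar>\<phi> (z + t *\<^sub>R u + t *\<^sub>R v) - \<phi> (z + t *\<^sub>R u) - \<phi> (z + t *\<^sub>R v) + \<phi> z - (t *\<^sub>R u) \<bullet> (?H *v (t *\<^sub>R v))\<bar> \<le> 2 * \<eta> * (t * ?N)\<^sup>2"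
      using mixed_difference_le[OF g h, where u="t *\<^sub>R u" and v="t *\<^sub>R v"] t \<eta> unfolding tn by simp
    have 2: "\<bar>\<phi> (z + t *\<^sub>R v + t *\<^sub>R u) - \<phi> (z + t *\<^sub>R v) - \<phi> (z + t *\<^sub>R u) + \<phi> z - (t *\<^sub>R v) \<bullet> (?H *v (t *\<^sub>R u))\<bar> \<le> 2 * \<eta> * (t * ?N)\<^sup>2"
      using mixed_difference_le[OF g h, where u="t *\<^sub>R v" and v="t *\<^sub>R u"] t \<eta> unfolding tn by simp
    have comm: "z + t *\<^sub>R v + t *\<^sub>R u = z + t *\<^sub>R u + t *\<^sub>R v" by simp
    have s: "(t *\<^sub>R a) \<bullet> (?H *v (t *\<^sub>R b)) = t\<^sup>2 * (a \<bullet> (?H *v b))" for a b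
      by (simp add: matrix_vector_mult_scaleR power2_eq_square)
    have "\<bar>t\<^sup>2 * (u \<bullet> (?H *v v)) - t\<^sup>2 * (v \<bullet> (?H *v u))\<bar> \<le> 4 * \<eta> * (t * ?N)\<^sup>2"
      using 1 2 unfolding s comm by linarith
    also have "t\<^sup>2 * (u \<bullet> (?H *v v)) - t\<^sup>2 * (v \<bullet> (?H *v u)) = t\<^sup>2 * (u \<bullet> (?H *v v) - v \<bullet> (?H *v u))"
      by (simp add: algebra_simps)
    also have "\<bar>t\<^sup>2 * (u \<bullet> (?H *v v) - v \<bullet> (?H *v u))\<bar> = t\<^sup>2 * \<bar>u \<bullet> (?H *v v) - v \<bullet> (?H *v u)\<bar>"
      by (simp add: abs_mult)
    also have "4 * \<eta> * (t * ?N)\<^sup>2 = t\<^sup>2 * (4 * \<eta> * ?N\<^sup>2)" by (simp add: power_mult_distrib)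
    finally have "\<bar>u \<bullet> (?H *v v) - v \<bullet> (?H *v u)\<bar> \<le> 4 * \<eta> * ?N\<^sup>2"
      using t by (subst (asm) mult_le_cancel_left_pos) auto
    also have "\<dots> \<le> 4 * \<eta> * (?N + 1)\<^sup>2" using \<eta> by (intro mult_left_mono power_mono) auto
    also have "\<dots> = e" using N by (simp add: \<eta>_def)
    finally show ?thesis by simp
  qed
  then have "\<bar>u \<bullet> (?H *v v) - v \<bullet> (?H *v u)\<bar> \<le> 0" by (rule field_le_epsilon)
  then show ?thesis by simp
qed

text \<open>In the sum of the Taylor expansions at \<open>1\<close> and \<open>-1\<close> the
  first-order terms cancel. Only a bound on the Hessian along the segment enters, so the same
  estimate serves for strong concavity on a whole set and for the local expansion at one
  point.\<close>

lemma second_difference_le: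
  fixes \<phi> :: "real^'n \<Rightarrow> real"
  assumes S: "\<And>t. \<bar>t\<bar> \<le> 1 \<Longrightarrow> \<phi> differentiable (at (z + t *\<^sub>R u)) \<and> grad \<phi> differentiable (at (z + t *\<^sub>R u))"
    and \<kappa>: "\<And>t. \<bar>t\<bar> \<le> 1 \<Longrightarrow> u \<bullet> (hess \<phi> (z + t *\<^sub>R u) *v u) \<le> \<kappa>"
  shows "\<phi> (z + u) + \<phi> (z - u) - 2 * \<phi> z \<le> \<kappa>"
proof -
  let ?w = "\<lambda>t. z + t *\<^sub>R u"
  define D where "D m t = (if m = 0 then \<phi> (?w t) else if m = 1 then grad \<phi> (?w t) \<bullet> u else u \<bullet> (hess \<phi> (?w t) *v u))" for m :: nat and t :: real
  have d0: "((\<lambda>t. \<phi> (?w t)) has_real_derivative grad \<phi> (?w t) \<bullet> u) (at t)" if "\<bar>t\<bar> \<le> 1" for t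
  proof -
    have "((\<lambda>t. \<phi> (?w t)) has_derivative (\<lambda>h. grad \<phi> (?w t) \<bullet> (h *\<^sub>R u))) (at t)"
      by (rule has_derivative_compose[of ?w "\<lambda>h. h *\<^sub>R u"])
         (use S[OF that] grad_works in \<open>auto intro!: derivative_eq_intros\<close>)
    then show ?thesis unfolding has_field_derivative_def
      by (rule has_derivative_eq_rhs) (auto simp: fun_eq_iff)
  qed
  have d1: "((\<lambda>t. grad \<phi> (?w t) \<bullet> u) has_real_derivative u \<bullet> (hess \<phi> (?w t) *v u)) (at t)" if "\<bar>t\<bar> \<le> 1" for t
  proof -
    have "((\<lambda>t. grad \<phi> (?w t)) has_derivative (\<lambda>h. hess \<phi> (?w t) *v (h *\<^sub>R u))) (at t)"
      by (rule has_derivative_compose[of ?w "\<lambda>h. h *\<^sub>R u"])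
         (use S[OF that] hess_works in \<open>auto intro!: derivative_eq_intros\<close>)
    from has_derivative_inner_left[OF this, of u] show ?thesis unfolding has_field_derivative_def
      by (rule has_derivative_eq_rhs) (auto simp: fun_eq_iff matrix_vector_mult_scaleR inner_commute)
  qed
  have der: "\<forall>m t. m < 2 \<and> -1 \<le> t \<and> t \<le> 1 \<longrightarrow> DERIV (D m) t :> D (Suc m) t"
    using d0 d1 by (auto simp: D_def[abs_def] less_2_cases_iff)
  have T: "\<exists>t. \<bar>t\<bar> \<le> 1 \<and> \<phi> (?w x) = \<phi> z + (grad \<phi> z \<bullet> u) * x + (u \<bullet> (hess \<phi> (?w t) *v u)) / 2" if "x = 1 \<or> x = -1" for x
  proof -
    have "\<exists>t. (if x < 0 then x < t \<and> t < 0 else 0 < t \<and> t < x) \<and>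
      \<phi> (?w x) = (\<Sum>m<2. (D m 0 / fact m) * (x - 0)^m) + (D 2 t / fact 2) * (x - 0)^2"
      by (rule Taylor[of 2 D "\<lambda>t. \<phi> (?w t)" "-1" 1 0 x, OF _ _ der]) (use that in \<open>auto simp: D_def\<close>)
    then obtain t where t: "if x < 0 then x < t \<and> t < 0 else 0 < t \<and> t < x"
      "\<phi> (?w x) = (\<Sum>m<2. (D m 0 / fact m) * (x - 0)^m) + (D 2 t / fact 2) * (x - 0)^2" by blast
    have "\<bar>t\<bar> \<le> 1" using t(1) that by (auto split: if_splits)
    moreover have "\<phi> (?w x) = \<phi> z + (grad \<phi> z \<bullet> u) * x + (u \<bullet> (hess \<phi> (?w t) *v u)) / 2"
      using t(2) that by (auto simp: D_def eval_nat_numeral)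
    ultimately show ?thesis by blast
  qed
  obtain s t where "\<bar>s\<bar> \<le> 1" "\<phi> (?w 1) = \<phi> z + grad \<phi> z \<bullet> u * 1 + (u \<bullet> (hess \<phi> (?w s) *v u)) / 2"
    "\<bar>t\<bar> \<le> 1" "\<phi> (?w (-1)) = \<phi> z + grad \<phi> z \<bullet> u * (-1) + (u \<bullet> (hess \<phi> (?w t) *v u)) / 2"
    using T[of 1] T[of "-1"] by blast
  with \<kappa>[of s] \<kappa>[of t] show ?thesis by simp
qed

text \<open>Completing the square: the form of \<open>M\<close> is nonnegative at
  \<open>u - s w\<close> for \<open>w = matrix_inv M *v a\<close>. This is where the inverse Hessian
  enters, as the Legendre transform of the quadratic form.\<close>

lemma inverse_quadratic_form:
  fixes M :: "real^'n^'n" and a u :: "real^'n"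
  assumes sym: "\<And>u v. u \<bullet> (M *v v) = v \<bullet> (M *v u)" and pd: "\<And>v. v \<noteq> 0 \<Longrightarrow> v \<bullet> (M *v v) > 0"
  shows "2 * s * (a \<bullet> u) - u \<bullet> (M *v u) \<le> s\<^sup>2 * ((matrix_inv M *v a) \<bullet> a)"
    and "0 \<le> (matrix_inv M *v a) \<bullet> a"
proof -
  have "\<forall>x. M *v x = 0 \<longrightarrow> x = 0" using pd by (metis inner_zero_right less_irrefl)
  then have "invertible M" by (simp add: invertible_left_inverse matrix_left_invertible_ker)
  then have inv: "M ** matrix_inv M = mat 1"
    unfolding invertible_def matrix_inv_def by (rule someI2_ex) blast
  define w where "w = matrix_inv M *v a"
  have Mw: "M *v w = a" by (simp add: w_def matrix_vector_mul_assoc inv)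
  have nn: "v \<bullet> (M *v v) \<ge> 0" for v using pd[of v] by (cases "v = 0") auto
  have "0 \<le> (u - s *\<^sub>R w) \<bullet> (M *v (u - s *\<^sub>R w))" by (rule nn)
  also have "\<dots> = u \<bullet> (M *v u) - s * (u \<bullet> (M *v w)) - s * (w \<bullet> (M *v u)) + s\<^sup>2 * (w \<bullet> (M *v w))"
    by (simp add: inner_diff_left inner_diff_right matrix_vector_mult_diff_distrib matrix_vector_mult_scaleR power2_eq_square algebra_simps)
  also have "w \<bullet> (M *v u) = u \<bullet> (M *v w)" by (rule sym)
  finally show "2 * s * (a \<bullet> u) - u \<bullet> (M *v u) \<le> s\<^sup>2 * ((matrix_inv M *v a) \<bullet> a)"
    by (simp add: Mw w_def[symmetric] inner_commute)
  show "0 \<le> (matrix_inv M *v a) \<bullet> a" using nn[of w] by (simp add: Mw flip: w_def)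
qed

text \<open>The form attains a positive minimum over the compact product of \<open>K\<close> with
  the unit sphere; homogeneity does the rest.\<close>

lemma hess_uniformly_positive:
  fixes \<phi> :: "real^'n \<Rightarrow> real"
  assumes cont: "continuous_on \<Omega> (hess \<phi>)" and K: "compact K" "K \<subseteq> \<Omega>"
    and pd: "\<And>x v. x \<in> \<Omega> \<Longrightarrow> v \<noteq> 0 \<Longrightarrow> v \<bullet> ((- hess \<phi> x) *v v) > 0"
  shows "\<exists>c>0. \<forall>x\<in>K. \<forall>v. c * (norm v)\<^sup>2 \<le> v \<bullet> ((- hess \<phi> x) *v v)"
proof (cases "K = {}")
  case False
  let ?F = "\<lambda>p. snd p \<bullet> ((- hess \<phi> (fst p)) *v snd p)"
  have "\<exists>p\<in>K \<times> sphere 0 1. \<forall>q\<in>K \<times> sphere 0 1. ?F p \<le> ?F q"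
  proof (rule continuous_attains_inf)
    show "compact (K \<times> sphere (0::real^'n) 1)" using K by (intro compact_Times) auto
    show "K \<times> sphere (0::real^'n) 1 \<noteq> {}"
      using False vector_choose_size[of 1, where 'a="real^'n"] by (auto simp: sphere_eq_empty)
    show "continuous_on (K \<times> sphere 0 1) ?F"
      unfolding matrix_vector_mult_def inner_vec_def
      using K by (auto intro!: continuous_intros continuous_on_compose2[OF cont])
  qed
  then obtain x w where xw: "x \<in> K" "norm w = 1" "\<And>y v. y \<in> K \<Longrightarrow> norm v = 1 \<Longrightarrow> ?F (x, w) \<le> ?F (y, v)"
    by (auto simp: dist_norm)
  define c where "c = ?F (x, w)"
  have "c > 0" unfolding c_def using xw(1,2) K(2) pd[of x w] by force
  moreover have "c * (norm v)\<^sup>2 \<le> v \<bullet> ((- hess \<phi> y) *v v)" if "y \<in> K" for y v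
  proof (cases "v = 0")
    case False
    have "c \<le> ?F (y, (1 / norm v) *\<^sub>R v)" unfolding c_def using False that by (intro xw) auto
    also have "\<dots> = (v \<bullet> ((- hess \<phi> y) *v v)) / (norm v)\<^sup>2"
      by (simp add: matrix_vector_mult_scaleR power2_eq_square)
    finally show ?thesis using False by (simp add: field_simps)
  qed simp
  ultimately show ?thesis by blast
qed (auto intro: exI[of _ 1])

text \<open>Continuity of the entries controls the operator norm of the difference, hence the
  quadratic form for all \<open>u\<close> at once.\<close>

lemma hess_quadratic_continuous:
  fixes \<phi> :: "real^'n \<Rightarrow> real"
  assumes cont: "continuous_on \<Omega> (hess \<phi>)" "open \<Omega>" "z \<in> \<Omega>" and e: "e > 0"
  shows "\<exists>d>0. \<forall>y. norm (y - z) < d \<longrightarrow> y \<in> \<Omega> \<and> (\<forall>u. u \<bullet> (hess \<phi> y *v u) \<le> u \<bullet> (hess \<phi> z *v u) + e * (norm u)\<^sup>2)"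
proof -
  let ?s = "\<lambda>y. \<Sum>i\<in>UNIV. \<Sum>j\<in>UNIV. \<bar>(hess \<phi> y - hess \<phi> z) $ i $ j\<bar>"
  have lim: "(hess \<phi> \<longlongrightarrow> hess \<phi> z) (at z)"
    using cont by (simp add: continuous_on_eq_continuous_at isCont_def)
  have "(?s \<longlongrightarrow> (\<Sum>i\<in>(UNIV::'n set). \<Sum>j\<in>(UNIV::'n set). \<bar>(hess \<phi> z - hess \<phi> z) $ i $ j\<bar>)) (at z)"
    by (intro tendsto_intros lim)
  then have "(?s \<longlongrightarrow> 0) (at z)" by simp
  then have "eventually (\<lambda>y. ?s y < e) (at z)" using e by (rule order_tendstoD)
  then obtain d1 where d1: "d1 > 0" "\<And>y. y \<noteq> z \<Longrightarrow> norm (y - z) < d1 \<Longrightarrow> ?s y < e"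
    by (auto simp: eventually_at dist_norm)
  obtain d2 where d2: "d2 > 0" "ball z d2 \<subseteq> \<Omega>" using cont by (meson open_contains_ball)
  have "u \<bullet> (hess \<phi> y *v u) \<le> u \<bullet> (hess \<phi> z *v u) + e * (norm u)\<^sup>2" if y: "norm (y - z) < d1" for y u
  proof (cases "y = z")
    case True then show ?thesis using e by simp
  next
    case False
    let ?D = "hess \<phi> y - hess \<phi> z"
    have "u \<bullet> (hess \<phi> y *v u) - u \<bullet> (hess \<phi> z *v u) = u \<bullet> (?D *v u)"
      by (simp add: matrix_vector_mult_diff_rdistrib inner_diff_right)
    also have "\<dots> \<le> norm u * norm (?D *v u)" by (rule norm_cauchy_schwarz)
    also have "norm (?D *v u) \<le> onorm ((*v) ?D) * norm u" by (rule onorm) simp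
    also have "onorm ((*v) ?D) \<le> e"
      using onorm_le_matrix_component_sum[of ?D] d1(2)[OF False y] by linarith
    finally have "u \<bullet> (hess \<phi> y *v u) - u \<bullet> (hess \<phi> z *v u) \<le> norm u * (e * norm u)"
      by (simp add: mult_left_mono mult_right_mono)
    then show ?thesis by (simp add: power2_eq_square mult_ac)
  qed
  then show ?thesis using d1(1) d2 by (intro exI[of _ "min d1 d2"]) (auto simp: subset_iff dist_norm norm_minus_commute)
qed

section \<open>Perturbations of a uniformly concave function\<close>

locale midpoint_concave =
  fixes \<phi> g :: "'a::euclidean_space \<Rightarrow> real" and U :: "'a set" and c L :: real
  assumes U: "open U" "convex U" and c: "c > 0"
    and cont: "continuous_on U \<phi>"
    and conc: "\<And>z u. z + u \<in> U \<Longrightarrow> z - u \<in> U \<Longrightarrow> \<phi> (z + u) + \<phi> (z - u) - 2 * \<phi> z \<le> - c * (norm u)\<^sup>2"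
    and lip: "L-lipschitz_on U g"
begin

text \<open>For \<open>x = z + u\<close> and \<open>y = z - u\<close>, twice the excess of the
  average of \<open>\<phi> x + s * g x\<close> and \<open>\<phi> y - s * g y\<close> over
  \<open>\<phi> z\<close>.\<close>

definition gain :: "real \<Rightarrow> 'a \<Rightarrow> 'a \<Rightarrow> real" where
  "gain s z u = \<phi> (z + u) + \<phi> (z - u) - 2 * \<phi> z + s * (g (z + u) - g (z - u))"

text \<open>\<open>\<phi> + s\<^sup>2 gain_rate s\<close> is the supremal midpoint convolution of \<open>\<phi> + s g\<close> and \<open>\<phi> - s g\<close> on \<open>U\<close>.\<close>

definition gain_rate :: "real \<Rightarrow> 'a \<Rightarrow> real" where
  "gain_rate s z = (SUP u\<in>{u. z + u \<in> U \<and> z - u \<in> U}. gain s z u) / (2 * s\<^sup>2)"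

lemma mid_in: "z + u \<in> U \<Longrightarrow> z - u \<in> U \<Longrightarrow> z \<in> U"
proof -
  assume "z + u \<in> U" "z - u \<in> U"
  then have "(1/2) *\<^sub>R (z + u) + (1/2) *\<^sub>R (z - u) \<in> U" using U(2) by (intro convexD) auto
  also have "(1/2) *\<^sub>R (z + u) + (1/2) *\<^sub>R (z - u) = z"
    by (simp add: scaleR_right_distrib scaleR_diff_right scaleR_left_distrib[symmetric])
  finally show "z \<in> U" .
qed

lemma L0: "L \<ge> 0" using lip by (rule lipschitz_on_nonneg)

lemma cont_g: "continuous_on U g" using lip by (rule lipschitz_on_continuous_on)

lemma gain_le:
  assumes s: "s > 0" and u: "z + u \<in> U" "z - u \<in> U"
  shows "gain s z u \<le> 2 * s * L * norm u - c * (norm u)\<^sup>2"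
proof -
  have "g (z + u) - g (z - u) \<le> L * dist (z + u) (z - u)"
    using lipschitz_onD[OF lip u] by (simp add: dist_real_def abs_le_iff)
  also have "dist (z + u) (z - u) = 2 * norm u"
    by (simp add: dist_norm scaleR_2[symmetric])
  finally have "s * (g (z + u) - g (z - u)) \<le> s * (L * (2 * norm u))" using s by (intro mult_left_mono) auto
  then show ?thesis unfolding gain_def using conc[OF u] by simp
qed

text \<open>The bound \<open>2 s L t - c t^2\<close> is largest at \<open>t = s L / c\<close>. That
  maximum is of order \<open>s^2\<close>, so \<open>gain_rate\<close> is bounded uniformly in
  \<open>s\<close>, which supplies the majorant for reverse Fatou.\<close>

lemma gain_le_const:
  assumes s: "s > 0" and u: "z + u \<in> U" "z - u \<in> U"
  shows "gain s z u \<le> s\<^sup>2 * (L\<^sup>2 / c)"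
proof -
  have "0 \<le> (c * norm u - s * L)\<^sup>2" by simp
  also have "\<dots> = c * (c * (norm u)\<^sup>2 - 2 * s * L * norm u) + s\<^sup>2 * L\<^sup>2"
    by (simp add: power2_eq_square algebra_simps)
  finally have "c * (2 * s * L * norm u - c * (norm u)\<^sup>2) \<le> s\<^sup>2 * L\<^sup>2" by (simp add: algebra_simps)
  then have "2 * s * L * norm u - c * (norm u)\<^sup>2 \<le> s\<^sup>2 * L\<^sup>2 / c" using c by (simp add: field_simps)
  with gain_le[OF assms] show ?thesis by simp
qed

lemma bdd_gain: "s > 0 \<Longrightarrow> bdd_above (gain s z ` {u. z + u \<in> U \<and> z - u \<in> U})"
  using gain_le_const by (intro bdd_aboveI2[where M="s\<^sup>2 * (L\<^sup>2 / c)"]) auto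

lemma gain_rate_bounds:
  assumes s: "s > 0" and z: "z \<in> U"
  shows "0 \<le> gain_rate s z" "gain_rate s z \<le> L\<^sup>2 / (2 * c)"
proof -
  have "gain s z 0 \<le> (SUP u\<in>{u. z + u \<in> U \<and> z - u \<in> U}. gain s z u)"
    using z by (intro cSUP_upper bdd_gain s) auto
  moreover have "gain s z 0 = 0" by (simp add: gain_def)
  ultimately show "0 \<le> gain_rate s z" unfolding gain_rate_def by simp
  have "(SUP u\<in>{u. z + u \<in> U \<and> z - u \<in> U}. gain s z u) \<le> s\<^sup>2 * (L\<^sup>2 / c)"
  proof (rule cSUP_least)
    show "{u. z + u \<in> U \<and> z - u \<in> U} \<noteq> {}" using z by (auto intro!: exI[of _ 0])
  qed (use gain_le_const[OF s] in auto)
  then show "gain_rate s z \<le> L\<^sup>2 / (2 * c)" unfolding gain_rate_def using s by (simp add: field_simps)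
qed

lemma gain_le_gain_rate:
  assumes s: "s > 0" and u: "z + u \<in> U" "z - u \<in> U"
  shows "gain s z u \<le> 2 * s\<^sup>2 * gain_rate s z"
proof -
  have "gain s z u \<le> (SUP u\<in>{u. z + u \<in> U \<and> z - u \<in> U}. gain s z u)"
    using u by (intro cSUP_upper bdd_gain s) auto
  then show ?thesis using s by (simp add: gain_rate_def)
qed

text \<open>The supremum expressed through the endpoints, the form in which the midpoint hypothesis
  of Prekopa-Leindler is checked.\<close>

lemma gain_rate_midpoint:
  assumes s: "s > 0" and xy: "x \<in> U" "y \<in> U"
  shows "(\<phi> x + s * g x) + (\<phi> y - s * g y) \<le> 2 * (\<phi> ((1/2) *\<^sub>R (x + y)) + s\<^sup>2 * gain_rate s ((1/2) *\<^sub>R (x + y)))"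
proof -
  define z u where "z = (1/2) *\<^sub>R (x + y)" and "u = (1/2) *\<^sub>R (x - y)"
  have zu: "z + u = x" "z - u = y"
    by (simp_all add: z_def u_def scaleR_right_distrib scaleR_diff_right scaleR_left_distrib[symmetric])
  have "gain s z u \<le> 2 * s\<^sup>2 * gain_rate s z" using xy by (intro gain_le_gain_rate s) (auto simp: zu)
  then have "\<phi> x + \<phi> y - 2 * \<phi> z + s * (g x - g y) \<le> 2 * s\<^sup>2 * gain_rate s z" by (simp only: gain_def zu)
  then show ?thesis unfolding z_def[symmetric] by (simp add: algebra_simps)
qed

lemma gain_rate_le_iff:
  assumes s: "s > 0" and z: "z \<in> U"
  shows "gain_rate s z \<le> b \<longleftrightarrow> (\<forall>u. z + u \<in> U \<and> z - u \<in> U \<longrightarrow> gain s z u \<le> 2 * s\<^sup>2 * b)"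
proof
  assume "gain_rate s z \<le> b"
  then have "2 * s\<^sup>2 * gain_rate s z \<le> 2 * s\<^sup>2 * b" using s by simp
  then show "\<forall>u. z + u \<in> U \<and> z - u \<in> U \<longrightarrow> gain s z u \<le> 2 * s\<^sup>2 * b" using gain_le_gain_rate[OF s] by force
next
  assume *: "\<forall>u. z + u \<in> U \<and> z - u \<in> U \<longrightarrow> gain s z u \<le> 2 * s\<^sup>2 * b"
  have "(SUP u\<in>{u. z + u \<in> U \<and> z - u \<in> U}. gain s z u) \<le> 2 * s\<^sup>2 * b"
  proof (rule cSUP_least)
    show "{u. z + u \<in> U \<and> z - u \<in> U} \<noteq> {}" using z by (auto intro!: exI[of _ 0])
  qed (use * in auto)
  then show "gain_rate s z \<le> b" unfolding gain_rate_def using s by (simp add: field_simps)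
qed

text \<open>The supremum runs over uncountably many \<open>u\<close>, but it is lower
  semicontinuous: its superlevel sets are unions over \<open>u\<close> of open sets.\<close>

lemma gain_rate_measurable:
  assumes s: "s > 0"
  shows "gain_rate s \<in> borel_measurable (restrict_space lborel U)"
proof (rule borel_measurableI_greater)
  fix b
  let ?S = "\<lambda>u. {z. z + u \<in> U \<and> z - u \<in> U}"
  have op: "open {z \<in> ?S u. 2 * s\<^sup>2 * b < gain s z u}" for u
  proof -
    have "open (((\<lambda>z. z + u) -` U) \<inter> ((\<lambda>z. z - u) -` U))"
      using U(1) by (intro open_Int open_vimage continuous_intros)
    moreover have "((\<lambda>z. z + u) -` U) \<inter> ((\<lambda>z. z - u) -` U) = ?S u" by auto
    ultimately have "open (?S u)" by simp
    have "continuous_on (?S u) (\<lambda>z. gain s z u)"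
      unfolding gain_def
      by (intro continuous_intros continuous_on_compose2[OF cont] continuous_on_compose2[OF cont_g]) (auto intro: mid_in)
    then show ?thesis
      using continuous_on_open_vimage[OF \<open>open (?S u)\<close>, of "\<lambda>z. gain s z u"] open_greaterThan[of "2 * s\<^sup>2 * b"]
      by (auto simp: vimage_def Int_def conj_commute elim!: allE[of _ "{2 * s\<^sup>2 * b<..}"])
  qed
  have "{z \<in> space (restrict_space lborel U). b < gain_rate s z} = (\<Union>u. {z \<in> ?S u. 2 * s\<^sup>2 * b < gain s z u})"
    using gain_rate_le_iff[OF s] mid_in by (force simp: space_restrict_space not_le[symmetric])
  moreover have "open (\<Union>u. {z \<in> ?S u. 2 * s\<^sup>2 * b < gain s z u})" using op by auto
  moreover have "(\<Union>u. {z \<in> ?S u. 2 * s\<^sup>2 * b < gain s z u}) \<subseteq> U" using mid_in by auto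
  ultimately show "{z \<in> space (restrict_space lborel U). b < gain_rate s z} \<in> sets (restrict_space lborel U)"
    using U(1) by (auto simp: sets_restrict_space_iff)
qed

text \<open>Displacements longer than \<open>C * s\<close> have nonpositive gain by strong
  concavity. For the others both expansions have errors of order \<open>\<eta> * s^2\<close>, and
  the leading part \<open>2 * s * (a \<bullet> u) - q u\<close> is at most
  \<open>s^2 * Q\<close>.\<close>

lemma gain_rate_asymptotic:
  assumes z: "z \<in> U" and g: "(g has_derivative (\<lambda>h. a \<bullet> h)) (at z)"
    and \<phi>: "\<And>e. e > 0 \<Longrightarrow> \<exists>d>0. \<forall>u. norm u < d \<longrightarrow> \<phi> (z + u) + \<phi> (z - u) - 2 * \<phi> z \<le> - q u + e * (norm u)\<^sup>2"
    and Q: "Q \<ge> 0" "\<And>s u. 2 * s * (a \<bullet> u) - q u \<le> s\<^sup>2 * Q"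
    and e: "e > 0"
  shows "\<exists>s0>0. \<forall>s. 0 < s \<and> s < s0 \<longrightarrow> gain_rate s z \<le> Q / 2 + e"
proof -
  \<comment> \<open>\<open>C * s\<close> is the length at which the concave loss
    \<open>c * (norm u)^2\<close> catches up with the Lipschitz gain
    \<open>2 * s * L * norm u\<close>.\<close>
  define C where "C = 2 * L / c"
  have C: "C \<ge> 0" using L0 c by (simp add: C_def)
  \<comment> \<open>The total error is \<open>s^2 * \<eta> * (C^2 + 2 * C)\<close>, to be kept below
    \<open>2 * s^2 * e\<close>; the \<open>+ 1\<close> covers \<open>C = 0\<close>.\<close>
  define \<eta> where "\<eta> = 2 * e / (C\<^sup>2 + 2 * C + 1)"
  have pos: "C\<^sup>2 + 2 * C + 1 > 0" using C by (simp add: add_nonneg_pos)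
  have \<eta>: "\<eta> > 0" using e pos by (simp add: \<eta>_def)
  obtain d1 where d1: "d1 > 0" "\<And>u. norm u < d1 \<Longrightarrow> \<phi> (z + u) + \<phi> (z - u) - 2 * \<phi> z \<le> - q u + \<eta> * (norm u)\<^sup>2"
    using \<phi>[OF \<eta>] by auto
  obtain d2 where d2: "d2 > 0" "\<And>y. norm (y - z) < d2 \<Longrightarrow> norm (g y - g z - a \<bullet> (y - z)) \<le> \<eta> * norm (y - z)"
    using g \<eta> unfolding has_derivative_at_alt by blast
  define s0 where "s0 = min d1 d2 / (C + 1)"
  have s0: "s0 > 0" using d1 d2 C by (simp add: s0_def)
  have "gain_rate s z \<le> Q / 2 + e" if s: "0 < s" "s < s0" for s
    unfolding gain_rate_le_iff[OF s(1) z]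
  proof (intro allI impI, elim conjE)
    fix u assume u: "z + u \<in> U" "z - u \<in> U"
    show "gain s z u \<le> 2 * s\<^sup>2 * (Q / 2 + e)"
    proof (cases "norm u \<le> C * s")
      case False
      then have "2 * s * L \<le> c * norm u" using c by (simp add: C_def field_simps)
      then have "(2 * s * L) * norm u \<le> (c * norm u) * norm u" by (intro mult_right_mono) auto
      then have "gain s z u \<le> 0" using gain_le[OF s(1) u] by (simp add: power2_eq_square)
      also have "0 \<le> 2 * s\<^sup>2 * (Q / 2 + e)" using Q(1) e by simp
      finally show ?thesis .
    next
      case True
      have "C * s \<le> (C + 1) * s" using s by simp
      also have "\<dots> < min d1 d2" using s C by (simp add: s0_def pos_less_divide_eq mult.commute)
      finally have nu: "norm u < d1" "norm u < d2" using True by auto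
      have 1: "g (z + u) - g z - a \<bullet> u \<le> \<eta> * norm u" using d2(2)[of "z + u"] nu by (simp add: abs_le_iff)
      have 2: "- (g (z - u) - g z + a \<bullet> u) \<le> \<eta> * norm u" using d2(2)[of "z - u"] nu by (simp add: abs_le_iff)
      have "s * (g (z + u) - g (z - u)) \<le> s * (2 * (a \<bullet> u) + 2 * \<eta> * norm u)"
        using 1 2 s by (intro mult_left_mono) auto
      then have "gain s z u \<le> - q u + \<eta> * (norm u)\<^sup>2 + s * (2 * (a \<bullet> u) + 2 * \<eta> * norm u)"
        using d1(2)[OF nu(1)] by (simp add: gain_def)
      also have "\<dots> = (2 * s * (a \<bullet> u) - q u) + \<eta> * ((norm u)\<^sup>2 + 2 * s * norm u)"
        by (simp add: algebra_simps)
      also have "\<dots> \<le> s\<^sup>2 * Q + \<eta> * ((C * s)\<^sup>2 + 2 * s * (C * s))"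
        using Q(2) True s \<eta> by (intro add_mono mult_left_mono power_mono) auto
      also have "\<eta> * ((C * s)\<^sup>2 + 2 * s * (C * s)) = s\<^sup>2 * (\<eta> * (C\<^sup>2 + 2 * C))"
        by (simp add: power2_eq_square algebra_simps)
      also have "\<eta> * (C\<^sup>2 + 2 * C) \<le> \<eta> * (C\<^sup>2 + 2 * C + 1)" using \<eta> by (intro mult_left_mono) auto
      also have "\<eta> * (C\<^sup>2 + 2 * C + 1) = 2 * e" using pos unfolding \<eta>_def by (metis less_irrefl nonzero_eq_divide_eq)
      finally have "gain s z u \<le> s\<^sup>2 * Q + s\<^sup>2 * (2 * e)" by (simp add: mult_left_mono)
      then show ?thesis by (simp add: algebra_simps)
    qed
  qed
  then show ?thesis using s0 by blast
qed

text \<open>The integral inequality that \<open>second_variation\<close> asks for is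
  Prekopa-Leindler for the \<open>(p+1)\<close>-st powers cut off outside \<open>U\<close>;
  convexity keeps midpoints of \<open>U\<close> inside \<open>U\<close>.\<close>

lemma variance_inequality:
  assumes ne: "U \<noteq> {}" and bU: "bounded U" and \<delta>: "\<delta> > 0" and p: "p > 0"
    and \<phi>: "\<And>x. x \<in> U \<Longrightarrow> \<delta> \<le> \<phi> x \<and> \<phi> x \<le> K"
    and gG: "\<And>x. x \<in> U \<Longrightarrow> \<bar>g x\<bar> \<le> G"
    and zero: "(\<integral>x. g x * \<phi> x powr p \<partial>restrict_space lborel U) = 0"
    and Q: "AE x in lborel. x \<in> U \<longrightarrow> (\<forall>e>0. \<exists>s0>0. \<forall>s. 0 < s \<and> s < s0 \<longrightarrow> gain_rate s x \<le> Q x / 2 + e)"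
  shows "ennreal (p * (\<integral>x. (g x)\<^sup>2 * \<phi> x powr (p-1) \<partial>restrict_space lborel U))
    \<le> (\<integral>\<^sup>+x. ennreal (Q x * \<phi> x powr p) \<partial>restrict_space lborel U)"
proof (rule second_variation[where s="\<lambda>n. 1 / real (Suc n)" and k="\<lambda>n. gain_rate (1 / real (Suc n))"])
  let ?M = "restrict_space lborel U"
  have U': "U \<in> sets lborel" using U(1) by simp
  have eU: "emeasure ?M (space ?M) = emeasure lborel U"
    using U' by (simp add: emeasure_restrict_space space_restrict_space)
  have "emeasure lborel U < \<infinity>" by (rule emeasure_bounded_finite[OF bU])
  then show fin: "finite_measure ?M" using eU by (intro finite_measureI) auto
  show "emeasure ?M (space ?M) > 0"
    using emeasure_lborel_open_pos[OF U(1) ne] eU by simp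
  show m\<phi>[measurable]: "\<phi> \<in> borel_measurable ?M" by (rule borel_measurable_continuous_on_restrict_lborel[OF cont])
  show mg[measurable]: "g \<in> borel_measurable ?M" by (rule borel_measurable_continuous_on_restrict_lborel[OF cont_g])
  show mk: "gain_rate (1 / real (Suc n)) \<in> borel_measurable ?M" for n by (rule gain_rate_measurable) simp
  show "(\<lambda>n. 1 / real (Suc n)) \<longlonglongrightarrow> 0" using LIMSEQ_inverse_real_of_nat by (simp add: inverse_eq_divide)
  show "0 \<le> gain_rate (1 / real (Suc n)) x \<and> gain_rate (1 / real (Suc n)) x \<le> L\<^sup>2 / (2 * c)" if "x \<in> space ?M" for n x
    using that gain_rate_bounds by (simp add: space_restrict_space)
  show "AE x in ?M. \<forall>e>0. eventually (\<lambda>n. gain_rate (1 / real (Suc n)) x \<le> Q x / 2 + e) sequentially"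
  proof (subst AE_restrict_space_iff)
    show "AE x in lborel. x \<in> U \<longrightarrow> (\<forall>e>0. eventually (\<lambda>n. gain_rate (1 / real (Suc n)) x \<le> Q x / 2 + e) sequentially)"
      using Q
    proof eventually_elim
      case (elim x)
      show ?case
      proof (intro impI allI)
        fix e :: real assume "x \<in> U" "e > 0"
        then obtain s0 where s0: "s0 > 0" "\<And>s. 0 < s \<Longrightarrow> s < s0 \<Longrightarrow> gain_rate s x \<le> Q x / 2 + e" using elim by blast
        have "eventually (\<lambda>n. 1 / real (Suc n) < s0) sequentially"
          using order_tendstoD(2)[OF LIMSEQ_inverse_real_of_nat s0(1)] by (simp add: inverse_eq_divide)
        then show "eventually (\<lambda>n. gain_rate (1 / real (Suc n)) x \<le> Q x / 2 + e) sequentially"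
          by eventually_elim (use s0 in auto)
      qed
    qed
  qed (use U' in simp)
  show "(\<integral>x. (\<phi> x + 1 / real (Suc n) * g x) powr (p+1) \<partial>?M) * (\<integral>x. (\<phi> x - 1 / real (Suc n) * g x) powr (p+1) \<partial>?M)
         \<le> (\<integral>x. (\<phi> x + (1 / real (Suc n))\<^sup>2 * gain_rate (1 / real (Suc n)) x) powr (p+1) \<partial>?M)\<^sup>2"
    if small: "1 / real (Suc n) * G \<le> \<delta> / 2" for n
  proof -
    define s where "s = 1 / real (Suc n)"
    let ?W = "\<lambda>f x. ennreal (f x powr (p+1)) * indicator U x"
    let ?f1 = "\<lambda>x. \<phi> x + s * g x" and ?f2 = "\<lambda>x. \<phi> x - s * g x" and ?f3 = "\<lambda>x. \<phi> x + s\<^sup>2 * gain_rate s x"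
    have s: "s > 0" by (simp add: s_def)
    have [measurable]: "gain_rate s \<in> borel_measurable ?M" by (rule gain_rate_measurable[OF s])
    have sg: "\<bar>s * g x\<bar> \<le> \<delta>/2" if "x \<in> U" for x
    proof -
      have "\<bar>s * g x\<bar> = s * \<bar>g x\<bar>" using s by (simp add: abs_mult)
      also have "\<dots> \<le> s * G" using s gG[OF that] by (intro mult_left_mono) auto
      finally show ?thesis using small unfolding s_def by linarith
    qed
    have int: "ennreal (\<integral>x. f x powr (p+1) \<partial>?M) = (\<integral>\<^sup>+x. ?W f x \<partial>lborel)
         \<and> ?W f \<in> borel_measurable borel"
      if [measurable]: "f \<in> borel_measurable ?M" and f: "\<And>x. x \<in> U \<Longrightarrow> 0 \<le> f x \<and> f x \<le> B" for f :: "'a \<Rightarrow> real" and B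
    proof -
      have "integrable ?M (\<lambda>x. f x powr (p+1))"
      proof (rule integrable_bounded_measurable[OF fin])
        fix x assume "x \<in> space ?M"
        then show "\<bar>f x powr (p+1)\<bar> \<le> B powr (p+1)" using f p by (auto simp: space_restrict_space intro!: powr_mono2)
      qed measurable
      then have "ennreal (\<integral>x. f x powr (p+1) \<partial>?M) = (\<integral>\<^sup>+x. ennreal (f x powr (p+1)) \<partial>?M)"
        by (subst nn_integral_eq_integral) auto
      also have "\<dots> = (\<integral>\<^sup>+x. ?W f x \<partial>lborel)"
        using U' by (subst nn_integral_restrict_space) auto
      finally have 1: "ennreal (\<integral>x. f x powr (p+1) \<partial>?M) = (\<integral>\<^sup>+x. ?W f x \<partial>lborel)" .
      have "(\<lambda>x. ennreal (f x powr (p+1))) \<in> borel_measurable ?M" by measurable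
      then have "?W f \<in> borel_measurable lborel"
        using U' by (subst (asm) borel_measurable_restrict_space_iff_ennreal) auto
      with 1 show ?thesis by simp
    qed
    have f1: "0 \<le> ?f1 x \<and> ?f1 x \<le> K + \<delta>/2" if "x \<in> U" for x
      using sg[OF that] \<phi>[OF that] \<delta> by (auto simp: abs_le_iff)
    have f2: "0 \<le> ?f2 x \<and> ?f2 x \<le> K + \<delta>/2" if "x \<in> U" for x
      using sg[OF that] \<phi>[OF that] \<delta> by (auto simp: abs_le_iff)
    have f3: "0 \<le> ?f3 x \<and> ?f3 x \<le> K + s\<^sup>2 * (L\<^sup>2 / (2*c))" if "x \<in> U" for x
    proof -
      have "s\<^sup>2 * gain_rate s x \<le> s\<^sup>2 * (L\<^sup>2 / (2*c))" using gain_rate_bounds[OF s that] by (intro mult_left_mono) auto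
      moreover have "0 \<le> s\<^sup>2 * gain_rate s x" using gain_rate_bounds[OF s that] by simp
      ultimately show ?thesis using \<phi>[OF that] \<delta> by linarith
    qed
    have i1: "ennreal (\<integral>x. ?f1 x powr (p+1) \<partial>?M) = (\<integral>\<^sup>+x. ?W ?f1 x \<partial>lborel)
         \<and> ?W ?f1 \<in> borel_measurable borel"
      by (rule int[OF _ f1]) measurable
    have i2: "ennreal (\<integral>x. ?f2 x powr (p+1) \<partial>?M) = (\<integral>\<^sup>+x. ?W ?f2 x \<partial>lborel)
         \<and> ?W ?f2 \<in> borel_measurable borel"
      by (rule int[OF _ f2]) measurable
    have i3: "ennreal (\<integral>x. ?f3 x powr (p+1) \<partial>?M) = (\<integral>\<^sup>+x. ?W ?f3 x \<partial>lborel)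
         \<and> ?W ?f3 \<in> borel_measurable borel"
      by (rule int[OF _ f3]) measurable
    have "(\<integral>\<^sup>+x. ?W ?f1 x \<partial>lborel) * (\<integral>\<^sup>+x. ?W ?f2 x \<partial>lborel)
       \<le> (\<integral>\<^sup>+x. ?W ?f3 x \<partial>lborel)\<^sup>2"
    proof (rule prekopa_leindler)
      fix x y
      show "?W ?f1 x * ?W ?f2 y \<le> (?W ?f3 ((1/2) *\<^sub>R (x + y)))\<^sup>2"
      proof (cases "x \<in> U \<and> y \<in> U")
        case True
        define z where "z = (1/2) *\<^sub>R (x + y)"
        have z: "z \<in> U" unfolding z_def using True convexD[OF U(2), of x y "1/2" "1/2"] by (simp add: scaleR_right_distrib)
        define A where "A = \<phi> x + s * g x"
        define B where "B = \<phi> y - s * g y"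
        define D where "D = \<phi> z + s\<^sup>2 * gain_rate s z"
        have nn: "A \<ge> 0" "B \<ge> 0" "D \<ge> 0" using f1 f2 f3 True z by (auto simp: A_def B_def D_def)
        have "A + B \<le> 2 * D" using gain_rate_midpoint[OF s] True by (simp add: A_def B_def D_def z_def)
        \<comment> \<open>The convolution controls an arithmetic mean, whereas Prekopa-Leindler asks
          for the geometric one.\<close>
        have "4 * (A * B) \<le> (A + B)\<^sup>2" using zero_le_power2[of "A - B"] by (simp add: power2_eq_square algebra_simps)
        also have "\<dots> \<le> (2 * D)\<^sup>2" using \<open>A + B \<le> 2 * D\<close> nn by (intro power_mono) auto
        finally have "A * B \<le> D * D" by (simp add: power2_eq_square)
        then have "(A * B) powr (p+1) \<le> (D * D) powr (p+1)" using nn p by (intro powr_mono2) auto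
        then have "A powr (p+1) * B powr (p+1) \<le> (D powr (p+1))\<^sup>2" using nn by (simp add: powr_mult power2_eq_square)
        then have "ennreal (A powr (p+1) * B powr (p+1)) \<le> ennreal ((D powr (p+1))\<^sup>2)" by (rule ennreal_leI)
        then show ?thesis using True z
          by (simp add: A_def B_def D_def z_def ennreal_mult ennreal_power)
      qed auto
    qed (use i1 i2 i3 in auto)
    then have "ennreal (\<integral>x. ?f1 x powr (p+1) \<partial>?M) * ennreal (\<integral>x. ?f2 x powr (p+1) \<partial>?M)
       \<le> (ennreal (\<integral>x. ?f3 x powr (p+1) \<partial>?M))\<^sup>2"
      using i1 i2 i3 by simp
    then show ?thesis
      unfolding s_def[symmetric]
      by (subst (asm) ennreal_mult[symmetric], simp, simp) (simp add: ennreal_power)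
  qed
qed (use \<delta> p \<phi> gG zero in \<open>auto simp: space_restrict_space\<close>)

end

section \<open>The weighted Poincare inequality\<close>

lemma locally_lipschitz_compact:
  fixes f :: "real^'n \<Rightarrow> real"
  assumes f: "locally_lipschitz_on \<Omega> f" and \<Omega>: "open \<Omega>" and K: "compact K" "K \<subseteq> \<Omega>"
  shows "\<exists>L. L-lipschitz_on K f"
proof -
  \<comment> \<open>A one-point time set turns \<open>f\<close> into a time-dependent family, to
    which the compactness theorem for \<open>local_lipschitz\<close> applies.\<close>
  have "local_lipschitz {0::real} \<Omega> (\<lambda>_. f)"
    unfolding local_lipschitz_def
  proof (intro ballI)
    fix x and t :: real assume x: "x \<in> \<Omega>"
    then obtain r L where r: "r > 0" "L-lipschitz_on (ball x r \<inter> \<Omega>) f"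
      using f unfolding locally_lipschitz_on_def by blast
    then show "\<exists>u>0. \<exists>L. \<forall>t\<in>cball t u \<inter> {0}. L-lipschitz_on (cball x u \<inter> \<Omega>) f"
      by (intro exI[of _ "r/2"]) (auto intro!: exI[of _ L] intro: lipschitz_on_subset)
  qed
  then have "local_lipschitz {0::real} K (\<lambda>_. f)" using K(2) by (rule local_lipschitz_subset[OF _ order_refl])
  from local_lipschitz_compact_implies_lipschitz[OF this K(1), of] show ?thesis by auto
qed

lemma locally_lipschitz_continuous_on:
  fixes f :: "real^'n \<Rightarrow> real"
  assumes f: "locally_lipschitz_on \<Omega> f" and \<Omega>: "open \<Omega>"
  shows "continuous_on \<Omega> f"
proof (rule continuous_at_imp_continuous_on, intro ballI)
  fix x assume x: "x \<in> \<Omega>"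
  then obtain r L where r: "r > 0" "L-lipschitz_on (ball x r \<inter> \<Omega>) f"
    using f unfolding locally_lipschitz_on_def by blast
  have "continuous_on (ball x r \<inter> \<Omega>) f" using r(2) by (rule lipschitz_on_continuous_on)
  moreover have "open (ball x r \<inter> \<Omega>)" "x \<in> ball x r \<inter> \<Omega>" using \<Omega> x r by auto
  ultimately show "isCont f x" by (simp add: continuous_on_eq_continuous_at)
qed

lemma matrix_vector_mult_neg: "(- A) *v x = - (A *v x)" for A :: "real^'n^'m"
  by (simp add: vec_eq_iff matrix_vector_mult_def sum_negf)

text \<open>The Brascamp-Lieb energy density: the squared length of the gradient in the inverse of
  the metric \<open>- hess \<phi> x\<close>.\<close>

definition dual_form :: "(real^'n \<Rightarrow> real) \<Rightarrow> (real^'n \<Rightarrow> real) \<Rightarrow> real^'n \<Rightarrow> real" where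
  "dual_form \<phi> f x = (matrix_inv (- hess \<phi> x) *v grad f x) \<bullet> grad f x"

locale concave_potential =
  fixes \<Omega> :: "(real^'n) set" and \<phi> :: "real^'n \<Rightarrow> real"
  assumes open_\<Omega>: "open \<Omega>" and convex_\<Omega>: "convex \<Omega>" and bounded_\<Omega>: "bounded \<Omega>"
    and pos: "\<And>x. x \<in> \<Omega> \<Longrightarrow> \<phi> x > 0" and C2: "C2_on \<Omega> \<phi>"
    and pd: "\<And>x v. x \<in> \<Omega> \<Longrightarrow> v \<noteq> 0 \<Longrightarrow> v \<bullet> ((- hess \<phi> x) *v v) > 0"
begin

lemma diff: "x \<in> \<Omega> \<Longrightarrow> \<phi> differentiable (at x)" "x \<in> \<Omega> \<Longrightarrow> grad \<phi> differentiable (at x)"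
  and hess_cont: "continuous_on \<Omega> (hess \<phi>)"
  using C2 unfolding C2_on_def by auto

lemma cont: "continuous_on \<Omega> \<phi>"
  by (rule continuous_at_imp_continuous_on) (auto intro: differentiable_imp_continuous_within diff)

lemma hess_sym: "x \<in> \<Omega> \<Longrightarrow> u \<bullet> ((- hess \<phi> x) *v v) = v \<bullet> ((- hess \<phi> x) *v u)"
  using hess_symmetric[OF open_\<Omega>, of x \<phi> u v] diff
  by (simp add: matrix_vector_mult_neg)

lemma segment_in:
  assumes "z + u \<in> S" "z - u \<in> S" "convex S" "\<bar>t\<bar> \<le> 1"
  shows "z + t *\<^sub>R u \<in> S"
proof -
  have "((1 + t)/2) *\<^sub>R (z + u) + ((1 - t)/2) *\<^sub>R (z - u) \<in> S"
    using assms by (intro convexD[of S]) (auto simp: abs_le_iff add_divide_distrib[symmetric])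
  also have "((1 + t)/2) *\<^sub>R (z + u) + ((1 - t)/2) *\<^sub>R (z - u) = ((1 + t)/2 + (1 - t)/2) *\<^sub>R z + ((1 + t)/2 - (1 - t)/2) *\<^sub>R u"
    by (simp only: scaleR_right_distrib scaleR_right_diff_distrib scaleR_left_distrib scaleR_left_diff_distrib) simp
  finally show ?thesis by (simp add: add_divide_distrib diff_divide_distrib)
qed

text \<open>Compactness of the closure supplies all constants of \<open>variance_inequality\<close>:
  strong concavity, a Lipschitz constant, and two-sided bounds on \<phi> and \<open>f\<close>. The
  integrability in the conclusion lets the Bochner integral be replaced by a nonnegative one when
  \<Omega> is exhausted.\<close>

lemma local_inequality:
  assumes U: "open U" "convex U" "U \<noteq> {}" and cl: "closure U \<subseteq> \<Omega>"
    and f: "locally_lipschitz_on \<Omega> f" and p: "p > 0"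
  shows "\<exists>a. ennreal (p * (\<integral>x. (f x - a)\<^sup>2 * \<phi> x powr (p-1) \<partial>restrict_space lborel U))
           \<le> (\<integral>\<^sup>+x. ennreal (dual_form \<phi> f x * \<phi> x powr p) \<partial>restrict_space lborel U)
         \<and> integrable (restrict_space lborel U) (\<lambda>x. (f x - a)\<^sup>2 * \<phi> x powr (p-1))"
proof -
  let ?M = "restrict_space lborel U"
  have sub: "U \<subseteq> \<Omega>" using cl closure_subset by blast
  have bU: "bounded U" using bounded_subset[OF bounded_\<Omega> sub] .
  have K: "compact (closure U)" using bU by (simp add: compact_closure)
  obtain L where L: "L-lipschitz_on (closure U) f" using locally_lipschitz_compact[OF f open_\<Omega> K cl] by auto
  then have LU: "L-lipschitz_on U f" by (rule lipschitz_on_subset) (rule closure_subset)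
  obtain c where c: "c > 0" "\<And>x v. x \<in> closure U \<Longrightarrow> c * (norm v)\<^sup>2 \<le> v \<bullet> ((- hess \<phi> x) *v v)"
    using hess_uniformly_positive[OF hess_cont K cl pd] by blast
  have clne: "closure U \<noteq> {}" using U by simp
  have cc: "continuous_on (closure U) \<phi>" by (rule continuous_on_subset[OF cont cl])
  obtain xm where xm: "xm \<in> closure U" "\<And>y. y \<in> closure U \<Longrightarrow> \<phi> xm \<le> \<phi> y"
    using continuous_attains_inf[OF K clne cc] by blast
  obtain xM where xM: "xM \<in> closure U" "\<And>y. y \<in> closure U \<Longrightarrow> \<phi> y \<le> \<phi> xM"
    using continuous_attains_sup[OF K clne cc] by blast
  define \<delta> where "\<delta> = \<phi> xm"
  have \<delta>: "\<delta> > 0" using xm cl by (auto simp: \<delta>_def intro: pos)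
  have bnd: "\<delta> \<le> \<phi> x \<and> \<phi> x \<le> \<phi> xM" if "x \<in> U" for x
    using that closure_subset xm xM by (auto simp: \<delta>_def)
  have "compact (f ` closure U)"
    using K L by (intro compact_continuous_image lipschitz_on_continuous_on)
  then obtain B where B: "\<And>x. x \<in> closure U \<Longrightarrow> \<bar>f x\<bar> \<le> B"
    using compact_imp_bounded bounded_iff by (metis image_eqI real_norm_def)
  have conc: "\<phi> (z + u) + \<phi> (z - u) - 2 * \<phi> z \<le> - c * (norm u)\<^sup>2" if "z + u \<in> U" "z - u \<in> U" for z u
  proof (rule second_difference_le)
    fix t :: real assume "\<bar>t\<bar> \<le> 1"
    then have "z + t *\<^sub>R u \<in> U" using that U by (intro segment_in)
    then have "z + t *\<^sub>R u \<in> \<Omega>" "z + t *\<^sub>R u \<in> closure U" using sub closure_subset by auto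
    then show "\<phi> differentiable at (z + t *\<^sub>R u) \<and> grad \<phi> differentiable at (z + t *\<^sub>R u)"
      "u \<bullet> (hess \<phi> (z + t *\<^sub>R u) *v u) \<le> - c * (norm u)\<^sup>2"
      using diff c(2)[of "z + t *\<^sub>R u" u] by (auto simp: matrix_vector_mult_neg)
  qed
  define I where "I = (\<integral>x. \<phi> x powr p \<partial>?M)"
  define a where "a = (\<integral>x. f x * \<phi> x powr p \<partial>?M) / I"
  define g where "g x = f x - a" for x
  have lg: "L-lipschitz_on U g"
    using LU unfolding g_def lipschitz_on_def by (simp add: dist_real_def)
  have cU: "continuous_on U \<phi>" by (rule continuous_on_subset[OF cont sub])
  interpret mc: midpoint_concave \<phi> g U c L
    by unfold_locales (use U c(1) cU conc lg in auto)
  have [measurable]: "\<phi> \<in> borel_measurable ?M" by (rule borel_measurable_continuous_on_restrict_lborel[OF cU])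
  have [measurable]: "f \<in> borel_measurable ?M" by (rule borel_measurable_continuous_on_restrict_lborel[OF lipschitz_on_continuous_on[OF LU]])
  have U': "U \<in> sets lborel" using U(1) by simp
  have eU: "emeasure ?M (space ?M) = emeasure lborel U"
    using U' by (simp add: emeasure_restrict_space space_restrict_space)
  have "emeasure lborel U < \<infinity>" by (rule emeasure_bounded_finite[OF bU])
  then have fin: "finite_measure ?M" using eU by (intro finite_measureI) auto
  have Bn: "B \<ge> 0" using B clne abs_ge_zero order_trans by (metis ex_in_conv)
  have gB: "\<bar>g x\<bar> \<le> B + \<bar>a\<bar>" if "x \<in> U" for x
    using B[of x] that closure_subset unfolding g_def by fastforce
  obtain P where P: "P \<ge> 0" "\<And>t. \<delta> \<le> t \<Longrightarrow> t \<le> \<phi> xM \<Longrightarrow> t powr p \<le> P"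
    using powr_bounded_on_interval[OF \<delta>, of "\<phi> xM" p] by auto
  obtain P' where P': "P' \<ge> 0" "\<And>t. \<delta> \<le> t \<Longrightarrow> t \<le> \<phi> xM \<Longrightarrow> t powr (p-1) \<le> P'"
    using powr_bounded_on_interval[OF \<delta>, of "\<phi> xM" "p-1"] by auto
  have i1: "integrable ?M (\<lambda>x. \<phi> x powr p)"
    by (rule integrable_bounded_measurable[OF fin, where B=P]) (use P bnd in \<open>auto simp: space_restrict_space\<close>)
  have i2: "integrable ?M (\<lambda>x. f x * \<phi> x powr p)"
  proof (rule integrable_bounded_measurable[OF fin, where B="B * P"])
    fix x assume "x \<in> space ?M"
    then have x: "x \<in> U" by (simp add: space_restrict_space)
    show "\<bar>f x * \<phi> x powr p\<bar> \<le> B * P"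
      unfolding abs_mult using B[of x] x closure_subset P(2)[of "\<phi> x"] bnd[OF x] Bn by (intro mult_mono) auto
  qed measurable
  have i3: "integrable ?M (\<lambda>x. (g x)\<^sup>2 * \<phi> x powr (p-1))"
  proof (rule integrable_bounded_measurable[OF fin, where B="(B + \<bar>a\<bar>)\<^sup>2 * P'"])
    show "(\<lambda>x. (g x)\<^sup>2 * \<phi> x powr (p-1)) \<in> borel_measurable ?M" unfolding g_def by measurable
    fix x assume "x \<in> space ?M"
    then have x: "x \<in> U" by (simp add: space_restrict_space)
    have "(g x)\<^sup>2 \<le> (B + \<bar>a\<bar>)\<^sup>2" using gB[OF x] Bn by (simp add: abs_le_square_iff[symmetric])
    then show "\<bar>(g x)\<^sup>2 * \<phi> x powr (p-1)\<bar> \<le> (B + \<bar>a\<bar>)\<^sup>2 * P'"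
      unfolding abs_mult using P'(2)[of "\<phi> x"] bnd[OF x] by (intro mult_mono) auto
  qed
  have Ipos: "I > 0"
  proof -
    have "measure ?M (space ?M) > 0"
      using emeasure_lborel_open_pos[OF U(1,3)] eU finite_measure.emeasure_eq_measure[OF fin, of "space ?M"] by (auto simp: zero_less_measure_iff)
    then have "0 < measure ?M (space ?M) * \<delta> powr p" using \<delta> by simp
    also have "\<dots> = (\<integral>x. \<delta> powr p \<partial>?M)" by simp
    also have "\<dots> \<le> I" unfolding I_def using i1 bnd \<delta> p finite_measure.integrable_const[OF fin]
      by (intro integral_mono) (auto simp: space_restrict_space intro!: powr_mono2)
    finally show ?thesis .
  qed
  have zero: "(\<integral>x. g x * \<phi> x powr p \<partial>?M) = 0"
  proof -
    have "(\<integral>x. g x * \<phi> x powr p \<partial>?M) = (\<integral>x. f x * \<phi> x powr p - a * \<phi> x powr p \<partial>?M)"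
      by (simp add: g_def left_diff_distrib)
    also have "\<dots> = (\<integral>x. f x * \<phi> x powr p \<partial>?M) - a * I" using i1 i2 by (simp add: I_def)
    also have "\<dots> = 0" using Ipos by (simp add: a_def)
    finally show ?thesis .
  qed
  have "ennreal (p * (\<integral>x. (g x)\<^sup>2 * \<phi> x powr (p-1) \<partial>?M)) \<le> (\<integral>\<^sup>+x. ennreal (dual_form \<phi> f x * \<phi> x powr p) \<partial>?M)"
  proof (rule mc.variance_inequality[OF U(3) bU \<delta> p bnd gB zero])
    show "AE x in lborel. x \<in> U \<longrightarrow> (\<forall>e>0. \<exists>s0>0. \<forall>s. 0 < s \<and> s < s0 \<longrightarrow> mc.gain_rate s x \<le> dual_form \<phi> f x / 2 + e)"
      using Rademacher_on[OF LU U(1)]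
    proof eventually_elim
      case (elim x)
      show ?case
      proof (intro impI allI)
        fix e :: real assume x: "x \<in> U" and e: "e > 0"
        have x\<Omega>: "x \<in> \<Omega>" using x sub by auto
        have "f differentiable (at x)" using elim x by (intro differentiable_if_gradient_exists) auto
        then have "(f has_derivative (\<lambda>h. grad f x \<bullet> h)) (at x)" by (rule grad_works)
        then have dg: "(g has_derivative (\<lambda>h. grad f x \<bullet> h)) (at x)"
          unfolding g_def by (auto intro!: derivative_eq_intros)
        show "\<exists>s0>0. \<forall>s. 0 < s \<and> s < s0 \<longrightarrow> mc.gain_rate s x \<le> dual_form \<phi> f x / 2 + e"
        proof (rule mc.gain_rate_asymptotic[OF x dg, where q="\<lambda>u. u \<bullet> ((- hess \<phi> x) *v u)"])
          show "0 \<le> dual_form \<phi> f x" "2 * s * (grad f x \<bullet> u) - u \<bullet> ((- hess \<phi> x) *v u) \<le> s\<^sup>2 * dual_form \<phi> f x" for s u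
            unfolding dual_form_def using inverse_quadratic_form[OF hess_sym[OF x\<Omega>] pd[OF x\<Omega>]] by auto
          fix e' :: real assume e': "e' > 0"
          \<comment> \<open>Continuity freezes the Hessian at \<open>x\<close>, at the cost of
            \<open>e' * (norm u)^2\<close>.\<close>
          obtain d where d: "d > 0" "\<And>y. norm (y - x) < d \<Longrightarrow> y \<in> \<Omega> \<and> (\<forall>u. u \<bullet> (hess \<phi> y *v u) \<le> u \<bullet> (hess \<phi> x *v u) + e' * (norm u)\<^sup>2)"
            using hess_quadratic_continuous[OF hess_cont open_\<Omega> x\<Omega> e'] by blast
          have "\<phi> (x + u) + \<phi> (x - u) - 2 * \<phi> x \<le> - (u \<bullet> ((- hess \<phi> x) *v u)) + e' * (norm u)\<^sup>2" if u: "norm u < d" for u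
          proof (rule second_difference_le)
            fix t :: real assume "\<bar>t\<bar> \<le> 1"
            then have "norm (t *\<^sub>R u) \<le> norm u" by (simp add: mult_left_le_one_le)
            then have "norm (x + t *\<^sub>R u - x) < d" using u by simp
            from d(2)[OF this] show "\<phi> differentiable at (x + t *\<^sub>R u) \<and> grad \<phi> differentiable at (x + t *\<^sub>R u)"
              "u \<bullet> (hess \<phi> (x + t *\<^sub>R u) *v u) \<le> - (u \<bullet> ((- hess \<phi> x) *v u)) + e' * (norm u)\<^sup>2"
              using diff by (auto simp: matrix_vector_mult_neg)
          qed
          then show "\<exists>d>0. \<forall>u. norm u < d \<longrightarrow> \<phi> (x + u) + \<phi> (x - u) - 2 * \<phi> x \<le> - (u \<bullet> ((- hess \<phi> x) *v u)) + e' * (norm u)\<^sup>2"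
            using d(1) by blast
        qed (rule e)
      qed
    qed
  qed
  then show ?thesis using i3 unfolding g_def by blast
qed

end

section \<open>Exhaustion of the domain by dilates\<close>

lemma (in concave_potential) weighted_poincare:
  assumes f: "locally_lipschitz_on \<Omega> f" and p: "p > 0"
  shows "\<exists>a. ennreal p * (\<integral>\<^sup>+x. ennreal ((f x - a)\<^sup>2 * \<phi> x powr (p-1)) \<partial>restrict_space lborel \<Omega>)
           \<le> (\<integral>\<^sup>+x. ennreal (dual_form \<phi> f x * \<phi> x powr p) \<partial>restrict_space lborel \<Omega>)"
\<comment> \<open>With an infinite right side every constant works; a finite one is what bounds the
  local constants.\<close>
proof (cases "\<Omega> = {} \<or> (\<integral>\<^sup>+x. ennreal (dual_form \<phi> f x * \<phi> x powr p) \<partial>restrict_space lborel \<Omega>) = top")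
  case True
  then show ?thesis
  proof
    assume "\<Omega> = {}"
    then show ?thesis by (simp add: nn_integral_empty space_restrict_space)
  qed simp
next
  case False
  let ?R = "\<integral>\<^sup>+x. ennreal (dual_form \<phi> f x * \<phi> x powr p) \<partial>restrict_space lborel \<Omega>"
  obtain \<rho> where \<rho>: "?R = ennreal \<rho>" "\<rho> \<ge> 0" using False by (cases ?R) auto
  obtain x0 where x0: "x0 \<in> \<Omega>" using False by auto
  \<comment> \<open>The ratios increase from \<open>1/2\<close> to one. \<open>?h n\<close> inverts
    the dilation by \<open>r n\<close> about \<open>x0\<close>, so that membership in
    \<open>U n\<close> is an open condition on \<open>?h n x\<close>.\<close>
  define r where "r n = 1 - 1 / (real n + 2)" for n
  have r: "1/2 \<le> r n" "r n < 1" "0 < r n" for n by (auto simp: r_def field_simps)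
  let ?h = "\<lambda>n x. x0 + (1 / r n) *\<^sub>R (x - x0)"
  define U where "U n = (\<lambda>x. (1 - r n) *\<^sub>R x0 + r n *\<^sub>R x) ` \<Omega>" for n
  have U_vimage: "U n = ?h n -` \<Omega>" for n
  proof (intro set_eqI iffI)
    fix x assume "x \<in> U n"
    then obtain y where y: "y \<in> \<Omega>" "x = (1 - r n) *\<^sub>R x0 + r n *\<^sub>R y" by (auto simp: U_def)
    have "x - x0 = r n *\<^sub>R (y - x0)" using y by (simp add: algebra_simps)
    then have "?h n x = y" using r[of n] by simp
    then show "x \<in> ?h n -` \<Omega>" using y by simp
  next
    fix x assume x: "x \<in> ?h n -` \<Omega>"
    have "x = (1 - r n) *\<^sub>R x0 + r n *\<^sub>R (?h n x)"
      using r[of n] by (simp add: algebra_simps)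
    then show "x \<in> U n" unfolding U_def using x by (intro image_eqI) auto
  qed
  have Uo: "open (U n)" for n
    unfolding U_vimage using open_\<Omega> by (intro open_vimage continuous_intros)
  have Uc: "convex (U n)" for n
    unfolding U_def by (rule convex_affinity[OF convex_\<Omega>])
  have Ux0: "x0 \<in> U n" for n unfolding U_vimage using x0 by simp
  \<comment> \<open>Shrinking the point \<open>?h n x\<close> of \<open>closure \<Omega>\<close> by
    the factor \<open>r n\<close> towards the interior point \<open>x0\<close> recovers
    \<open>x\<close> and lands in the interior.\<close>
  have Ucl: "closure (U n) \<subseteq> \<Omega>" for n
  proof
    fix x assume x: "x \<in> closure (U n)"
    have "?h n x \<in> closure \<Omega>"
    proof -
      have "?h n ` closure (U n) \<subseteq> closure \<Omega>"
      proof (rule image_closure_subset)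
        show "continuous_on (closure (U n)) (?h n)" by (intro continuous_intros)
        show "?h n ` U n \<subseteq> closure \<Omega>" using closure_subset by (auto simp: U_vimage)
      qed simp
      then show ?thesis using x by auto
    qed
    then have "?h n x - (1 - r n) *\<^sub>R (?h n x - x0) \<in> interior \<Omega>"
      using r[of n] x0 open_\<Omega> by (intro mem_interior_closure_convex_shrink convex_\<Omega>) (auto simp: interior_open)
    also have "?h n x - (1 - r n) *\<^sub>R (?h n x - x0) = x0 + (1 / r n - (1 - r n) * (1 / r n)) *\<^sub>R (x - x0)"
      by (simp add: scaleR_left_diff_distrib del: scaleR_right_diff_distrib)
    also have "1 / r n - (1 - r n) * (1 / r n) = 1" using r[of n] by (simp add: field_simps)
    finally show "x \<in> \<Omega>" using open_\<Omega> by (simp add: interior_open)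
  qed
  have Usub: "U n \<subseteq> \<Omega>" for n using Ucl closure_subset by blast
  \<comment> \<open>As \<open>1 / r n \<le> 2\<close>, the point \<open>?h n x\<close> is a convex
    combination of \<open>x0\<close> and \<open>?h 0 x\<close>.\<close>
  have U0: "U 0 \<subseteq> U n" for n
  proof
    fix x assume "x \<in> U 0"
    then have y: "x0 + 2 *\<^sub>R (x - x0) \<in> \<Omega>" by (simp add: U_vimage r_def)
    have "(1 - 1 / (2 * r n)) *\<^sub>R x0 + (1 / (2 * r n)) *\<^sub>R (x0 + 2 *\<^sub>R (x - x0)) \<in> \<Omega>"
      using r[of n] y x0 convex_\<Omega> by (intro convexD) auto
    also have "(1 - 1 / (2 * r n)) *\<^sub>R x0 + (1 / (2 * r n)) *\<^sub>R (x0 + 2 *\<^sub>R (x - x0)) = ?h n x"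
      by (simp add: scaleR_left_diff_distrib scaleR_right_distrib)
    finally show "x \<in> U n" by (simp add: U_vimage)
  qed
  have Uev: "eventually (\<lambda>n. x \<in> U n) sequentially" if x: "x \<in> \<Omega>" for x
  proof -
    have "(\<lambda>n. 1 / (real n + 2)) \<longlonglongrightarrow> 0"
      using LIMSEQ_ignore_initial_segment[OF lim_1_over_n[where 'a=real], of 2] by (simp add: add.commute)
    then have "r \<longlonglongrightarrow> 1 - 0" unfolding r_def by (intro tendsto_intros)
    then have "(\<lambda>n. ?h n x) \<longlonglongrightarrow> x0 + (1 / (1 - 0)) *\<^sub>R (x - x0)"
      by (intro tendsto_intros) auto
    then have "(\<lambda>n. ?h n x) \<longlonglongrightarrow> x" by simp
    then have "eventually (\<lambda>n. ?h n x \<in> \<Omega>) sequentially"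
      using open_\<Omega> x by (rule topological_tendstoD)
    then show ?thesis by (simp add: U_vimage)
  qed
  have fm: "continuous_on \<Omega> f" by (rule locally_lipschitz_continuous_on[OF f open_\<Omega>])
  define w where "w a x = p * ((f x - a)\<^sup>2 * \<phi> x powr (p-1))" for a x
  have w_cont: "continuous_on \<Omega> (w a)" for a
    unfolding w_def by (intro continuous_intros fm cont) (auto dest: pos)
  have w_meas: "(\<lambda>x. ennreal (w a x) * indicator S x) \<in> borel_measurable lborel" if "open S" "S \<subseteq> \<Omega>" for a S
  proof -
    have "w a \<in> borel_measurable (restrict_space lborel S)"
      using that by (intro borel_measurable_continuous_on_restrict_lborel continuous_on_subset[OF w_cont])
    then have "(\<lambda>x. ennreal (w a x)) \<in> borel_measurable (restrict_space lborel S)" by measurable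
    then show ?thesis using that(1) by (subst (asm) borel_measurable_restrict_space_iff_ennreal) auto
  qed
  have w0: "w a x \<ge> 0" for a x using p by (simp add: w_def)
  have "\<exists>a. (\<integral>\<^sup>+x. ennreal (w a x) * indicator (U n) x \<partial>lborel) \<le> ennreal \<rho>" for n
  proof -
    let ?M = "restrict_space lborel (U n)"
    have Un: "U n \<inter> space lborel \<in> sets lborel" "\<Omega> \<inter> space lborel \<in> sets lborel" using Uo open_\<Omega> by auto
    obtain a where a: "ennreal (p * (\<integral>x. (f x - a)\<^sup>2 * \<phi> x powr (p-1) \<partial>?M)) \<le> (\<integral>\<^sup>+x. ennreal (dual_form \<phi> f x * \<phi> x powr p) \<partial>?M)"
      "integrable ?M (\<lambda>x. (f x - a)\<^sup>2 * \<phi> x powr (p-1))"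
      using local_inequality[OF Uo Uc _ Ucl f p, of n] Ux0[of n] by blast
    have "(\<integral>\<^sup>+x. ennreal (w a x) * indicator (U n) x \<partial>lborel) = (\<integral>\<^sup>+x. ennreal (w a x) \<partial>?M)"
      by (rule nn_integral_restrict_space[OF Un(1), symmetric])
    also have "\<dots> = ennreal (\<integral>x. w a x \<partial>?M)"
      using a(2) w0 unfolding w_def by (intro nn_integral_eq_integral) auto
    also have "\<dots> = ennreal (p * (\<integral>x. (f x - a)\<^sup>2 * \<phi> x powr (p-1) \<partial>?M))" unfolding w_def by simp
    also have "\<dots> \<le> (\<integral>\<^sup>+x. ennreal (dual_form \<phi> f x * \<phi> x powr p) \<partial>?M)" by (rule a)
    also have "\<dots> = (\<integral>\<^sup>+x. ennreal (dual_form \<phi> f x * \<phi> x powr p) * indicator (U n) x \<partial>lborel)"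
      by (rule nn_integral_restrict_space[OF Un(1)])
    also have "\<dots> \<le> (\<integral>\<^sup>+x. ennreal (dual_form \<phi> f x * \<phi> x powr p) * indicator \<Omega> x \<partial>lborel)"
      using Usub[of n] by (intro nn_integral_mono mult_left_mono) (auto simp: indicator_def)
    also have "\<dots> = ?R" by (rule nn_integral_restrict_space[OF Un(2), symmetric])
    finally show ?thesis using \<rho> by auto
  qed
  then obtain a where a: "\<And>n. (\<integral>\<^sup>+x. ennreal (w (a n) x) * indicator (U n) x \<partial>lborel) \<le> ennreal \<rho>" by metis
  \<comment> \<open>\<open>U 0\<close> lies in every \<open>U n\<close> and \<open>f\<close> is
    bounded by some \<open>B\<close> on it. A constant beyond \<open>B\<close> makes the integrand
    at least \<open>p * (\<bar>a n\<bar> - B)^2 * \<mu>\<close> there, and \<rho> limits its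
    integral uniformly in \<open>n\<close>.\<close>
  have "bounded (range a)"
  proof -
    have K: "compact (closure (U 0))" 
      using bounded_subset[OF bounded_\<Omega> Usub] by (simp add: compact_closure)
    have "compact (f ` closure (U 0))" by (intro compact_continuous_image K continuous_on_subset[OF fm Ucl])
    then obtain B where B: "\<And>x. x \<in> closure (U 0) \<Longrightarrow> \<bar>f x\<bar> \<le> B"
      using compact_imp_bounded bounded_iff by (metis image_eqI real_norm_def)
    have \<phi>c: "continuous_on (closure (U 0)) (\<lambda>x. \<phi> x powr (p-1))"
    proof -
      have "\<phi> x \<noteq> 0" if "x \<in> closure (U 0)" for x using pos[of x] that Ucl[of 0] by force
      then show ?thesis by (intro continuous_intros continuous_on_subset[OF cont Ucl]) auto
    qed
    have "closure (U 0) \<noteq> {}" using Ux0[of 0] by auto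
    then obtain xm where xm: "xm \<in> closure (U 0)" "\<And>y. y \<in> closure (U 0) \<Longrightarrow> \<phi> xm powr (p-1) \<le> \<phi> y powr (p-1)"
      using continuous_attains_inf[OF K _ \<phi>c] by blast
    define \<mu> where "\<mu> = \<phi> xm powr (p-1)"
    have "\<phi> xm > 0" using pos xm(1) Ucl[of 0] by blast
    then have \<mu>: "\<mu> > 0" by (simp add: \<mu>_def)
    have "emeasure lborel (U 0) \<noteq> 0" using emeasure_lborel_open_pos[OF Uo, of 0] Ux0[of 0] by force
    moreover have "emeasure lborel (U 0) < \<infinity>" by (intro emeasure_bounded_finite bounded_subset[OF bounded_\<Omega> Usub])
    ultimately obtain v where v: "emeasure lborel (U 0) = ennreal v" "v > 0"
      by (cases "emeasure lborel (U 0)") (auto simp: less_le)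
    have "\<bar>a n\<bar> \<le> B + sqrt (\<rho> / (p * \<mu> * v))" for n
    proof (cases "\<bar>a n\<bar> \<le> B")
      case True
      have "0 \<le> sqrt (\<rho> / (p * \<mu> * v))" using \<rho>(2) p \<mu> v by simp
      then show ?thesis using True by linarith
    next
      case False
      let ?t = "p * ((\<bar>a n\<bar> - B)\<^sup>2 * \<mu>)"
      have t0: "?t \<ge> 0" using p \<mu> by simp
      have "ennreal (?t * v) = ennreal ?t * emeasure lborel (U 0)"
        using t0 v by (simp add: ennreal_mult)
      also have "\<dots> = (\<integral>\<^sup>+x. ennreal ?t * indicator (U 0) x \<partial>lborel)"
        using Uo by (simp add: nn_integral_cmult)
      also have "\<dots> \<le> (\<integral>\<^sup>+x. ennreal (w (a n) x) * indicator (U n) x \<partial>lborel)"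
      proof (rule nn_integral_mono)
        fix x
        show "ennreal ?t * indicator (U 0) x \<le> ennreal (w (a n) x) * indicator (U n) x"
        proof (cases "x \<in> U 0")
          case True
          then have xc: "x \<in> closure (U 0)" using closure_subset by blast
          have "\<bar>a n\<bar> - B \<le> \<bar>f x - a n\<bar>" using B[OF xc] by linarith
          then have "(\<bar>a n\<bar> - B)\<^sup>2 \<le> \<bar>f x - a n\<bar>\<^sup>2" using False by (intro power_mono) auto
          then have "?t \<le> w (a n) x" unfolding w_def using p xm(2)[OF xc] \<mu>
            by (intro mult_left_mono mult_mono) (auto simp: \<mu>_def)
          then show ?thesis using True U0 by (auto simp: indicator_def intro!: ennreal_leI)
        qed simp
      qed
      also have "\<dots> \<le> ennreal \<rho>" by (rule a)
      finally have "?t * v \<le> \<rho>" using \<rho>(2) by simp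
      then have "(\<bar>a n\<bar> - B)\<^sup>2 \<le> \<rho> / (p * \<mu> * v)" using p \<mu> v by (simp add: field_simps)
      then have "\<bar>a n\<bar> - B \<le> sqrt (\<rho> / (p * \<mu> * v))" by (rule real_le_rsqrt)
      then show ?thesis by simp
    qed
    then show ?thesis by (auto simp: bounded_iff)
  qed
  then obtain l \<sigma> where \<sigma>: "strict_mono (\<sigma> :: nat \<Rightarrow> nat)" "(a \<circ> \<sigma>) \<longlonglongrightarrow> l"
    using bounded_imp_convergent_subsequence by blast
  let ?u = "\<lambda>n x. ennreal (w (a (\<sigma> n)) x) * indicator (U (\<sigma> n)) x"
  have "(\<integral>\<^sup>+x. ennreal (w l x) * indicator \<Omega> x \<partial>lborel) \<le> (\<integral>\<^sup>+x. liminf (\<lambda>n. ?u n x) \<partial>lborel)"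
  proof (rule nn_integral_mono)
    fix x
    show "ennreal (w l x) * indicator \<Omega> x \<le> liminf (\<lambda>n. ?u n x)"
    proof (cases "x \<in> \<Omega>")
      case True
      have "(\<lambda>n. w (a (\<sigma> n)) x) \<longlonglongrightarrow> w l x" unfolding w_def
        using \<sigma>(2) by (intro tendsto_intros) (simp add: comp_def)
      then have "(\<lambda>n. ennreal (w (a (\<sigma> n)) x)) \<longlonglongrightarrow> ennreal (w l x)" by (rule tendsto_ennrealI)
      moreover have "eventually (\<lambda>n. ennreal (w (a (\<sigma> n)) x) = ?u n x) sequentially"
        using eventually_subseq[OF \<sigma>(1) Uev[OF True]] by eventually_elim simp
      ultimately have "(\<lambda>n. ?u n x) \<longlonglongrightarrow> ennreal (w l x)" by (rule Lim_transform_eventually)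
      then have "liminf (\<lambda>n. ?u n x) = ennreal (w l x)" by (intro lim_imp_Liminf) auto
      then show ?thesis using True by simp
    qed simp
  qed
  also have "\<dots> \<le> liminf (\<lambda>n. \<integral>\<^sup>+x. ?u n x \<partial>lborel)"
    using w_meas[OF Uo Usub] by (intro nn_integral_liminf) auto
  also have "\<dots> \<le> ennreal \<rho>"
    using Liminf_mono[of "\<lambda>n. \<integral>\<^sup>+x. ?u n x \<partial>lborel" "\<lambda>_. ennreal \<rho>" sequentially] a
    by (simp add: Liminf_const)
  finally have fin: "(\<integral>\<^sup>+x. ennreal (w l x) * indicator \<Omega> x \<partial>lborel) \<le> ennreal \<rho>" .
  have [measurable]: "(\<lambda>x. (f x - l)\<^sup>2 * \<phi> x powr (p-1)) \<in> borel_measurable (restrict_space lborel \<Omega>)"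
    by (intro borel_measurable_continuous_on_restrict_lborel continuous_intros fm cont) (auto dest: pos)
  have "ennreal p * (\<integral>\<^sup>+x. ennreal ((f x - l)\<^sup>2 * \<phi> x powr (p-1)) \<partial>restrict_space lborel \<Omega>)
     = (\<integral>\<^sup>+x. ennreal p * ennreal ((f x - l)\<^sup>2 * \<phi> x powr (p-1)) \<partial>restrict_space lborel \<Omega>)"
    by (rule nn_integral_cmult[symmetric]) measurable
  also have "\<dots> = (\<integral>\<^sup>+x. ennreal (w l x) \<partial>restrict_space lborel \<Omega>)"
    using p by (simp add: w_def ennreal_mult)
  also have "\<dots> = (\<integral>\<^sup>+x. ennreal (w l x) * indicator \<Omega> x \<partial>lborel)"
    using open_\<Omega> by (intro nn_integral_restrict_space) auto
  finally show ?thesis using fin \<rho> by (intro exI[of _ l]) simp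
qed

text \<open>\<open>smooth_on\<close> speaks of partial derivatives only, so the path from
  \<open>y\<close> to \<open>z\<close> changes one coordinate at a time and the mean value bound is
  used on each segment. The radius is halved because a corner of the path can be as far as
  \<open>norm (y - x) + norm (z - x)\<close> from \<open>x\<close>.\<close>

lemma smooth_on_imp_locally_lipschitz_on:
  fixes f :: "real^'n \<Rightarrow> real"
  assumes f: "smooth_on U f" and U: "open U"
  shows "locally_lipschitz_on U f"
  unfolding locally_lipschitz_on_def
proof
  fix x assume x: "x \<in> U"
  have pd_works: "((\<lambda>t. f (y + t *\<^sub>R axis i 1)) has_real_derivative pd i f y) (at 0)" if "y \<in> U" for y i
  proof -
    have "\<exists>d. ((\<lambda>t. f (y + t *\<^sub>R axis i 1)) has_real_derivative d) (at 0)"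
      using f that unfolding smooth_on_def by (metis iter_pd.simps(1))
    then show ?thesis unfolding pd_def by (auto intro: someI_ex)
  qed
  have pd_cont: "continuous_on U (pd i f)" for i
    using f unfolding smooth_on_def by (metis iter_pd.simps)
  obtain r where r: "r > 0" "cball x r \<subseteq> U" using U x by (meson open_contains_cball)
  have "\<exists>B. \<forall>y\<in>cball x r. \<bar>pd i f y\<bar> \<le> B" for i
  proof -
    have "compact (pd i f ` cball x r)"
      using continuous_on_subset[OF pd_cont r(2)] by (intro compact_continuous_image) auto
    then show ?thesis using compact_imp_bounded bounded_iff by (metis image_eqI real_norm_def)
  qed
  then obtain B where B: "\<And>i y. y \<in> cball x r \<Longrightarrow> \<bar>pd i f y\<bar> \<le> B i" by metis
  define C where "C = (\<Sum>i\<in>UNIV. \<bar>B i\<bar>)"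
  have line: "\<bar>f (w + s *\<^sub>R axis i 1) - f w\<bar> \<le> C * \<bar>s\<bar>"
    if w: "w \<in> cball x r" "w + s *\<^sub>R axis i 1 \<in> cball x r" for w s i
  proof -
    let ?S = "closed_segment 0 s"
    have in_cb: "w + t *\<^sub>R axis i 1 \<in> cball x r" if t: "t \<in> ?S" for t
    proof -
      obtain u where u: "0 \<le> u" "u \<le> 1" "t = u * s" using t unfolding in_segment by auto
      have "(1 - u) *\<^sub>R w + u *\<^sub>R (w + s *\<^sub>R axis i 1) \<in> cball x r"
        using w u by (intro convexD[OF convex_cball]) auto
      then show ?thesis using u by (simp add: algebra_simps)
    qed
    have "norm (f (w + s *\<^sub>R axis i 1) - f (w + 0 *\<^sub>R axis i 1)) \<le> C * norm (s - 0)"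
    proof (rule field_differentiable_bound[where S="?S" and f'="\<lambda>t. pd i f (w + t *\<^sub>R axis i 1)"])
      fix t assume t: "t \<in> ?S"
      have "((\<lambda>h. f (w + t *\<^sub>R axis i 1 + h *\<^sub>R axis i 1)) has_real_derivative pd i f (w + t *\<^sub>R axis i 1)) (at 0)"
        using in_cb[OF t] r(2) by (intro pd_works) auto
      then have "((\<lambda>h. f (w + (h + t) *\<^sub>R axis i 1)) has_real_derivative pd i f (w + t *\<^sub>R axis i 1)) (at 0)"
        by (simp add: scaleR_left_distrib add_ac)
      then have "((\<lambda>t. f (w + t *\<^sub>R axis i 1)) has_real_derivative pd i f (w + t *\<^sub>R axis i 1)) (at (0 + t))"
        by (subst DERIV_shift)
      then show "((\<lambda>t. f (w + t *\<^sub>R axis i 1)) has_real_derivative pd i f (w + t *\<^sub>R axis i 1)) (at t within ?S)"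
        by (simp add: has_field_derivative_at_within)
      have "\<bar>B i\<bar> \<le> C" unfolding C_def by (rule member_le_sum) auto
      then show "norm (pd i f (w + t *\<^sub>R axis i 1)) \<le> C" using B[OF in_cb[OF t], of i] by simp
    qed auto
    then show ?thesis by simp
  qed
  have "(C * real CARD('n))-lipschitz_on (ball x (r/2) \<inter> U) f"
  proof (rule lipschitz_onI)
    have C0: "C \<ge> 0" unfolding C_def by (intro sum_nonneg) auto
    then show "0 \<le> C * real CARD('n)" by simp
    fix y z assume yz: "y \<in> ball x (r/2) \<inter> U" "z \<in> ball x (r/2) \<inter> U"
    \<comment> \<open>The corner of the path at which exactly the coordinates in \<open>F\<close>
      have been moved.\<close>
    define w where "w F = (\<chi> i. if i \<in> F then z $ i else y $ i)" for F :: "'n set"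
    have w_in: "w F \<in> cball x r" for F
    proof -
      have "norm (w F - x) \<le> L2_set (\<lambda>i. \<bar>(y - x) $ i\<bar> + \<bar>(z - x) $ i\<bar>) UNIV"
        unfolding norm_vec_def by (intro L2_set_mono) (auto simp: w_def)
      also have "\<dots> \<le> L2_set (\<lambda>i. \<bar>(y - x) $ i\<bar>) UNIV + L2_set (\<lambda>i. \<bar>(z - x) $ i\<bar>) UNIV"
        by (rule L2_set_triangle_ineq)
      also have "\<dots> = norm (y - x) + norm (z - x)" by (simp add: norm_vec_def)
      also have "\<dots> \<le> r/2 + r/2" using yz by (intro add_mono) (auto simp: dist_norm norm_minus_commute)
      finally show ?thesis by (simp add: dist_norm norm_minus_commute)
    qed
    have "\<bar>f (w F) - f y\<bar> \<le> (\<Sum>i\<in>F. C * \<bar>z $ i - y $ i\<bar>)" for F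
      using finite[of F]
    proof (induction F rule: finite_induct)
      case empty
      have "w {} = y" by (simp add: w_def vec_eq_iff)
      then show ?case by simp
    next
      case (insert i F)
      have eq: "w (insert i F) = w F + (z $ i - y $ i) *\<^sub>R axis i 1"
        using insert by (auto simp: w_def vec_eq_iff axis_def)
      have "\<bar>f (w (insert i F)) - f (w F)\<bar> \<le> C * \<bar>z $ i - y $ i\<bar>"
        using line[OF w_in[of F], of "z $ i - y $ i" i] w_in[of "insert i F"] unfolding eq by simp
      then show ?case using insert by simp
    qed
    from this[of UNIV] have "\<bar>f z - f y\<bar> \<le> (\<Sum>i\<in>UNIV. C * \<bar>z $ i - y $ i\<bar>)"
      by (simp add: w_def)
    also have "\<dots> \<le> (\<Sum>i\<in>(UNIV::'n set). C * dist y z)"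
    proof (intro sum_mono mult_left_mono C0)
      fix i show "\<bar>z $ i - y $ i\<bar> \<le> dist y z"
        using component_le_norm_cart[of "z - y" i] by (simp add: dist_norm norm_minus_commute)
    qed
    also have "\<dots> = C * real CARD('n) * dist y z" by simp
    also have "\<bar>f z - f y\<bar> = dist (f y) (f z)" by (simp only: dist_real_def abs_minus_commute)
    finally show "dist (f y) (f z) \<le> C * real CARD('n) * dist y z" .
  qed
  moreover have "r/2 > 0" using r(1) by simp
  ultimately show "\<exists>r>0. \<exists>L. L-lipschitz_on (ball x r \<inter> U) f" by blast
qed

text \<open>The integral of a non-measurable \<open>h\<close> is a lower integral, for which only this inequality holds.\<close>

lemma nn_integral_density_ge:
  fixes w h :: "'a \<Rightarrow> ennreal"
  assumes [measurable]: "w \<in> borel_measurable M" and w: "\<And>x. x \<in> space M \<Longrightarrow> 0 < w x \<and> w x < top"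
  shows "C * (\<integral>\<^sup>+x. w x * h x \<partial>M) \<le> (\<integral>\<^sup>+x. h x \<partial>density M (\<lambda>x. C * w x))"
  unfolding nn_integral_def[of M] SUP_mult_left_ennreal
proof (rule SUP_least)
  fix g assume g: "g \<in> {g. simple_function M g \<and> g \<le> (\<lambda>x. w x * h x)}"
  then have [measurable]: "g \<in> borel_measurable M" by (auto intro: borel_measurable_simple_function)
  have le: "g x \<le> w x * h x" for x using g by (auto simp: le_fun_def)
  have "C * integral\<^sup>S M g = C * (\<integral>\<^sup>+x. g x \<partial>M)" using g by (simp add: nn_integral_eq_simple_integral)
  also have "\<dots> = (\<integral>\<^sup>+x. C * g x \<partial>M)" by (rule nn_integral_cmult[symmetric]) measurable
  \<comment> \<open>The quotient \<open>g / w\<close> is measurable and lies below \<open>h\<close>,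
    so the density formula can be applied to it instead of \<open>h\<close>.\<close>
  also have "\<dots> = (\<integral>\<^sup>+x. C * w x * (g x / w x) \<partial>M)"
  proof (rule nn_integral_cong)
    fix x assume "x \<in> space M"
    then have "w x \<noteq> 0" "w x \<noteq> top" using w[of x] by auto
    then have "w x * (g x / w x) = g x"
      by (simp add: ennreal_times_divide ennreal_mult_divide_eq mult.commute[of "w x"])
    then show "C * g x = C * w x * (g x / w x)" by (simp add: mult.assoc)
  qed
  also have "\<dots> = (\<integral>\<^sup>+x. g x / w x \<partial>density M (\<lambda>x. C * w x))"
    by (rule nn_integral_density[symmetric]) measurable
  also have "\<dots> \<le> (\<integral>\<^sup>+x. h x \<partial>density M (\<lambda>x. C * w x))"
  proof (rule nn_integral_mono)
    fix x assume "x \<in> space (density M (\<lambda>x. C * w x))"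
    then have "0 < w x" "w x < top" using w by auto
    then have "g x / w x \<le> (w x * h x) / w x" using le by (intro divide_right_mono_ennreal)
    also have "\<dots> = h x" using \<open>0 < w x\<close> \<open>w x < top\<close> by (simp add: ennreal_mult_divide_eq mult.commute)
    finally show "g x / w x \<le> h x" .
  qed
  finally show "C * integral\<^sup>S M g \<le> (\<integral>\<^sup>+x. h x \<partial>density M (\<lambda>x. C * w x))" .
qed

section \<open>Transfer to the normalized measures \<open>nu\<close>\<close>

context concave_potential
begin

lemma powr_cont: "continuous_on \<Omega> (\<lambda>x. \<phi> x powr q)"
  by (intro continuous_intros cont) (auto dest: pos)

lemma nu_eq:
  fixes \<beta> :: real
  defines "Z \<equiv> set_lebesgue_integral lborel \<Omega> (\<lambda>y. \<phi> y powr \<beta>)"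
  shows "nu \<Omega> \<phi> \<beta> = density (restrict_space lborel \<Omega>) (\<lambda>x. ennreal (1 / Z) * ennreal (\<phi> x powr \<beta>))"
    and "Z \<ge> 0"
proof -
  show Z: "Z \<ge> 0" unfolding Z_def set_lebesgue_integral_def by (intro integral_nonneg_AE) auto
  show "nu \<Omega> \<phi> \<beta> = density (restrict_space lborel \<Omega>) (\<lambda>x. ennreal (1 / Z) * ennreal (\<phi> x powr \<beta>))"
    unfolding nu_def Z_def[symmetric] using Z by (simp add: ennreal_mult[symmetric])
qed

text \<open>If \<Omega> is empty or \<open>\<phi> powr \<beta>\<close> is not integrable, the
  normalizing Bochner integral is zero by convention; division by zero then makes the density zero
  and \<open>nu\<close> the null measure. A nonzero value certifies integrability, and the
  normalization is genuine.\<close>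

lemma nu_null_or_probability:
  fixes \<beta> :: real
  shows "(AE x in nu \<Omega> \<phi> \<beta>. False) \<or>
    finite_measure (nu \<Omega> \<phi> \<beta>) \<and> measure (nu \<Omega> \<phi> \<beta>) (space (nu \<Omega> \<phi> \<beta>)) = 1"
proof -
  let ?Z = "set_lebesgue_integral lborel \<Omega> (\<lambda>y. \<phi> y powr \<beta>)"
  let ?M = "restrict_space lborel \<Omega>"
  have [measurable]: "(\<lambda>x. \<phi> x powr \<beta>) \<in> borel_measurable ?M" by (rule borel_measurable_continuous_on_restrict_lborel[OF powr_cont])
  have \<Omega>: "\<Omega> \<inter> space lborel \<in> sets lborel" using open_\<Omega> by simp
  show ?thesis
  proof (cases "?Z = 0")
    case True
    then show ?thesis unfolding nu_eq by (subst AE_density) auto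
  next
    case False
    then have Z: "?Z > 0" using nu_eq(2)[of \<beta>] by simp
    then have "integrable lborel (\<lambda>x. indicator \<Omega> x *\<^sub>R \<phi> x powr \<beta>)"
      unfolding set_lebesgue_integral_def using not_integrable_integral_eq by fastforce
    then have i: "integrable ?M (\<lambda>x. \<phi> x powr \<beta>)" using \<Omega> by (subst integrable_restrict_space) auto
    have e: "(\<integral>x. \<phi> x powr \<beta> \<partial>?M) = ?Z"
      unfolding set_lebesgue_integral_def using \<Omega> by (rule integral_restrict_space)
    have "emeasure (nu \<Omega> \<phi> \<beta>) (space (nu \<Omega> \<phi> \<beta>)) = (\<integral>\<^sup>+x. ennreal (1 / ?Z) * ennreal (\<phi> x powr \<beta>) \<partial>?M)"
      unfolding nu_eq by (subst emeasure_density) (auto intro!: nn_integral_cong)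
    also have "\<dots> = ennreal (1 / ?Z) * (\<integral>\<^sup>+x. ennreal (\<phi> x powr \<beta>) \<partial>?M)" by (rule nn_integral_cmult) measurable
    also have "(\<integral>\<^sup>+x. ennreal (\<phi> x powr \<beta>) \<partial>?M) = ennreal ?Z"
      using i e by (subst nn_integral_eq_integral) auto
    also have "ennreal (1 / ?Z) * ennreal ?Z = 1" using Z by (simp add: ennreal_mult[symmetric])
    finally show ?thesis by (auto simp: measure_def intro!: finite_measureI)
  qed
qed

text \<open>Relative to the density \<open>\<phi> powr \<beta>\<close> both weights lose the
  exponent \<beta>. Keeping \<open>p\<close> and \<beta> independent serves both claims:
  \<open>p = \<beta> + 1\<close> leaves the weights \<open>1\<close> and \<phi>, and
  \<open>p = \<beta>\<close> leaves \<open>1 / \<phi>\<close> and \<open>1\<close>.\<close>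

lemma nu_weighted_poincare:
  fixes \<beta> p :: real
  assumes f: "locally_lipschitz_on \<Omega> f" and p: "p > 0"
  shows "\<exists>a. (\<integral>\<^sup>+x. ennreal ((f x - a)\<^sup>2 * \<phi> x powr (p - 1 - \<beta>)) \<partial>nu \<Omega> \<phi> \<beta>)
     \<le> ennreal (1 / p) * (\<integral>\<^sup>+x. ennreal (dual_form \<phi> f x * \<phi> x powr (p - \<beta>)) \<partial>nu \<Omega> \<phi> \<beta>)"
proof -
  let ?Z = "set_lebesgue_integral lborel \<Omega> (\<lambda>y. \<phi> y powr \<beta>)"
  let ?M = "restrict_space lborel \<Omega>"
  let ?w = "\<lambda>x. ennreal (\<phi> x powr \<beta>)"
  obtain a where a: "ennreal p * (\<integral>\<^sup>+x. ennreal ((f x - a)\<^sup>2 * \<phi> x powr (p-1)) \<partial>?M)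
           \<le> (\<integral>\<^sup>+x. ennreal (dual_form \<phi> f x * \<phi> x powr p) \<partial>?M)"
    using weighted_poincare[OF f p] by blast
  have [measurable]: "(\<lambda>x. \<phi> x powr q) \<in> borel_measurable ?M" for q by (rule borel_measurable_continuous_on_restrict_lborel[OF powr_cont])
  have [measurable]: "f \<in> borel_measurable ?M"
    by (rule borel_measurable_continuous_on_restrict_lborel[OF locally_lipschitz_continuous_on[OF f open_\<Omega>]])
  \<comment> \<open>For negative \<open>h\<close> both sides are truncated to zero.\<close>
  have split: "?w x * ennreal (h * \<phi> x powr (q - \<beta>)) = ennreal (h * \<phi> x powr q)" for h q x
  proof (cases "h \<ge> 0")
    case False
    then have "h * \<phi> x powr r \<le> 0" for r by (intro mult_nonpos_nonneg) auto
    then show ?thesis by (simp add: ennreal_neg)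
  qed (auto simp: ennreal_mult[symmetric] powr_diff)
  have "(\<integral>\<^sup>+x. ennreal ((f x - a)\<^sup>2 * \<phi> x powr (p - 1 - \<beta>)) \<partial>nu \<Omega> \<phi> \<beta>)
    = (\<integral>\<^sup>+x. ennreal (1 / ?Z) * ?w x * ennreal ((f x - a)\<^sup>2 * \<phi> x powr (p - 1 - \<beta>)) \<partial>?M)"
    unfolding nu_eq by (rule nn_integral_density) measurable
  also have "\<dots> = (\<integral>\<^sup>+x. ennreal (1 / ?Z) * ennreal ((f x - a)\<^sup>2 * \<phi> x powr (p - 1)) \<partial>?M)"
    by (simp only: mult.assoc split)
  also have "\<dots> = ennreal (1 / ?Z) * (\<integral>\<^sup>+x. ennreal ((f x - a)\<^sup>2 * \<phi> x powr (p - 1)) \<partial>?M)"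
    by (rule nn_integral_cmult) measurable
  also have "\<dots> = ennreal (1 / p) * (ennreal (1 / ?Z) * (ennreal p * (\<integral>\<^sup>+x. ennreal ((f x - a)\<^sup>2 * \<phi> x powr (p - 1)) \<partial>?M)))"
  proof -
    have "ennreal (1 / p) * ennreal p = 1" using p by (simp add: ennreal_mult[symmetric])
    moreover have "ennreal (1 / p) * (z * (ennreal p * X)) = (ennreal (1 / p) * ennreal p) * (z * X)" for z X
      by (simp only: mult_ac)
    ultimately show ?thesis by simp
  qed
  also have "\<dots> \<le> ennreal (1 / p) * (ennreal (1 / ?Z) * (\<integral>\<^sup>+x. ennreal (dual_form \<phi> f x * \<phi> x powr p) \<partial>?M))"
    by (intro mult_left_mono a) auto
  also have "(\<integral>\<^sup>+x. ennreal (dual_form \<phi> f x * \<phi> x powr p) \<partial>?M) = (\<integral>\<^sup>+x. ?w x * ennreal (dual_form \<phi> f x * \<phi> x powr (p - \<beta>)) \<partial>?M)"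
    by (simp only: split)
  \<comment> \<open>Here \<open>dual_form\<close> meets the density, and the inequality for lower
    integrals points in the required direction.\<close>
  also have "ennreal (1 / ?Z) * \<dots> \<le> (\<integral>\<^sup>+x. ennreal (dual_form \<phi> f x * \<phi> x powr (p - \<beta>)) \<partial>nu \<Omega> \<phi> \<beta>)"
    unfolding nu_eq by (rule nn_integral_density_ge) (auto simp: space_restrict_space dest: pos)
  finally show ?thesis by (intro exI[of _ a]) (simp add: mult_left_mono)
qed

end

text \<open>The mean minimizes the second moment about a constant, so the constant produced by the
  exhaustion serves without being identified.\<close>

lemma (in finite_measure) variance_le_second_moment:
  fixes f :: "'a \<Rightarrow> real"
  assumes one: "measure M (space M) = 1"
    and [measurable]: "f \<in> borel_measurable M" and f2: "integrable M (\<lambda>x. (f x)\<^sup>2)"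
  shows "ennreal ((\<integral>x. (f x)\<^sup>2 \<partial>M) - (\<integral>x. f x \<partial>M)\<^sup>2) \<le> (\<integral>\<^sup>+x. ennreal ((f x - a)\<^sup>2) \<partial>M)"
proof -
  have f1: "integrable M f" using f2 by (rule square_integrable_imp_integrable[rotated]) measurable
  have eq: "(f x - a)\<^sup>2 = (f x)\<^sup>2 - 2 * a * f x + a\<^sup>2" for x by (simp add: power2_eq_square algebra_simps)
  have "(\<integral>x. (f x)\<^sup>2 \<partial>M) - (\<integral>x. f x \<partial>M)\<^sup>2 \<le> (\<integral>x. (f x)\<^sup>2 \<partial>M) - 2 * a * (\<integral>x. f x \<partial>M) + a\<^sup>2"
    using zero_le_power2[of "(\<integral>x. f x \<partial>M) - a"] by (simp add: power2_eq_square algebra_simps)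
  also have "\<dots> = (\<integral>x. (f x - a)\<^sup>2 \<partial>M)" unfolding eq using f1 f2 by (simp add: one)
  finally have "ennreal ((\<integral>x. (f x)\<^sup>2 \<partial>M) - (\<integral>x. f x \<partial>M)\<^sup>2) \<le> ennreal (\<integral>x. (f x - a)\<^sup>2 \<partial>M)" by (rule ennreal_leI)
  also have "\<dots> = (\<integral>\<^sup>+x. ennreal ((f x - a)\<^sup>2) \<partial>M)"
  proof (rule nn_integral_eq_integral[symmetric])
    show "integrable M (\<lambda>x. (f x - a)\<^sup>2)" unfolding eq using f1 f2 by simp
  qed simp
  finally show ?thesis .
qed

theorem theorem9:
  fixes \<Omega> :: "(real^'n) set" and \<phi> :: "real^'n \<Rightarrow> real"
  assumes "bounded \<Omega>" and "open \<Omega>" and "convex \<Omega>"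
    and "\<forall>x\<in>\<Omega>. \<phi> x > 0"
    and "C2_on \<Omega> \<phi>" and "concave_on \<Omega> \<phi>"
    and "\<forall>x\<in>\<Omega>. \<forall>v. v \<noteq> 0 \<longrightarrow> v \<bullet> ((- hess \<phi> x) *v v) > 0"
  shows "(\<forall>\<beta>::real. \<forall>f::real^'n \<Rightarrow> real.
            \<beta> > -1 \<and> locally_lipschitz_on \<Omega> f \<and> f \<in> borel_measurable (nu \<Omega> \<phi> \<beta>)
            \<and> integrable (nu \<Omega> \<phi> \<beta>) (\<lambda>x. (f x)\<^sup>2) \<longrightarrow>
            ennreal ((\<integral>x. (f x)\<^sup>2 \<partial>(nu \<Omega> \<phi> \<beta>)) - (\<integral>x. f x \<partial>(nu \<Omega> \<phi> \<beta>))\<^sup>2)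
              \<le> ennreal (1 / (\<beta> + 1)) *
                 (\<integral>\<^sup>+x. ennreal (((matrix_inv (- hess \<phi> x) *v grad f x) \<bullet> grad f x) * \<phi> x)
                    \<partial>(nu \<Omega> \<phi> \<beta>)))
       \<and> (\<forall>\<beta>::real. \<forall>f::real^'n \<Rightarrow> real.
            \<beta> > 0 \<and> smooth_on \<Omega> f \<and> bounded (f ` \<Omega>) \<longrightarrow>
            (INF c::real. \<integral>\<^sup>+x. ennreal ((\<bar>f x - c\<bar>)\<^sup>2 / \<phi> x) \<partial>(nu \<Omega> \<phi> \<beta>))
              \<le> ennreal (1 / \<beta>) *
                 (\<integral>\<^sup>+x. ennreal ((matrix_inv (- hess \<phi> x) *v grad f x) \<bullet> grad f x)
                    \<partial>(nu \<Omega> \<phi> \<beta>)))"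
proof -
  let ?q = "\<lambda>f x. (matrix_inv (- hess \<phi> x) *v grad f x) \<bullet> grad f x"
  interpret concave_potential \<Omega> \<phi> by unfold_locales (use assms in auto)
  have space_nu: "space (nu \<Omega> \<phi> \<beta>) = \<Omega>" for \<beta> by (simp add: nu_def space_restrict_space)
  show ?thesis
  proof (intro conjI allI impI; elim conjE)
    fix \<beta> :: real and f :: "real^'n \<Rightarrow> real"
    assume \<beta>: "\<beta> > -1" and f: "locally_lipschitz_on \<Omega> f" and m: "f \<in> borel_measurable (nu \<Omega> \<phi> \<beta>)"
      and f2: "integrable (nu \<Omega> \<phi> \<beta>) (\<lambda>x. (f x)\<^sup>2)"
    show "ennreal ((\<integral>x. (f x)\<^sup>2 \<partial>(nu \<Omega> \<phi> \<beta>)) - (\<integral>x. f x \<partial>(nu \<Omega> \<phi> \<beta>))\<^sup>2)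
       \<le> ennreal (1 / (\<beta> + 1)) *
          (\<integral>\<^sup>+x. ennreal ((?q f x) * \<phi> x) \<partial>(nu \<Omega> \<phi> \<beta>))"
      using nu_null_or_probability[of \<beta>]
    proof
      assume "AE x in nu \<Omega> \<phi> \<beta>. False"
      \<comment> \<open>In the null case the left side is minus a square, which
        \<open>ennreal\<close> truncates to zero.\<close>
      then have "(\<integral>x. (f x)\<^sup>2 \<partial>(nu \<Omega> \<phi> \<beta>)) = 0" by (intro integral_eq_zero_AE) (auto elim: eventually_mono)
      then show ?thesis by (simp add: ennreal_neg)
    next
      assume nu: "finite_measure (nu \<Omega> \<phi> \<beta>) \<and> measure (nu \<Omega> \<phi> \<beta>) (space (nu \<Omega> \<phi> \<beta>)) = 1"
      then interpret finite_measure "nu \<Omega> \<phi> \<beta>" by simp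
      obtain a where a: "(\<integral>\<^sup>+x. ennreal ((f x - a)\<^sup>2 * \<phi> x powr (\<beta> + 1 - 1 - \<beta>)) \<partial>nu \<Omega> \<phi> \<beta>)
         \<le> ennreal (1 / (\<beta> + 1)) * (\<integral>\<^sup>+x. ennreal (dual_form \<phi> f x * \<phi> x powr (\<beta> + 1 - \<beta>)) \<partial>nu \<Omega> \<phi> \<beta>)"
        using nu_weighted_poincare[OF f, of "\<beta> + 1" \<beta>] \<beta> by auto
      note variance_le_second_moment[OF conjunct2[OF nu] m f2, of a]
      also have "(\<integral>\<^sup>+x. ennreal ((f x - a)\<^sup>2) \<partial>nu \<Omega> \<phi> \<beta>)
          = (\<integral>\<^sup>+x. ennreal ((f x - a)\<^sup>2 * \<phi> x powr (\<beta> + 1 - 1 - \<beta>)) \<partial>nu \<Omega> \<phi> \<beta>)"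
        by (intro nn_integral_cong) (auto simp: space_nu dest: pos)
      also note a
      also have "(\<integral>\<^sup>+x. ennreal (dual_form \<phi> f x * \<phi> x powr (\<beta> + 1 - \<beta>)) \<partial>nu \<Omega> \<phi> \<beta>)
          = (\<integral>\<^sup>+x. ennreal ((?q f x) * \<phi> x) \<partial>(nu \<Omega> \<phi> \<beta>))"
        by (intro nn_integral_cong) (auto simp: space_nu dual_form_def dest: pos)
      finally show ?thesis .
    qed
  next
    fix \<beta> :: real and f :: "real^'n \<Rightarrow> real"
    assume \<beta>: "\<beta> > 0" and f: "smooth_on \<Omega> f"
    obtain a where a: "(\<integral>\<^sup>+x. ennreal ((f x - a)\<^sup>2 * \<phi> x powr (\<beta> - 1 - \<beta>)) \<partial>nu \<Omega> \<phi> \<beta>)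
       \<le> ennreal (1 / \<beta>) * (\<integral>\<^sup>+x. ennreal (dual_form \<phi> f x * \<phi> x powr (\<beta> - \<beta>)) \<partial>nu \<Omega> \<phi> \<beta>)"
      using nu_weighted_poincare[OF smooth_on_imp_locally_lipschitz_on[OF f open_\<Omega>] \<beta>, of \<beta>] by blast
    have "(INF c. \<integral>\<^sup>+x. ennreal ((\<bar>f x - c\<bar>)\<^sup>2 / \<phi> x) \<partial>(nu \<Omega> \<phi> \<beta>)) \<le> (\<integral>\<^sup>+x. ennreal ((\<bar>f x - a\<bar>)\<^sup>2 / \<phi> x) \<partial>(nu \<Omega> \<phi> \<beta>))"
      by (rule INF_lower) simp
    also have "\<dots> = (\<integral>\<^sup>+x. ennreal ((f x - a)\<^sup>2 * \<phi> x powr (\<beta> - 1 - \<beta>)) \<partial>nu \<Omega> \<phi> \<beta>)"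
    proof (rule nn_integral_cong)
      fix x assume "x \<in> space (nu \<Omega> \<phi> \<beta>)"
      then have "\<phi> x > 0" using pos by (simp add: space_nu)
      then show "ennreal ((\<bar>f x - a\<bar>)\<^sup>2 / \<phi> x) = ennreal ((f x - a)\<^sup>2 * \<phi> x powr (\<beta> - 1 - \<beta>))"
        by (simp add: powr_minus divide_inverse)
    qed
    also note a
    also have "(\<integral>\<^sup>+x. ennreal (dual_form \<phi> f x * \<phi> x powr (\<beta> - \<beta>)) \<partial>nu \<Omega> \<phi> \<beta>)
        = (\<integral>\<^sup>+x. ennreal (?q f x) \<partial>(nu \<Omega> \<phi> \<beta>))"
      by (intro nn_integral_cong) (auto simp: space_nu dual_form_def dest: pos)
    finally show "(INF c. \<integral>\<^sup>+x. ennreal ((\<bar>f x - c\<bar>)\<^sup>2 / \<phi> x) \<partial>(nu \<Omega> \<phi> \<beta>))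
       \<le> ennreal (1 / \<beta>) * (\<integral>\<^sup>+x. ennreal (?q f x) \<partial>(nu \<Omega> \<phi> \<beta>))" .
  qed
qed

end
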